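(* Let $X$ be a random vector in $\mathbb{R}^d$ and let $Y_1 = \tfrac{1}{\sqrt2} X + \tfrac{1}{\sqrt2} W_0$, where $W_0 \sim \mathcal{N}(0,I)$ is independent of $X$. Let $Y_{k+1} = a_k Y_k + \sqrt{1-a_k^2}\,W_k$ for $k = 1,2,\dots$, with the adaptive stepsizes $a_0 = 1/\sqrt{2}$ and, for $k=1,2,\dots$, $$B_k := \sup_{y\in\mathbb{R}^d} \|\mathrm{cov}(X \mid Y_k = y)\|_{\mathrm{op}}, \qquad \lambda_k := 4 B_k \prod_{\ell=0}^{k-1} a_\ell^2, \qquad a_k^2 = \frac{2\lambda_k+2}{2\lambda_k+3}.$$ Consider any trajectory length $K \ge 1$ such that $\prod_{\ell=0}^{K-1} a_\ell^2 \le \frac{1}{8 B_K}$. Then all of the sampling sub-problems in the collection $\{p_K\}\cup\{p_{k\mid k+1}\}_{k=1}^{K-1}$ are strongly log-concave (SLC) with condition number at most $4$. Consequently, for any distance $D \in \{D_{\mathrm{TV}}, D_{\mathrm{KL}}\}$ and any $\varepsilon>0$, by using any SLC sampler with query complexity $N_{\mathrm{SLC}}$ (with respect to $D$), one can obtain samples from the law of $Y_1$ that are $\varepsilon$-accurate in $D$ using at most $$T(\varepsilon) = \sum_{k=0}^{K} N_{\mathrm{SLC}}\Big(\frac{\varepsilon}{K+1}\Big)$$ queries.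
   Context: The problem arises as follows: given a random vector $X^{\mathrm{data}}$ in $\mathbb{R}^d$ and $\sigma>0$, the goal is to sample from $Z = X^{\mathrm{data}} + \sigma W_0$; with $X := X^{\mathrm{data}}/\sigma$ one has $Y_1 = Z/(\sqrt{2}\,\sigma)$, and this rescaling changes neither $D_{\mathrm{TV}}$ nor $D_{\mathrm{KL}}$, so sampling $Y_1$ is equivalent to sampling $Z$. The $W_k\sim\mathcal{N}(0,I)$ are standard Gaussian vectors in $\mathbb{R}^d$, independent of each other and of $X$. All $B_k$ in use are assumed finite. (Note $B_k$ depends only on the law of $Y_k$, hence on $a_0,\dots,a_{k-1}$, so the recursion is well defined.) $p_k$ is the density of $Y_k$ and $p_{k\mid k+1}$ the conditional density of $Y_k$ given $Y_{k+1}$. $\|\cdot\|_{\mathrm{op}}$ is the operator norm. If $B_K=0$, the condition on $K$ is vacuous. A twice differentiable density $p$ on $\mathbb{R}^d$ is SLC with condition number at most $c$ if there are $0<m'\le M'$ with $M'/m'\le c$ and $m' I \preceq -\nabla^2\log p(x) \preceq M' I$ for all $x$. For the conditional $p_{k\mid k+1}$ this is required of $p_{k\mid k+1}(\cdot\mid y)$ for every $y\in\mathbb{R}^d$, with the same $m',M'$. $D_{\mathrm{TV}}$ is total variation and $D_{\mathrm{KL}}(q,p)=D_{\mathrm{KL}}(q\|p)$ is Kullback–Leibler divergence; a sample with law $q$ is $\varepsilon$-accurate for $p$ in $D$ if $D(q,p)\le\varepsilon$. An SLC sampler with query complexity $N_{\mathrm{SLC}}$ is a procedure which, for any density on $\mathbb{R}^d$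 that is SLC with condition number at most $4$ and any $\delta>0$, outputs a sample whose law is within $\delta$ of that density in $D$, using at most $N_{\mathrm{SLC}}(\delta)$ queries to an oracle for that density (its score $\nabla\log$, and its log-density up to an additive constant if the sampler uses it). The overall procedure is assumed to have such oracle access to the marginal densities $p_k$; access to the backward conditionals follows from $\nabla_y \log p_{k\mid k+1}(y\mid y') = \nabla \log p_k(y) - \frac{a_k}{1-a_k^2}(a_k y - y')$. *)

theory Defs
  imports "HOL-Probability.Probability"
begin

section \<open>Divergences\<close>

definition D_TV :: "'v::euclidean_space measure \<Rightarrow> 'v measure \<Rightarrow> ereal" where
  "D_TV q p = (SUP A\<in>sets borel. ereal \<bar>measure q A - measure p A\<bar>)"

text \<open>
  The library's real-valued \<^const>\<open>KL_divergence\<close> takes the reference measure first and has a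
  junk value when the divergence is infinite.  For probability measures with \<open>q\<close> absolutely
  continuous w.r.t. \<open>p\<close>, the negative part of \<open>log (dq/dp)\<close> is always \<open>q\<close>-integrable, so
  non-integrability means exactly that the divergence is infinite.
\<close>

definition D_KL :: "'v::euclidean_space measure \<Rightarrow> 'v measure \<Rightarrow> ereal" where
  "D_KL q p =
     (if absolutely_continuous p q \<and> integrable q (entropy_density (exp 1) p q)
      then ereal (KL_divergence (exp 1) p q) else \<infinity>)"


section \<open>Laws, conditional laws and densities\<close>

definition std_gaussian :: "'v::euclidean_space measure" where
  "std_gaussian =
     density lborel (\<lambda>x. ennreal ((2 * pi) powr (- real DIM('v) / 2) * exp (- (norm x)\<^sup>2 / 2)))"

text \<open>
  Densities and conditional laws are determined only up to null sets.  Pointwise statements refer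
  to the continuous density and to the weakly continuous regular conditional distribution, which
  are unique (for the latter: when the conditioning variable has full support).
\<close>

definition cont_density :: "'v::euclidean_space measure \<Rightarrow> 'v \<Rightarrow> real" where
  "cont_density \<mu> =
     (THE f. continuous_on UNIV f \<and> (\<forall>x. 0 \<le> f x) \<and> \<mu> = density lborel (\<lambda>x. ennreal (f x)))"

definition is_cond_law ::
  "'m measure \<Rightarrow> ('m \<Rightarrow> 'v::euclidean_space) \<Rightarrow> ('m \<Rightarrow> 'u::euclidean_space) \<Rightarrow> ('u \<Rightarrow> 'v measure) \<Rightarrow> bool"
  where
  "is_cond_law M X Y \<kappa> \<longleftrightarrow>
     \<kappa> \<in> borel \<rightarrow>\<^sub>M prob_algebra borel \<and>
     (\<forall>A\<in>sets borel. \<forall>B\<in>sets borel.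
        emeasure M {\<omega>\<in>space M. X \<omega> \<in> A \<and> Y \<omega> \<in> B} =
          (\<integral>\<^sup>+y\<in>B. emeasure (\<kappa> y) A \<partial>distr M borel Y)) \<and>
     (\<forall>f::'v \<Rightarrow> real. continuous_on UNIV f \<and> bounded (range f) \<longrightarrow>
        continuous_on UNIV (\<lambda>y. \<integral>x. f x \<partial>\<kappa> y))"

definition cond_law ::
  "'m measure \<Rightarrow> ('m \<Rightarrow> 'v::euclidean_space) \<Rightarrow> ('m \<Rightarrow> 'u::euclidean_space) \<Rightarrow> 'u \<Rightarrow> 'v measure" where
  "cond_law M X Y = (THE \<kappa>. is_cond_law M X Y \<kappa>)"

definition rv_density :: "'m measure \<Rightarrow> ('m \<Rightarrow> 'v::euclidean_space) \<Rightarrow> 'v \<Rightarrow> real" where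
  "rv_density M X = cont_density (distr M borel X)"

definition cond_density ::
  "'m measure \<Rightarrow> ('m \<Rightarrow> 'v::euclidean_space) \<Rightarrow> ('m \<Rightarrow> 'u::euclidean_space) \<Rightarrow> 'u \<Rightarrow> 'v \<Rightarrow> real" where
  "cond_density M X Y y = cont_density (cond_law M X Y y)"

text \<open>The covariance matrix as a linear operator, \<open>v \<mapsto> E[(X - EX) (X - EX)\<^sup>T v]\<close>.\<close>

definition cov_op :: "'v::euclidean_space measure \<Rightarrow> 'v \<Rightarrow> 'v" where
  "cov_op \<mu> v = (let c = (\<integral>x. x \<partial>\<mu>) in (\<integral>x. ((x - c) \<bullet> v) *\<^sub>R (x - c) \<partial>\<mu>))"

definition cond_cov_norm ::
  "'m measure \<Rightarrow> ('m \<Rightarrow> 'v::euclidean_space) \<Rightarrow> ('m \<Rightarrow> 'u::euclidean_space) \<Rightarrow> 'u \<Rightarrow> real" where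
  "cond_cov_norm M X Y y = onorm (cov_op (cond_law M X Y y))"


section \<open>Strongly log-concave densities\<close>

definition score :: "('v::euclidean_space \<Rightarrow> real) \<Rightarrow> 'v \<Rightarrow> 'v" where
  "score p x = (THE g. GDERIV (\<lambda>z. ln (p z)) x :> g)"

text \<open>
  Below, \<open>H\<close> is the Hessian of \<open>ln p\<close> at \<open>x\<close>, i.e. the derivative of its gradient.
\<close>

definition slc_between :: "real \<Rightarrow> real \<Rightarrow> ('v::euclidean_space \<Rightarrow> real) \<Rightarrow> bool" where
  "slc_between m' M' p \<longleftrightarrow>
     p \<in> borel_measurable borel \<and> (\<forall>x. 0 < p x) \<and> (\<integral>\<^sup>+x. ennreal (p x) \<partial>lborel) = 1 \<and>
     (\<forall>x. (\<lambda>z. ln (p z)) differentiable (at x)) \<and>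
     (\<forall>x. \<exists>H. (score p has_derivative H) (at x) \<and>
        (\<forall>h. m' * (h \<bullet> h) \<le> - (h \<bullet> H h) \<and> - (h \<bullet> H h) \<le> M' * (h \<bullet> h)))"

definition slc :: "real \<Rightarrow> ('v::euclidean_space \<Rightarrow> real) \<Rightarrow> bool" where
  "slc c p \<longleftrightarrow> (\<exists>m' M'. 0 < m' \<and> m' \<le> M' \<and> M' / m' \<le> c \<and> slc_between m' M' p)"

definition slc_family :: "real \<Rightarrow> ('i \<Rightarrow> 'v::euclidean_space \<Rightarrow> real) \<Rightarrow> bool" where
  "slc_family c P \<longleftrightarrow>
     (\<exists>m' M'. 0 < m' \<and> m' \<le> M' \<and> M' / m' \<le> c \<and> (\<forall>i. slc_between m' M' (P i)))"


section \<open>Randomized procedures with oracle access\<close>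

text \<open>
  A deterministic adaptive procedure is a well-founded tree that either returns an output or asks
  a query and continues according to the answer.  A randomized procedure draws a seed first.
\<close>

datatype ('q, 'r, 'o) query_tree =
    Return 'o
  | Query 'q "'r \<Rightarrow> ('q, 'r, 'o) query_tree"

primrec run :: "('q, 'r, 'o) query_tree \<Rightarrow> ('q \<Rightarrow> 'r) \<Rightarrow> 'o" where
  "run (Return x) orc = x"
| "run (Query q c) orc = run (c (orc q)) orc"

primrec queries :: "('q, 'r, 'o) query_tree \<Rightarrow> ('q \<Rightarrow> 'r) \<Rightarrow> nat" where
  "queries (Return x) orc = 0"
| "queries (Query q c) orc = Suc (queries (c (orc q)) orc)"

primrec bind_tree ::
  "('q, 'r, 'o) query_tree \<Rightarrow> ('o \<Rightarrow> ('q, 'r, 'u) query_tree) \<Rightarrow> ('q, 'r, 'u) query_tree" where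
  "bind_tree (Return x) f = f x"
| "bind_tree (Query q c) f = Query q (\<lambda>r. bind_tree (c r) f)"

text \<open>
  \<open>simulate f g t\<close> runs \<open>t\<close> against another oracle: a query \<open>q\<close> is asked as \<open>f q\<close>, and the answer
  \<open>r\<close> received is handed to \<open>t\<close> as \<open>g q r\<close>.
\<close>

primrec simulate ::
  "('q \<Rightarrow> 'q') \<Rightarrow> ('q \<Rightarrow> 'r' \<Rightarrow> 'r) \<Rightarrow> ('q, 'r, 'o) query_tree \<Rightarrow> ('q', 'r', 'o) query_tree" where
  "simulate f g (Return x) = Return x"
| "simulate f g (Query q c) = Query (f q) (\<lambda>r. simulate f g (c (g q r)))"

record ('w, 'q, 'r, 'o) procedure =
  seed :: "'w measure"
  prog :: "'w \<Rightarrow> ('q, 'r, 'o) query_tree"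

definition output_law ::
  "('w, 'q, 'r, 'v::euclidean_space) procedure \<Rightarrow> ('q \<Rightarrow> 'r) \<Rightarrow> 'v measure" where
  "output_law P orc = distr (seed P) borel (\<lambda>w. run (prog P w) orc)"

definition samples_within ::
  "('v::euclidean_space measure \<Rightarrow> 'v measure \<Rightarrow> ereal) \<Rightarrow> real \<Rightarrow> real \<Rightarrow>
   ('w, 'q, 'r, 'v) procedure \<Rightarrow> ('q \<Rightarrow> 'r) \<Rightarrow> 'v measure \<Rightarrow> bool" where
  "samples_within D \<delta> n P orc \<mu> \<longleftrightarrow>
     prob_space (seed P) \<and>
     (\<lambda>w. run (prog P w) orc) \<in> seed P \<rightarrow>\<^sub>M borel \<and>
     D (output_law P orc) \<mu> \<le> ereal \<delta> \<and>
     (\<forall>w\<in>space (seed P). real (queries (prog P w) orc) \<le> n)"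

text \<open>
  An answer consists of the score and, if \<open>vals\<close> holds, the log-density up to an additive constant;
  for score-only access the second component carries no information.
\<close>

definition density_oracle ::
  "bool \<Rightarrow> ('v::euclidean_space \<Rightarrow> real) \<Rightarrow> ('v \<Rightarrow> 'v \<times> real) \<Rightarrow> bool" where
  "density_oracle vals p orc \<longleftrightarrow>
     (\<exists>c. \<forall>x. orc x = (score p x, if vals then ln (p x) + c else 0))"

text \<open>
  The first conjunct makes explicit the measurability needed to run the sampler on a target that
  depends on a previously drawn random point \<open>z\<close>: its output is then jointly measurable in the seed
  and \<open>z\<close>.
\<close>

definition slc_sampler ::
  "('v::euclidean_space measure \<Rightarrow> 'v measure \<Rightarrow> ereal) \<Rightarrow> bool \<Rightarrow> (real \<Rightarrow> real) \<Rightarrow>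
   (real \<Rightarrow> ('w, 'v, 'v \<times> real, 'v) procedure) \<Rightarrow> bool" where
  "slc_sampler D vals N S \<longleftrightarrow> (\<forall>\<delta>>0.
     (\<forall>G :: 'v \<times> 'v \<Rightarrow> 'v \<times> real. G \<in> borel_measurable borel \<longrightarrow>
        (\<lambda>(w, z). run (prog (S \<delta>) w) (\<lambda>y. G (z, y))) \<in> seed (S \<delta>) \<Otimes>\<^sub>M borel \<rightarrow>\<^sub>M borel) \<and>
     (\<forall>p orc. slc 4 p \<and> density_oracle vals p orc \<longrightarrow>
        samples_within D \<delta> (N \<delta>) (S \<delta>) orc (density lborel (\<lambda>x. ennreal (p x)))))"


section \<open>Sequential sampling with an SLC sampler\<close>

text \<open>
  The overall procedure may query the marginal densities, a query \<open>(k, y)\<close> being answered by the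
  oracle for \<open>p\<^sub>k\<close> at \<open>y\<close>.  By Bayes' rule, up to a constant independent of \<open>y\<close>,
  \<open>ln p\<^sub>k\<^sub>|\<^sub>k\<^sub>+\<^sub>1 (y | y') = ln p\<^sub>k (y) - \<parallel>y' - a y\<parallel>\<^sup>2 / (2 (1 - a\<^sup>2))\<close> with \<open>a = a\<^sub>k\<close>, so each query to the
  conditional costs one query to \<open>p\<^sub>k\<close>.
\<close>

definition backward_answer ::
  "bool \<Rightarrow> real \<Rightarrow> 'v::euclidean_space \<Rightarrow> 'v \<Rightarrow> 'v \<times> real \<Rightarrow> 'v \<times> real" where
  "backward_answer vals a y' y r =
     (fst r - (a / (1 - a\<^sup>2)) *\<^sub>R (a *\<^sub>R y - y'),
      if vals then snd r - (norm (y' - a *\<^sub>R y))\<^sup>2 / (2 * (1 - a\<^sup>2)) else 0)"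

text \<open>
  \<open>descend vals a t j y'\<close> turns a sample \<open>y'\<close> at level \<open>j + 1\<close> into a sample at level \<open>1\<close>, where
  \<open>t k\<close> is the tree used at level \<open>k\<close>.
\<close>

primrec descend ::
  "bool \<Rightarrow> (nat \<Rightarrow> real) \<Rightarrow> (nat \<Rightarrow> ('v::euclidean_space, 'v \<times> real, 'v) query_tree) \<Rightarrow>
   nat \<Rightarrow> 'v \<Rightarrow> (nat \<times> 'v, 'v \<times> real, 'v) query_tree" where
  "descend vals a t 0 y' = Return y'"
| "descend vals a t (Suc j) y' =
     bind_tree (simulate (Pair (Suc j)) (backward_answer vals (a (Suc j)) y') (t (Suc j)))
       (descend vals a t j)"

text \<open>Sample from \<open>p\<^sub>K\<close>, then descend, running \<open>P\<close> with a fresh independent seed at each level.\<close>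

definition sequential_sampler ::
  "bool \<Rightarrow> (nat \<Rightarrow> real) \<Rightarrow> nat \<Rightarrow> ('w, 'v::euclidean_space, 'v \<times> real, 'v) procedure \<Rightarrow>
   (nat \<Rightarrow> 'w, nat \<times> 'v, 'v \<times> real, 'v) procedure" where
  "sequential_sampler vals a K P =
     \<lparr>seed = PiM {1..K} (\<lambda>_. seed P),
      prog = (\<lambda>w. bind_tree (simulate (Pair K) (\<lambda>_ r. r) (prog P (w K)))
                (descend vals a (\<lambda>k. prog P (w k)) (K - 1)))\<rparr>"

end

theory Submission
  imports Defs
begin

text \<open>
  Adding Gaussian noise makes the log-density computable in terms of the posterior.  If
  \<open>Y = c X + s N\<close> with a standard Gaussian \<open>N\<close> independent of \<open>X\<close>, then
  \<open>- \<nabla>\<^sup>2 ln p\<^sub>Y (y) = I / s\<^sup>2 - (c\<^sup>2 / s\<^sup>4) cov (X | Y = y)\<close>.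
  Each \<open>Y k\<close> has this form with \<open>c\<^sup>2\<close> the product of the first \<open>k\<close> squared stepsizes and
  \<open>s\<^sup>2 = 1 - c\<^sup>2 \<ge> 1 / 2\<close>, so \<open>B k\<close> controls how far the Hessian is from \<open>- I / s\<^sup>2\<close>.
  At the last level the stopping condition bounds the covariance term by a quarter of the
  identity term.  For a backward conditional, Bayes' rule adds the Gaussian likelihood of the next
  state, which contributes \<open>(a\<^sup>2 / (1 - a\<^sup>2)) I = (2 \<lambda> + 2) I\<close>; since the covariance
  term is at most \<open>\<lambda>\<close>, all eigenvalues lie between \<open>\<lambda> + 3\<close> and \<open>2 \<lambda> + 4\<close>.
  These steps are \<open>slc_between_noised_density\<close> and \<open>slc_between_backward_density\<close>; they rest on
  \<open>exp_tilt_has_derivative\<close>, which differentiates integrals of exponentials.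

  The sampling guarantee holds because both divergences are subadditive under composition: replacing
  the initial law by one within \<open>\<delta>\<^sub>1\<close> and a kernel by one uniformly within \<open>\<delta>\<^sub>2\<close> costs at most
  \<open>\<delta>\<^sub>1 + \<delta>\<^sub>2\<close> (\<open>D_TV_bind\<close>, \<open>D_KL_bind\<close>).  For the Kullback--Leibler divergence this follows from the
  Gibbs variational principle, which turns the chain rule and data processing into a single
  calculation with bounded test functions.  The backward
  conditionals carry the law of \<open>Y (k + 1)\<close> to the law of \<open>Y k\<close>, so \<open>K\<close> calls of the sampler
  with accuracy \<open>\<epsilon> / (K + 1)\<close> turn a sample at level \<open>K\<close> into one at level \<open>1\<close>.

  Densities and conditional laws enter through definite descriptions, so every computation
  must be preceded by uniqueness: continuous densities agree once they agree almost everywhere, and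
  weakly continuous conditional laws agree because the conditioning variable has a positive
  density (\<open>cont_density_eqI\<close>, \<open>cond_law_eqI\<close>).
\<close>


section \<open>Divergences add up along Markov kernels\<close>

lemma D_TV_le_iff:
  "D_TV q p \<le> ereal \<delta> \<longleftrightarrow> (\<forall>A\<in>sets borel. \<bar>measure q A - measure p A\<bar> \<le> \<delta>)"
  unfolding D_TV_def by (subst SUP_le_iff) auto

lemma layer_cake_unit_interval:
  fixes q :: "'v::euclidean_space measure"
  assumes "prob_space q" and [measurable_cong]: "sets q = sets borel"
    and [measurable]: "F \<in> borel_measurable borel" and "\<And>x. 0 \<le> F x" "\<And>x. F x \<le> 1"
  shows "(\<integral>\<^sup>+x. ennreal (F x) \<partial>q) =
         (\<integral>\<^sup>+t. ennreal (measure q {x. t < F x}) * indicator {0..1} t \<partial>lborel)"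
proof -
  interpret q: prob_space q by fact
  interpret P: pair_sigma_finite lborel q ..
  have sp: "space q = UNIV" using assms(2) by (metis sets_eq_imp_space_eq space_borel)
  have "(\<integral>\<^sup>+x. ennreal (F x) \<partial>q) = (\<integral>\<^sup>+x. (\<integral>\<^sup>+t. indicator {0..<F x} t \<partial>lborel) \<partial>q)"
    using assms(4) by (simp)
  also have "\<dots> = (\<integral>\<^sup>+x. (\<integral>\<^sup>+t. indicator {z. fst z < F (snd z)} (t, x) * indicator {0..1} t \<partial>lborel) \<partial>q)"
    using assms(5) by (intro nn_integral_cong) (auto split: split_indicator intro: less_imp_le order_trans)
  also have "\<dots> = (\<integral>\<^sup>+t. (\<integral>\<^sup>+x. indicator {z. fst z < F (snd z)} (t, x) * indicator {0..1} t \<partial>q) \<partial>lborel)"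
    by (rule P.Fubini') measurable
  also have "\<dots> = (\<integral>\<^sup>+t. ennreal (measure q {x. t < F x}) * indicator {0..1} t \<partial>lborel)"
  proof (intro nn_integral_cong)
    fix t :: real
    have m: "{x. t < F x} \<in> sets q" using assms(2) by measurable
    have "(\<integral>\<^sup>+x. indicator {z. fst z < F (snd z)} (t, x) * indicator {0..1} t \<partial>q)
       = (\<integral>\<^sup>+x. indicator {x. t < F x} x * indicator {0..1} t \<partial>q)"
      by (intro nn_integral_cong) (auto split: split_indicator)
    also have "\<dots> = emeasure q {x. t < F x} * indicator {0..1} t"
      using m by (subst nn_integral_multc) auto
    finally show "(\<integral>\<^sup>+x. indicator {z. fst z < F (snd z)} (t, x) * indicator {0..1} t \<partial>q) =
        ennreal (measure q {x. t < F x}) * indicator {0..1} t"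
      by (simp add: q.emeasure_eq_measure)
  qed
  finally show ?thesis .
qed

text \<open>
  The layer-cake formula writes both integrals as averages, over thresholds in the unit interval, of
  measures of superlevel sets; a uniform bound on sets therefore passes to functions with values
  in the unit interval without a loss in the constant.
\<close>

lemma integral_le_if_measure_le:
  fixes q p :: "'v::euclidean_space measure"
  assumes q: "prob_space q" "sets q = sets borel" and p: "prob_space p" "sets p = sets borel"
    and F[measurable]: "F \<in> borel_measurable borel" and "\<And>x. 0 \<le> F x" "\<And>x. F x \<le> 1"
    and le: "\<And>A. A \<in> sets borel \<Longrightarrow> measure q A \<le> measure p A + \<delta>"
  shows "(\<integral>x. F x \<partial>q) \<le> (\<integral>x. F x \<partial>p) + \<delta>"
proof -
  interpret q: prob_space q by fact
  interpret p: prob_space p by fact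
  have \<delta>: "0 \<le> \<delta>" using le[of "{}"] by simp
  have iq: "integrable q F" using q assms(6,7)
    by (intro q.integrable_const_bound[of _ 1]) (auto simp: measurable_cong_sets[OF q(2) refl])
  have ip: "integrable p F" using p assms(6,7)
    by (intro p.integrable_const_bound[of _ 1]) (auto simp: measurable_cong_sets[OF p(2) refl])
  have "(\<lambda>t. - measure p {x. t < F x}) \<in> borel_measurable borel"
    by (intro borel_measurable_mono monoI) (auto simp: p(2) intro!: p.finite_measure_mono)
  from borel_measurable_uminus[OF this]
  have [measurable]: "(\<lambda>t. measure p {x. t < F x}) \<in> borel_measurable borel" by simp
  have "ennreal (\<integral>x. F x \<partial>q) = (\<integral>\<^sup>+x. ennreal (F x) \<partial>q)"
    using iq assms(6) by (simp add: nn_integral_eq_integral)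
  also have "\<dots> = (\<integral>\<^sup>+t. ennreal (measure q {x. t < F x}) * indicator {0..1} t \<partial>lborel)"
    by (rule layer_cake_unit_interval) fact+
  also have "\<dots> \<le> (\<integral>\<^sup>+t. ennreal (measure p {x. t < F x}) * indicator {0..1} t
                      + ennreal \<delta> * indicator {0..1::real} t \<partial>lborel)"
    using le \<delta> by (intro nn_integral_mono)
      (auto simp: ennreal_plus[symmetric] simp del: ennreal_plus split: split_indicator intro!: ennreal_leI)
  also have "\<dots> = (\<integral>\<^sup>+t. ennreal (measure p {x. t < F x}) * indicator {0..1} t \<partial>lborel) + ennreal \<delta>"
    by (subst nn_integral_add) (auto simp: nn_integral_cmult)
  also have "(\<integral>\<^sup>+t. ennreal (measure p {x. t < F x}) * indicator {0..1} t \<partial>lborel) = (\<integral>\<^sup>+x. ennreal (F x) \<partial>p)"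
    by (rule layer_cake_unit_interval[symmetric]) fact+
  also have "(\<integral>\<^sup>+x. ennreal (F x) \<partial>p) + ennreal \<delta> = ennreal ((\<integral>x. F x \<partial>p) + \<delta>)"
    using ip assms(6) \<delta> by (simp add: nn_integral_eq_integral ennreal_plus)
  finally show ?thesis
    using \<delta> assms(6) by (subst (asm) ennreal_le_iff) (auto intro!: add_nonneg_nonneg integral_nonneg)
qed

text \<open>
  The two replacements are made one after the other.  Exchanging the kernels under \<open>q\<close> costs an
  average of pointwise distances; exchanging \<open>q\<close> for \<open>p\<close> is tested against
  \<open>y \<mapsto> \<kappa>' y A\<close>, a function with values in the unit interval.
\<close>

lemma D_TV_bind:
  fixes q p :: "'u::euclidean_space measure" and \<kappa> \<kappa>' :: "'u \<Rightarrow> 'v::euclidean_space measure"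
  assumes q: "q \<in> space (prob_algebra borel)" and p: "p \<in> space (prob_algebra borel)"
    and \<kappa>: "\<kappa> \<in> borel \<rightarrow>\<^sub>M prob_algebra borel" and \<kappa>': "\<kappa>' \<in> borel \<rightarrow>\<^sub>M prob_algebra borel"
    and D1: "D_TV q p \<le> ereal \<delta>\<^sub>1" and D2: "\<And>y. D_TV (\<kappa> y) (\<kappa>' y) \<le> ereal \<delta>\<^sub>2"
  shows "D_TV (q \<bind> \<kappa>) (p \<bind> \<kappa>') \<le> ereal (\<delta>\<^sub>1 + \<delta>\<^sub>2)"
proof -
  have qp: "prob_space q" "sets q = sets borel" "prob_space p" "sets p = sets borel"
    using q p by (auto simp: space_prob_algebra)
  interpret q: prob_space q by fact
  interpret p: prob_space p by fact
  have K: "prob_space (\<kappa> y)" "prob_space (\<kappa>' y)" for y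
    using measurable_space[OF \<kappa>, of y] measurable_space[OF \<kappa>', of y] by (auto simp: space_prob_algebra)
  show ?thesis unfolding D_TV_le_iff
  proof
    fix A :: "'v set" assume A: "A \<in> sets borel"
    let ?F = "\<lambda>y. measure (\<kappa> y) A" and ?F' = "\<lambda>y. measure (\<kappa>' y) A"
    have [measurable]: "?F \<in> borel_measurable borel" "?F' \<in> borel_measurable borel"
      using measurable_compose[OF \<kappa> measurable_measure_prob_algebra[OF A]]
        measurable_compose[OF \<kappa>' measurable_measure_prob_algebra[OF A]] by auto
    have b: "?F y \<le> 1" "?F' y \<le> 1" for y using K[of y] by (auto intro: prob_space.prob_le_1)
    have eq: "measure (q \<bind> \<kappa>) A = (\<integral>y. ?F y \<partial>q)" "measure (p \<bind> \<kappa>') A = (\<integral>y. ?F' y \<partial>p)"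
      using \<kappa> \<kappa>' A qp
      by (auto intro!: q.measure_bind p.measure_bind measurable_prob_algebraD
          simp: measurable_cong_sets[OF qp(2) refl] measurable_cong_sets[OF qp(4) refl])
    have i: "integrable q ?F" "integrable q ?F'" using b
      by (auto intro!: q.integrable_const_bound[of _ 1] simp: measurable_cong_sets[OF qp(2) refl])
    have "\<bar>(\<integral>y. ?F y \<partial>q) - (\<integral>y. ?F' y \<partial>q)\<bar> = \<bar>\<integral>y. ?F y - ?F' y \<partial>q\<bar>"
      using i by simp
    also have "\<dots> \<le> (\<integral>y. \<bar>?F y - ?F' y\<bar> \<partial>q)" by (rule integral_abs_bound)
    also have "\<dots> \<le> (\<integral>y. \<delta>\<^sub>2 \<partial>q)" using D2 A i
      by (intro integral_mono) (auto simp: D_TV_le_iff)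
    finally have 1: "\<bar>(\<integral>y. ?F y \<partial>q) - (\<integral>y. ?F' y \<partial>q)\<bar> \<le> \<delta>\<^sub>2" by (simp add: q.prob_space)
    have "(\<integral>y. ?F' y \<partial>q) \<le> (\<integral>y. ?F' y \<partial>p) + \<delta>\<^sub>1"
      using D1 b by (intro integral_le_if_measure_le qp) (auto simp: D_TV_le_iff abs_le_iff algebra_simps)
    moreover have "(\<integral>y. ?F' y \<partial>p) \<le> (\<integral>y. ?F' y \<partial>q) + \<delta>\<^sub>1"
      using D1 b by (intro integral_le_if_measure_le qp) (auto simp: D_TV_le_iff abs_le_iff algebra_simps)
    ultimately show "\<bar>measure (q \<bind> \<kappa>) A - measure (p \<bind> \<kappa>') A\<bar> \<le> \<delta>\<^sub>1 + \<delta>\<^sub>2"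
      unfolding eq using 1 by linarith
  qed
qed

lemma D_KL_real_density:
  fixes q p :: "'v::euclidean_space measure"
  assumes q: "prob_space q" "sets q = sets borel" and p: "prob_space p" "sets p = sets borel"
    and ac: "absolutely_continuous p q"
  obtains g where "g \<in> borel_measurable borel" "\<And>x. 0 \<le> g x" "q = density p (\<lambda>x. ennreal (g x))"
    "AE x in q. 0 < g x" "AE x in q. entropy_density (exp 1) p q x = ln (g x)"
proof -
  interpret q: prob_space q by fact
  interpret p: prob_space p by fact
  have qp: "sets q = sets p" using q p by simp
  obtain g where g: "g \<in> borel_measurable p" "AE x in p. RN_deriv p q x = ennreal (g x)"
    "AE x in q. 0 < g x" "\<And>x. 0 \<le> g x"
    using p.real_RN_deriv[OF q.finite_measure_axioms ac qp] by blast
  have d: "density p (\<lambda>x. ennreal (g x)) = q"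
    using p.density_RN_deriv[OF ac qp] g(1,2)
    by (subst density_cong[of _ _ "RN_deriv p q"]) (auto elim: AE_mp)
  have "AE x in p. entropy_density (exp 1) p q x = ln (g x)"
    using g(2) by eventually_elim (simp add: entropy_density_def log_def g)
  then have "AE x in q. entropy_density (exp 1) p q x = ln (g x)"
    by (rule absolutely_continuous_AE[OF qp ac])
  then show ?thesis using that[of g] g d by (auto simp: measurable_cong_sets[OF p(2) refl])
qed

text \<open>
  Easy half of the Gibbs (Donsker--Varadhan) principle: with \<open>g = dq/dp\<close>, the difference of the two
  sides is controlled by \<open>ln t \<le> t - 1\<close> at \<open>t = exp f / (g L)\<close>, \<open>L = \<integral> exp f dp\<close>, whose
  \<open>q\<close>-integral is at most one.
\<close>

lemma gibbs_variational_bound: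
  fixes q p :: "'v::euclidean_space measure"
  assumes q: "prob_space q" "sets q = sets borel" and p: "prob_space p" "sets p = sets borel"
    and D: "D_KL q p \<le> ereal \<delta>"
    and f[measurable]: "f \<in> borel_measurable borel" and bd: "\<And>x. \<bar>f x\<bar> \<le> C"
  shows "(\<integral>x. f x \<partial>q) \<le> \<delta> + ln (\<integral>x. exp (f x) \<partial>p)"
proof -
  interpret q: prob_space q by fact
  interpret p: prob_space p by fact
  note [measurable_cong] = q(2) p(2)
  have ac: "absolutely_continuous p q" and ie: "integrable q (entropy_density (exp 1) p q)"
    and KL: "(\<integral>x. entropy_density (exp 1) p q x \<partial>q) \<le> \<delta>"
    using D by (auto simp: D_KL_def KL_divergence_def split: if_splits)
  obtain g where g[measurable]: "g \<in> borel_measurable borel" and g0: "\<And>x. 0 \<le> g x"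
    and qg: "q = density p (\<lambda>x. ennreal (g x))" and gpos: "AE x in q. 0 < g x"
    and ent: "AE x in q. entropy_density (exp 1) p q x = ln (g x)"
    using D_KL_real_density[OF q p ac] by metis
  have il: "integrable q (\<lambda>x. ln (g x))"
    using ie ent by (subst integrable_cong_AE[of _ _ "entropy_density (exp 1) p q"])
      (auto elim: AE_mp simp: qg)
  have KL': "(\<integral>x. ln (g x) \<partial>q) \<le> \<delta>"
    using KL ent by (subst integral_cong_AE[of _ _ "entropy_density (exp 1) p q"])
      (auto elim: AE_mp simp: qg)
  have if': "integrable q f" using bd by (intro q.integrable_const_bound[of _ C]) auto
  have fC: "f x \<le> C" "- C \<le> f x" for x using bd[of x] by auto
  have iep: "integrable p (\<lambda>x. exp (f x))"
    using fC by (intro p.integrable_const_bound[of _ "exp C"]) auto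
  define L where "L = (\<integral>x. exp (f x) \<partial>p)"
  have "exp (- C) = (\<integral>x. exp (- C) \<partial>p)" by (simp add: p.prob_space)
  also have "\<dots> \<le> L" unfolding L_def using fC iep by (intro integral_mono) auto
  finally have L: "0 < L" by (smt (verit) exp_gt_zero)
  \<comment> \<open>the right-hand side of \<open>ln t \<le> t - 1\<close> at \<open>t = exp f / (g L)\<close>\<close>
  have bnd: "integrable q (\<lambda>x. exp (f x) / g x / L) \<and> (\<integral>x. exp (f x) / g x / L \<partial>q) \<le> 1"
  proof -
    have i: "integrable p (\<lambda>x. g x *\<^sub>R (exp (f x) / g x / L))"
      by (rule Bochner_Integration.integrable_bound[OF integrable_divide[OF iep, of L]])
         (use g0 L in \<open>auto simp: abs_mult\<close>)
    have "(\<integral>x. exp (f x) / g x / L \<partial>q) = (\<integral>x. g x *\<^sub>R (exp (f x) / g x / L) \<partial>p)"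
      unfolding qg using g0 by (intro integral_density) auto
    also have "\<dots> \<le> (\<integral>x. exp (f x) / L \<partial>p)"
      using i iep L g0 by (intro integral_mono) auto
    also have "\<dots> = 1" using L iep by (simp add: L_def)
    finally show ?thesis using i g0 unfolding qg by (subst integrable_density) auto
  qed
  have "(\<integral>x. f x - ln (g x) - ln L \<partial>q) \<le> (\<integral>x. exp (f x) / g x / L - 1 \<partial>q)"
  proof (rule integral_mono_AE)
    show "AE x in q. f x - ln (g x) - ln L \<le> exp (f x) / g x / L - 1"
      using gpos
    proof eventually_elim
      fix x assume "0 < g x"
      then have "f x - ln (g x) - ln L = ln (exp (f x) / g x / L)"
        using L by (simp add: ln_div ln_mult)
      also have "\<dots> \<le> exp (f x) / g x / L - 1"
        using \<open>0 < g x\<close> L by (intro ln_le_minus_one) auto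
      finally show "f x - ln (g x) - ln L \<le> exp (f x) / g x / L - 1" .
    qed
  qed (use if' il bnd in auto)
  also have "\<dots> \<le> 0" using bnd by (simp add: q.prob_space)
  finally have "(\<integral>x. f x \<partial>q) - (\<integral>x. ln (g x) \<partial>q) - ln L \<le> 0"
    using if' il by (simp add: q.prob_space)
  then show ?thesis using KL' by (simp add: L_def)
qed

text \<open>
  The converse half: bounded test functions detect the divergence.  Besides the
  value, absolute continuity and integrability of \<open>ln (dq/dp)\<close> have to be recovered, because
  otherwise \<^const>\<open>D_KL\<close> is infinite.  The test functions are the truncations of \<open>ln (dq/dp)\<close>.
\<close>

lemma D_KL_le_if_gibbs:
  fixes q p :: "'v::euclidean_space measure"
  assumes q: "prob_space q" "sets q = sets borel" and p: "prob_space p" "sets p = sets borel"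
    and var: "\<And>f C. f \<in> borel_measurable borel \<Longrightarrow> (\<And>x. \<bar>f x\<bar> \<le> C) \<Longrightarrow>
      (\<integral>x. f x \<partial>q) \<le> \<delta> + ln (\<integral>x. exp (f x) \<partial>p)"
  shows "D_KL q p \<le> ereal \<delta>"
proof -
  interpret q: prob_space q by fact
  interpret p: prob_space p by fact
  note [measurable_cong] = q(2) p(2)
  have sp: "space q = UNIV" "space p = UNIV"
    using q(2) p(2) by (metis sets_eq_imp_space_eq space_borel)+
  \<comment> \<open>large multiples of the indicator of a \<open>p\<close>-null set are test functions\<close>
  have ac: "absolutely_continuous p q"
    unfolding absolutely_continuous_def
  proof
    fix A assume A: "A \<in> null_sets p"
    then have Ab[measurable]: "A \<in> sets borel" using p(2) by auto
    have "real n * measure q A \<le> \<delta>" for n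
    proof -
      have "(\<integral>x. real n * indicator A x \<partial>q) \<le> \<delta> + ln (\<integral>x. exp (real n * indicator A x) \<partial>p)"
        by (intro var[of _ "real n"]) (auto split: split_indicator)
      also have "(\<integral>x. exp (real n * indicator A x) \<partial>p) = (\<integral>x. 1 \<partial>p)"
      proof (rule integral_cong_AE)
        show "AE x in p. exp (real n * indicator A x) = 1"
          using AE_not_in[OF A] by eventually_elim simp
      qed measurable
      finally show ?thesis using p.prob_space by (simp add: sp)
    qed
    then have "measure q A \<le> 0"
      by (metis ex_less_of_nat_mult linorder_not_less)
    then show "A \<in> null_sets q"
      using Ab q(2) by (intro null_setsI) (auto simp: q.emeasure_eq_measure measure_le_0_iff)
  qed
  obtain g where g[measurable]: "g \<in> borel_measurable borel" and g0: "\<And>x. 0 \<le> g x"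
    and qg: "q = density p (\<lambda>x. ennreal (g x))" and gpos: "AE x in q. 0 < g x"
    and ent: "AE x in q. entropy_density (exp 1) p q x = ln (g x)"
    using D_KL_real_density[OF q p ac] by metis
  have igp: "integrable p g \<and> (\<integral>x. g x \<partial>p) = 1"
  proof -
    have "(\<integral>\<^sup>+x. ennreal (g x) \<partial>p) = emeasure q (space q)"
      unfolding qg by (simp add: emeasure_density sp)
    then have "(\<integral>\<^sup>+x. ennreal (g x) \<partial>p) = 1" by (simp add: q.emeasure_space_1)
    then show ?thesis using g0 nn_integral_eq_integrable[of g p 1] by (auto simp: p(2) cong: measurable_cong_sets)
  qed
  \<comment> \<open>at zeros of \<open>g\<close> the default \<open>ln 0 = 0\<close> would spoil \<open>exp (h n x) \<le> g x + exp (- n)\<close>\<close>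
  define h where "h n x = (if g x = 0 then - real n else max (- real n) (min (real n) (ln (g x))))" for n x
  have [measurable]: "h n \<in> borel_measurable borel" for n unfolding h_def by measurable
  have hb: "\<bar>h n x\<bar> \<le> real n" for n x unfolding h_def by auto
  have ih: "integrable q (h n)" for n using hb by (intro q.integrable_const_bound[of _ "real n"]) auto
  \<comment> \<open>the truncated log-density as a test function\<close>
  have hle: "(\<integral>x. h n x \<partial>q) \<le> \<delta> + ln (1 + exp (- real n))" for n
  proof -
    have ieh: "integrable p (\<lambda>x. exp (h n x))"
      using hb[of n] by (intro p.integrable_const_bound[of _ "exp (real n)"]) (auto simp: abs_le_iff)
    have hg: "exp (h n x) \<le> g x + exp (- real n)" for x
    proof (cases "g x = 0 \<or> ln (g x) \<le> - real n")
      case True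
      then have "h n x = - real n" unfolding h_def by auto
      then show ?thesis using g0 by simp
    next
      case False
      then have "h n x \<le> ln (g x)" "0 < g x" unfolding h_def using g0[of x] by auto
      then have "exp (h n x) \<le> g x" by (metis exp_ln exp_le_cancel_iff)
      then show ?thesis by (simp add: add_increasing2)
    qed
    have "exp (- real n) = (\<integral>x. exp (- real n) \<partial>p)" by (simp add: p.prob_space)
    also have "\<dots> \<le> (\<integral>x. exp (h n x) \<partial>p)"
      using ieh hb[of n] by (intro integral_mono) (auto simp: abs_le_iff minus_le_iff)
    finally have pos: "0 < (\<integral>x. exp (h n x) \<partial>p)" by (smt (verit) exp_gt_zero)
    have "(\<integral>x. exp (h n x) \<partial>p) \<le> (\<integral>x. g x + exp (- real n) \<partial>p)"
      using ieh igp hg by (intro integral_mono) auto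
    also have "\<dots> = 1 + exp (- real n)" using igp by (simp add: p.prob_space)
    finally have "ln (\<integral>x. exp (h n x) \<partial>p) \<le> ln (1 + exp (- real n))" using pos by simp
    moreover have "(\<integral>x. h n x \<partial>q) \<le> \<delta> + ln (\<integral>x. exp (h n x) \<partial>p)" using hb by (intro var) auto
    ultimately show ?thesis by simp
  qed
  define m where "m x = max 0 (- ln (g x))" for x
  have [measurable]: "m \<in> borel_measurable borel" unfolding m_def by measurable
  \<comment> \<open>the negative part of \<open>ln g\<close> is harmless because \<open>t ln (1 / t) \<le> 1\<close>\<close>
  have im: "integrable q m \<and> (\<integral>x. m x \<partial>q) \<le> 1"
  proof -
    have tl: "g x * m x \<le> 1" for x
    proof (cases "0 < g x")
      case True
      have "- ln (g x) = ln (1 / g x)" using True by (simp add: ln_div)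
      also have "\<dots> \<le> 1 / g x - 1" using True by (intro ln_le_minus_one) auto
      also have "\<dots> \<le> 1 / g x" by simp
      finally have "m x \<le> 1 / g x" using True by (auto simp: m_def)
      then have "g x * m x \<le> g x * (1 / g x)" using True by (intro mult_left_mono) auto
      then show ?thesis using True by simp
    next
      case False
      then show ?thesis using g0[of x] by auto
    qed
    have mn: "0 \<le> g x * m x" for x using g0[of x] by (simp add: m_def)
    have i: "integrable p (\<lambda>x. g x *\<^sub>R m x)"
      using tl mn by (intro p.integrable_const_bound[of _ 1]) auto
    have "(\<integral>x. m x \<partial>q) = (\<integral>x. g x *\<^sub>R m x \<partial>p)"
      unfolding qg using g0 by (intro integral_density) auto
    also have "\<dots> \<le> (\<integral>x. 1 \<partial>p)" using i tl by (intro integral_mono) auto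
    also have "\<dots> = 1" by (simp add: p.prob_space)
    finally show ?thesis using i g0 unfolding qg by (subst integrable_density) auto
  qed
  have hm: "max 0 (h n x) \<le> h n x + m x" if "0 < g x" for n x
    using that unfolding h_def m_def by auto
  have lim: "h n x = ln (g x)" if "0 < g x" "\<bar>ln (g x)\<bar> \<le> real n" for n x
    using that unfolding h_def by auto
  have evlim: "eventually (\<lambda>n. h n x = ln (g x)) sequentially" if "0 < g x" for x
    using eventually_ge_at_top[of "nat \<lceil>\<bar>ln (g x)\<bar>\<rceil>"]
    by eventually_elim (use that in \<open>auto intro!: lim simp: nat_le_iff ceiling_le_iff\<close>)
  \<comment> \<open>Fatou's lemma along the truncations bounds the positive part.\<close>
  have ipos: "(\<integral>\<^sup>+x. ennreal (max 0 (ln (g x))) \<partial>q) < \<infinity>"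
  proof -
    have "(\<integral>\<^sup>+x. ennreal (max 0 (ln (g x))) \<partial>q) = (\<integral>\<^sup>+x. liminf (\<lambda>n. ennreal (max 0 (h n x))) \<partial>q)"
    proof (rule nn_integral_cong_AE, use gpos in eventually_elim)
      fix x assume "0 < g x"
      have "(\<lambda>n. ennreal (max 0 (h n x))) \<longlonglongrightarrow> ennreal (max 0 (ln (g x)))"
        using evlim[OF \<open>0 < g x\<close>] by (intro tendsto_eventually) (auto elim: eventually_mono)
      then show "ennreal (max 0 (ln (g x))) = liminf (\<lambda>n. ennreal (max 0 (h n x)))"
        by (simp add: lim_imp_Liminf)
    qed
    also have "\<dots> \<le> liminf (\<lambda>n. \<integral>\<^sup>+x. ennreal (max 0 (h n x)) \<partial>q)"
      by (rule nn_integral_liminf) auto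
    also have "\<dots> \<le> liminf (\<lambda>n::nat. ennreal (\<delta> + ln 2 + 1))"
    proof (intro Liminf_mono always_eventually allI)
      fix n
      have im0: "integrable q (\<lambda>x. max 0 (h n x))" using ih by auto
      have "(\<integral>x. max 0 (h n x) \<partial>q) \<le> (\<integral>x. h n x + m x \<partial>q)"
        using im0 ih im gpos hm by (intro integral_mono_AE) (auto elim: AE_mp)
      also have "\<dots> \<le> \<delta> + ln (1 + exp (- real n)) + 1" using ih im hle[of n] by simp
      also have "ln (1 + exp (- real n)) \<le> ln 2" by (intro ln_mono) (auto intro: add_pos_pos)
      finally show "(\<integral>\<^sup>+x. ennreal (max 0 (h n x)) \<partial>q) \<le> ennreal (\<delta> + ln 2 + 1)"
        using im0 by (subst nn_integral_eq_integral) (auto intro: ennreal_leI)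
    qed
    also have "\<dots> < \<infinity>" by (simp add: Liminf_const)
    finally show ?thesis .
  qed
  have il: "integrable q (\<lambda>x. ln (g x))"
  proof -
    have "integrable q (\<lambda>x. max 0 (ln (g x)))"
      using ipos by (intro integrableI_nonneg) auto
    then have "integrable q (\<lambda>x. max 0 (ln (g x)) - m x)" using im by auto
    then show ?thesis by (rule Bochner_Integration.integrable_bound) (auto simp: m_def)
  qed
  have "(\<lambda>n. \<integral>x. h n x \<partial>q) \<longlonglongrightarrow> (\<integral>x. ln (g x) \<partial>q)"
  proof (rule integral_dominated_convergence[where w="\<lambda>x. \<bar>ln (g x)\<bar>"])
    show "AE x in q. (\<lambda>n. h n x) \<longlonglongrightarrow> ln (g x)"
      using gpos by eventually_elim (intro tendsto_eventually evlim)
    show "AE x in q. norm (h n x) \<le> \<bar>ln (g x)\<bar>" for n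
      using gpos by eventually_elim (auto simp: h_def)
  qed (use il in auto)
  moreover have "(\<lambda>n. \<delta> + ln (1 + exp (- real n))) \<longlonglongrightarrow> \<delta> + ln (1 + 0)"
    by (intro tendsto_intros filterlim_compose[OF exp_at_bot] filterlim_uminus_at_bot_at_top[THEN filterlim_compose] filterlim_real_sequentially) auto
  ultimately have le: "(\<integral>x. ln (g x) \<partial>q) \<le> \<delta>"
    using hle by (auto dest: LIMSEQ_le)
  have "integrable q (entropy_density (exp 1) p q)"
    using il ent by (subst integrable_cong_AE[of _ _ "\<lambda>x. ln (g x)"]) (auto simp: q(2) p(2) cong: measurable_cong_sets)
  moreover have "KL_divergence (exp 1) p q \<le> \<delta>"
    using le ent unfolding KL_divergence_def
    by (subst integral_cong_AE[of _ _ "\<lambda>x. ln (g x)"]) (auto simp: q(2) p(2) cong: measurable_cong_sets)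
  ultimately show ?thesis using ac by (simp add: D_KL_def)
qed

lemma integral_bind_bounded:
  assumes q: "q \<in> space (prob_algebra borel)" and \<kappa>: "\<kappa> \<in> borel \<rightarrow>\<^sub>M prob_algebra borel"
    and f[measurable]: "f \<in> borel_measurable borel" and bd: "\<And>x. \<bar>f x :: real\<bar> \<le> C"
  shows "(\<integral>x. f x \<partial>(q \<bind> \<kappa>)) = (\<integral>y. \<integral>x. f x \<partial>\<kappa> y \<partial>q)"
proof -
  interpret q: prob_space q using q by (simp add: space_prob_algebra)
  have qs: "sets q = sets borel" using q by (simp add: space_prob_algebra)
  show ?thesis
  proof (rule integral_bind[where K=borel and B=C and B'=1])
    show "\<kappa> \<in> q \<rightarrow>\<^sub>M subprob_algebra borel"
      using measurable_prob_algebraD[OF \<kappa>] by (simp add: measurable_cong_sets[OF qs refl])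
    show "AE x in q. emeasure (\<kappa> x) (space (\<kappa> x)) \<le> ennreal 1"
      using measurable_space[OF \<kappa>] by (auto simp: space_prob_algebra prob_space.emeasure_space_1)
  qed (use bd f in \<open>auto intro: q.finite_measure_axioms\<close>)
qed

text \<open>
  Given a test function \<open>f\<close>, the principle is applied to the kernels with \<open>f\<close> and then to \<open>q\<close> and
  \<open>p\<close> with \<open>ln \<integral> exp f d\<kappa>'\<close>.  The logarithm and the exponential cancel, leaving the
  bound for the composed measures.
\<close>

lemma D_KL_bind:
  fixes q p :: "'u::euclidean_space measure" and \<kappa> \<kappa>' :: "'u \<Rightarrow> 'v::euclidean_space measure"
  assumes q: "q \<in> space (prob_algebra borel)" and p: "p \<in> space (prob_algebra borel)"
    and \<kappa>: "\<kappa> \<in> borel \<rightarrow>\<^sub>M prob_algebra borel" and \<kappa>': "\<kappa>' \<in> borel \<rightarrow>\<^sub>M prob_algebra borel"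
    and D1: "D_KL q p \<le> ereal \<delta>\<^sub>1" and D2: "\<And>y. D_KL (\<kappa> y) (\<kappa>' y) \<le> ereal \<delta>\<^sub>2"
  shows "D_KL (q \<bind> \<kappa>) (p \<bind> \<kappa>') \<le> ereal (\<delta>\<^sub>1 + \<delta>\<^sub>2)"
proof (rule D_KL_le_if_gibbs)
  have qp: "prob_space q" "sets q = sets borel" "prob_space p" "sets p = sets borel"
    using q p by (auto simp: space_prob_algebra)
  interpret q: prob_space q by fact
  interpret p: prob_space p by fact
  note [measurable_cong] = qp(2,4)
  have K: "prob_space (\<kappa> y)" "prob_space (\<kappa>' y)" "sets (\<kappa> y) = sets borel" "sets (\<kappa>' y) = sets borel" for y
    using measurable_space[OF \<kappa>, of y] measurable_space[OF \<kappa>', of y] by (auto simp: space_prob_algebra)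
  show "prob_space (q \<bind> \<kappa>)" "sets (q \<bind> \<kappa>) = sets borel" "prob_space (p \<bind> \<kappa>')" "sets (p \<bind> \<kappa>') = sets borel"
    using prob_space_bind'[OF q \<kappa>] sets_bind'[OF q \<kappa>] prob_space_bind'[OF p \<kappa>'] sets_bind'[OF p \<kappa>'] by auto
  fix f :: "'v \<Rightarrow> real" and C
  assume f[measurable]: "f \<in> borel_measurable borel" and bd: "\<And>x. \<bar>f x\<bar> \<le> C"
  have fC: "f x \<le> C" "- C \<le> f x" for x using bd[of x] by auto
  have bde: "exp (f x) \<le> exp C" "exp (- C) \<le> exp (f x)" for x using fC[of x] by auto
  define Z where "Z y = (\<integral>x. exp (f x) \<partial>\<kappa>' y)" for y
  have Zb: "exp (- C) \<le> Z y" "Z y \<le> exp C" for y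
  proof -
    interpret k: prob_space "\<kappa>' y" by (rule K)
    have i: "integrable (\<kappa>' y) (\<lambda>x. exp (f x))" using bde
      by (intro k.integrable_const_bound[of _ "exp C"]) (auto simp: measurable_cong_sets[OF K(4) refl])
    have "exp (- C) = (\<integral>x. exp (- C) \<partial>\<kappa>' y)" by (simp add: k.prob_space)
    also have "\<dots> \<le> Z y" unfolding Z_def using i bde by (intro integral_mono) auto
    finally show "exp (- C) \<le> Z y" .
    have "Z y \<le> (\<integral>x. exp C \<partial>\<kappa>' y)" unfolding Z_def using i bde by (intro integral_mono) auto
    then show "Z y \<le> exp C" by (simp add: k.prob_space)
  qed
  have Zpos: "0 < Z y" for y using Zb[of y] by (smt (verit) exp_gt_zero)
  have [measurable]: "Z \<in> borel_measurable borel" unfolding Z_def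
    using measurable_prob_algebraD[OF \<kappa>'] by measurable
  have mI: "(\<lambda>y. \<integral>x. f x \<partial>\<kappa> y) \<in> borel_measurable borel"
    using measurable_prob_algebraD[OF \<kappa>] by measurable
  have "- C \<le> C" using fC[of 0] by linarith
  then have lnZb: "\<bar>ln (Z y)\<bar> \<le> C" for y
    using Zb[of y] Zpos[of y] by (smt (verit) ln_exp ln_le_cancel_iff exp_gt_zero)
  have ilZ: "integrable q (\<lambda>y. ln (Z y))" using lnZb by (intro q.integrable_const_bound[of _ C]) auto
  have step: "(\<integral>x. f x \<partial>\<kappa> y) \<le> \<delta>\<^sub>2 + ln (Z y)" for y
    unfolding Z_def by (rule gibbs_variational_bound[OF K(1,3) K(2,4) D2 f bd])
  have "\<bar>\<integral>x. f x \<partial>\<kappa> y\<bar> \<le> C" for y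
  proof -
    interpret k: prob_space "\<kappa> y" by (rule K)
    have C: "0 \<le> C" using bd[of 0] by linarith
    have "\<bar>\<integral>x. f x \<partial>\<kappa> y\<bar> \<le> (\<integral>x. \<bar>f x\<bar> \<partial>\<kappa> y)" by (rule integral_abs_bound)
    also have "\<dots> \<le> (\<integral>x. C \<partial>\<kappa> y)" using bd C
      by (intro integral_mono k.integrable_const_bound[of _ C]) (auto simp: measurable_cong_sets[OF K(3) refl])
    finally show ?thesis by (simp add: k.prob_space)
  qed
  then have iq: "integrable q (\<lambda>y. \<integral>x. f x \<partial>\<kappa> y)" using mI
    by (intro q.integrable_const_bound[of _ C]) auto
  have "(\<integral>x. f x \<partial>(q \<bind> \<kappa>)) = (\<integral>y. \<integral>x. f x \<partial>\<kappa> y \<partial>q)"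
    by (rule integral_bind_bounded[OF q \<kappa> f bd])
  also have "\<dots> \<le> (\<integral>y. \<delta>\<^sub>2 + ln (Z y) \<partial>q)"
    using iq ilZ step by (intro integral_mono) auto
  also have "\<dots> = \<delta>\<^sub>2 + (\<integral>y. ln (Z y) \<partial>q)" using ilZ by (simp add: q.prob_space)
  also have "(\<integral>y. ln (Z y) \<partial>q) \<le> \<delta>\<^sub>1 + ln (\<integral>y. exp (ln (Z y)) \<partial>p)"
    by (rule gibbs_variational_bound[OF qp D1 _ lnZb]) measurable
  also have "(\<integral>y. exp (ln (Z y)) \<partial>p) = (\<integral>y. Z y \<partial>p)" using Zpos by simp
  also have "\<dots> = (\<integral>x. exp (f x) \<partial>(p \<bind> \<kappa>'))" unfolding Z_def
    using bde by (intro integral_bind_bounded[OF p \<kappa>', symmetric, of _ "exp C"]) auto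
  finally show "(\<integral>x. f x \<partial>(q \<bind> \<kappa>)) \<le> \<delta>\<^sub>1 + \<delta>\<^sub>2 + ln (\<integral>x. exp (f x) \<partial>(p \<bind> \<kappa>'))" by simp
qed

section \<open>Running the sequential sampler\<close>

text \<open>
  What the analysis of the sequential sampler needs of a divergence.
\<close>

definition bind_stable :: "('v::euclidean_space measure \<Rightarrow> 'v measure \<Rightarrow> ereal) \<Rightarrow> bool" where
  "bind_stable D \<longleftrightarrow> (\<forall>q p \<kappa> \<kappa>' \<delta>\<^sub>1 \<delta>\<^sub>2.
     q \<in> space (prob_algebra borel) \<and> p \<in> space (prob_algebra borel) \<and>
     \<kappa> \<in> borel \<rightarrow>\<^sub>M prob_algebra borel \<and> \<kappa>' \<in> borel \<rightarrow>\<^sub>M prob_algebra borel \<and>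
     D q p \<le> ereal \<delta>\<^sub>1 \<and> (\<forall>y. D (\<kappa> y) (\<kappa>' y) \<le> ereal \<delta>\<^sub>2) \<longrightarrow>
     D (q \<bind> \<kappa>) (p \<bind> \<kappa>') \<le> ereal (\<delta>\<^sub>1 + \<delta>\<^sub>2))"

lemma bind_stable_TV_KL: "D \<in> {D_TV, D_KL} \<Longrightarrow> bind_stable D"
  unfolding bind_stable_def by (auto intro: D_TV_bind D_KL_bind)

lemma run_bind_tree: "run (bind_tree t f) orc = run (f (run t orc)) orc"
  by (induction t) auto

lemma queries_bind_tree:
  "queries (bind_tree t f) orc = queries t orc + queries (f (run t orc)) orc"
  by (induction t) auto

lemma run_simulate: "run (simulate f g t) orc = run t (\<lambda>q. g q (orc (f q)))"
  by (induction t) auto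

lemma queries_simulate: "queries (simulate f g t) orc = queries t (\<lambda>q. g q (orc (f q)))"
  by (induction t) auto

text \<open>
  The state after \<open>j\<close> backward steps, as a function of the seeds: \<open>R k u y\<close> is the output of the
  sampler at level \<open>k\<close> with seed \<open>u\<close> when the previous state is \<open>y\<close>.  It starts at level \<open>K\<close>, so
  after \<open>j\<close> steps the level is \<open>K - j\<close> and only the seeds from \<open>K - j\<close> to \<open>K\<close> have been used.
\<close>

primrec chain :: "(nat \<Rightarrow> 'w \<Rightarrow> 'v \<Rightarrow> 'v) \<Rightarrow> ('w \<Rightarrow> 'v) \<Rightarrow> nat \<Rightarrow> nat \<Rightarrow> (nat \<Rightarrow> 'w) \<Rightarrow> 'v" where
  "chain R R\<^sub>0 K 0 w = R\<^sub>0 (w K)"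
| "chain R R\<^sub>0 K (Suc j) w = R (K - Suc j) (w (K - Suc j)) (chain R R\<^sub>0 K j w)"

lemma chain_cong:
  "j < K \<Longrightarrow> (\<And>i. K - j \<le> i \<Longrightarrow> i \<le> K \<Longrightarrow> w i = w' i) \<Longrightarrow> chain R R\<^sub>0 K j w = chain R R\<^sub>0 K j w'"
  by (induction j) auto

lemma measurable_chain:
  assumes R: "\<And>k. 1 \<le> k \<Longrightarrow> k < K \<Longrightarrow> (\<lambda>(u, y). R k u y) \<in> U \<Otimes>\<^sub>M borel \<rightarrow>\<^sub>M borel"
    and R0: "R\<^sub>0 \<in> U \<rightarrow>\<^sub>M borel"
    and "j < K"
  shows "chain R R\<^sub>0 K j \<in> PiM {1..K} (\<lambda>_. U) \<rightarrow>\<^sub>M borel"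
  using \<open>j < K\<close>
proof (induction j)
  case 0
  have "(\<lambda>w. w K) \<in> PiM {1..K} (\<lambda>_. U) \<rightarrow>\<^sub>M U" using 0 by (intro measurable_component_singleton) auto
  from measurable_compose[OF this R0] show ?case by (simp add: fun_eq_iff cong: measurable_cong)
next
  case (Suc j)
  have "(\<lambda>w. w (K - Suc j)) \<in> PiM {1..K} (\<lambda>_. U) \<rightarrow>\<^sub>M U"
    using Suc by (intro measurable_component_singleton) auto
  then have "(\<lambda>w. (w (K - Suc j), chain R R\<^sub>0 K j w)) \<in> PiM {1..K} (\<lambda>_. U) \<rightarrow>\<^sub>M U \<Otimes>\<^sub>M borel"
    using Suc by (intro measurable_Pair) auto
  from measurable_compose[OF this R[of "K - Suc j"]] Suc show ?case by simp
qed

text \<open>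
  The seed of the next step is independent of the current state; Fubini's theorem, which splits
  off this single coordinate of the product measure, turns the step into a kernel.
\<close>

lemma distr_chain_Suc:
  assumes U: "prob_space U"
    and R: "\<And>k. 1 \<le> k \<Longrightarrow> k < K \<Longrightarrow> (\<lambda>(u, y). R k u y) \<in> U \<Otimes>\<^sub>M (borel :: 'v::euclidean_space measure) \<rightarrow>\<^sub>M borel"
    and R0: "R\<^sub>0 \<in> U \<rightarrow>\<^sub>M borel" and j: "Suc j < K"
  shows "distr (PiM {1..K} (\<lambda>_. U)) borel (chain R R\<^sub>0 K (Suc j)) =
         distr (PiM {1..K} (\<lambda>_. U)) borel (chain R R\<^sub>0 K j) \<bind>
           (\<lambda>y. distr U borel (\<lambda>u. R (K - Suc j) u y))" (is "?L = Giry_Monad.bind ?q ?\<kappa>")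
proof -
  define k where "k = K - Suc j"
  interpret U: prob_space U by fact
  interpret P: product_prob_space "\<lambda>_::nat. U" by standard
  let ?P = "PiM {1..K} (\<lambda>_. U)" and ?P' = "PiM ({1..K} - {k}) (\<lambda>_. U)"
  have k: "k \<in> {1..K}" using j unfolding k_def by auto
  have ins: "insert k ({1..K} - {k}) = {1..K}" using k by auto
  have Rm[measurable]: "(\<lambda>(u, y). R k u y) \<in> U \<Otimes>\<^sub>M borel \<rightarrow>\<^sub>M borel" using k by (intro R) (auto simp: k_def)
  have mch: "chain R R\<^sub>0 K j \<in> ?P \<rightarrow>\<^sub>M borel" "chain R R\<^sub>0 K (Suc j) \<in> ?P \<rightarrow>\<^sub>M borel"
    using measurable_chain[of K R U R\<^sub>0 j] measurable_chain[of K R U R\<^sub>0 "Suc j"] R R0 j by auto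
  interpret PP: prob_space ?P by (rule prob_space_PiM) (rule U)
  have pq: "?q \<in> space (prob_algebra borel)"
    using PP.prob_space_distr[OF mch(1)] by (simp add: space_prob_algebra)
  have mR: "(\<lambda>(y, u). R k u y) \<in> borel \<Otimes>\<^sub>M U \<rightarrow>\<^sub>M borel" by measurable
  have \<kappa>: "?\<kappa> \<in> borel \<rightarrow>\<^sub>M prob_algebra borel"
    unfolding k_def[symmetric]
    by (rule measurable_distr_prob_space2[OF _ mR]) (simp add: space_prob_algebra U)
  \<comment> \<open>the state reached after \<open>j\<close> steps does not depend on the fresh seed\<close>
  have indep: "chain R R\<^sub>0 K j (w(k := u)) = chain R R\<^sub>0 K j w" for w u
    using j unfolding k_def by (intro chain_cong) auto
  have fub: "(\<integral>\<^sup>+w. f w \<partial>?P) = (\<integral>\<^sup>+w. (\<integral>\<^sup>+u. f (w(k := u)) \<partial>U) \<partial>?P')"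
    if "f \<in> borel_measurable ?P" for f
    using P.product_nn_integral_insert[of "{1..K} - {k}" k f] that unfolding ins by simp
  show ?thesis
  proof (rule measure_eqI)
    show "sets ?L = sets (?q \<bind> ?\<kappa>)" using sets_bind'[OF pq \<kappa>] by simp
    fix A :: "'v set" assume "A \<in> sets ?L"
    then have A[measurable]: "A \<in> sets borel" by simp
    have em: "emeasure (distr N borel g) A = (\<integral>\<^sup>+w. indicator A (g w) \<partial>N)"
      if "g \<in> N \<rightarrow>\<^sub>M borel" for N and g :: "'x \<Rightarrow> 'v"
      using nn_integral_distr[OF that, of "indicator A"] by simp
    have mk: "(\<lambda>y. emeasure (distr U borel (\<lambda>u. R k u y)) A) \<in> borel_measurable borel"
      using measurable_emeasure_kernel[OF measurable_prob_algebraD[OF \<kappa>] A] unfolding k_def .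
    have "emeasure ?L A = (\<integral>\<^sup>+w. indicator A (chain R R\<^sub>0 K (Suc j) w) \<partial>?P)"
      by (rule em[OF mch(2)])
    also have "\<dots> = (\<integral>\<^sup>+w. (\<integral>\<^sup>+u. indicator A (R k u (chain R R\<^sub>0 K j w)) \<partial>U) \<partial>?P')"
      by (subst fub[OF measurable_compose[OF mch(2) borel_measurable_indicator[OF A]]])
         (simp add: indep k_def[symmetric])
    also have "\<dots> = (\<integral>\<^sup>+w. emeasure (distr U borel (\<lambda>u. R k u (chain R R\<^sub>0 K j w))) A \<partial>?P')"
    proof (intro nn_integral_cong)
      fix w
      have "(\<lambda>u. R k u (chain R R\<^sub>0 K j w)) \<in> U \<rightarrow>\<^sub>M borel" by measurable
      then show "(\<integral>\<^sup>+u. indicator A (R k u (chain R R\<^sub>0 K j w)) \<partial>U) =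
          emeasure (distr U borel (\<lambda>u. R k u (chain R R\<^sub>0 K j w))) A"
        by (rule em[symmetric])
    qed
    also have "\<dots> = (\<integral>\<^sup>+w. emeasure (distr U borel (\<lambda>u. R k u (chain R R\<^sub>0 K j w))) A \<partial>?P)"
      using measurable_compose[OF mch(1) mk]
      by (subst fub) (auto simp: indep U.emeasure_space_1)
    also have "\<dots> = (\<integral>\<^sup>+y. emeasure (distr U borel (\<lambda>u. R k u y)) A \<partial>?q)"
      using mch mk by (subst nn_integral_distr) auto
    also have "\<dots> = emeasure (?q \<bind> ?\<kappa>) A"
      using emeasure_bind_prob_algebra[OF pq \<kappa> A] unfolding k_def by simp
    finally show "emeasure ?L A = emeasure (?q \<bind> ?\<kappa>) A" .
  qed
qed


lemma chain_law_within:
  fixes p :: "nat \<Rightarrow> 'v::euclidean_space measure"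
  assumes D: "bind_stable D" and U: "prob_space U"
    and R: "\<And>k. 1 \<le> k \<Longrightarrow> k < K \<Longrightarrow> (\<lambda>(u, y). R k u y) \<in> U \<Otimes>\<^sub>M borel \<rightarrow>\<^sub>M borel"
    and R0: "R\<^sub>0 \<in> U \<rightarrow>\<^sub>M borel"
    and p: "\<And>k. 1 \<le> k \<Longrightarrow> k \<le> K \<Longrightarrow> p k \<in> space (prob_algebra borel)"
    and \<kappa>: "\<And>k. 1 \<le> k \<Longrightarrow> k < K \<Longrightarrow> \<kappa> k \<in> borel \<rightarrow>\<^sub>M prob_algebra borel"
    and pk: "\<And>k. 1 \<le> k \<Longrightarrow> k < K \<Longrightarrow> p k = p (Suc k) \<bind> \<kappa> k"
    and D0: "D (distr U borel R\<^sub>0) (p K) \<le> ereal \<delta>"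
    and Dk: "\<And>k y. 1 \<le> k \<Longrightarrow> k < K \<Longrightarrow> D (distr U borel (\<lambda>u. R k u y)) (\<kappa> k y) \<le> ereal \<delta>"
    and j: "j < K"
  shows "D (distr (PiM {1..K} (\<lambda>_. U)) borel (chain R R\<^sub>0 K j)) (p (K - j)) \<le> ereal (real (Suc j) * \<delta>)"
  using j
proof (induction j)
  case 0
  interpret P: product_prob_space "\<lambda>_::nat. U" "{1..K}"
    by (intro product_prob_spaceI U)
  have "distr (PiM {1..K} (\<lambda>_. U)) borel (chain R R\<^sub>0 K 0) =
      distr (distr (PiM {1..K} (\<lambda>_. U)) U (\<lambda>w. w K)) borel R\<^sub>0"
    using R0 0 by (subst distr_distr) (auto simp: fun_eq_iff comp_def intro!: distr_cong)
  also have "distr (PiM {1..K} (\<lambda>_. U)) U (\<lambda>w. w K) = U" using 0 by (intro P.PiM_component) auto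
  finally show ?case using D0 by simp
next
  case (Suc j)
  interpret P: prob_space "PiM {1..K} (\<lambda>_. U)" by (intro prob_space_PiM U)
  define k where "k = K - Suc j"
  have k: "1 \<le> k" "k < K" "K - j = Suc k" using Suc.prems by (auto simp: k_def)
  have Rm[measurable]: "(\<lambda>(u, y). R k u y) \<in> U \<Otimes>\<^sub>M borel \<rightarrow>\<^sub>M borel" using k by (intro R)
  have mR: "(\<lambda>(y, u). R k u y) \<in> borel \<Otimes>\<^sub>M U \<rightarrow>\<^sub>M borel" by measurable
  have k1: "(\<lambda>y. distr U borel (\<lambda>u. R k u y)) \<in> borel \<rightarrow>\<^sub>M prob_algebra borel"
    by (rule measurable_distr_prob_space2[OF _ mR]) (simp add: space_prob_algebra U)
  have mch: "chain R R\<^sub>0 K j \<in> PiM {1..K} (\<lambda>_. U) \<rightarrow>\<^sub>M borel"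
    using measurable_chain[of K R U R\<^sub>0 j] R R0 Suc.prems by auto
  have q: "distr (PiM {1..K} (\<lambda>_. U)) borel (chain R R\<^sub>0 K j) \<in> space (prob_algebra borel)"
    using P.prob_space_distr[OF mch] by (simp add: space_prob_algebra)
  have "D (distr (PiM {1..K} (\<lambda>_. U)) borel (chain R R\<^sub>0 K j) \<bind> (\<lambda>y. distr U borel (\<lambda>u. R k u y)))
          (p (Suc k) \<bind> \<kappa> k) \<le> ereal (real (Suc j) * \<delta> + \<delta>)"
    using D[unfolded bind_stable_def] q p[of "Suc k"] k1 \<kappa>[of k] Dk[of k] Suc k by auto
  moreover have "distr (PiM {1..K} (\<lambda>_. U)) borel (chain R R\<^sub>0 K (Suc j)) =
      distr (PiM {1..K} (\<lambda>_. U)) borel (chain R R\<^sub>0 K j) \<bind> (\<lambda>y. distr U borel (\<lambda>u. R k u y))"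
    unfolding k_def by (rule distr_chain_Suc[OF U R R0 Suc.prems])
  ultimately show ?case using pk[of k] k by (simp add: k_def[symmetric] algebra_simps del: chain.simps)
qed

text \<open>
  The Lebesgue densities \<open>f\<close> and \<open>h k y'\<close> are the sampling targets, and the oracle handed to the
  sampler at level \<open>k\<close> is the translated one.  The sampler's joint measurability in seed and
  target makes each step a Markov kernel, so the chain estimate applies.  Nonnegativity of \<open>N \<delta>\<close>
  comes from any single run, since query counts are natural numbers; it is recorded because the
  advertised budget has one summand more than the number of calls.
\<close>

lemma samples_within_sequential_sampler:
  fixes S :: "real \<Rightarrow> ('w, 'v::euclidean_space, 'v \<times> real, 'v) procedure"
    and f :: "'v \<Rightarrow> real" and h :: "nat \<Rightarrow> 'v \<Rightarrow> 'v \<Rightarrow> real"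
  assumes D: "bind_stable D" and S: "slc_sampler D vals N S" and \<delta>: "0 < \<delta>" and K: "1 \<le> K"
    and orc: "\<And>k. 1 \<le> k \<Longrightarrow> k \<le> K \<Longrightarrow> (\<lambda>y. orc (k, y)) \<in> borel \<rightarrow>\<^sub>M borel"
    and top: "slc 4 f" "density_oracle vals f (\<lambda>y. orc (K, y))"
    and cond: "\<And>k y'. 1 \<le> k \<Longrightarrow> k < K \<Longrightarrow> slc 4 (h k y')"
      "\<And>k y'. 1 \<le> k \<Longrightarrow> k < K \<Longrightarrow>
         density_oracle vals (h k y') (\<lambda>y. backward_answer vals (a k) y' y (orc (k, y)))"
    and p: "\<And>k. 1 \<le> k \<Longrightarrow> k \<le> K \<Longrightarrow> p k \<in> space (prob_algebra borel)"
    and pK: "p K = density lborel (\<lambda>x. ennreal (f x))"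
    and \<kappa>: "\<And>k. 1 \<le> k \<Longrightarrow> k < K \<Longrightarrow>
      (\<lambda>y'. density lborel (\<lambda>x. ennreal (h k y' x))) \<in> borel \<rightarrow>\<^sub>M prob_algebra borel"
    and pk: "\<And>k. 1 \<le> k \<Longrightarrow> k < K \<Longrightarrow> p k = p (Suc k) \<bind> (\<lambda>y'. density lborel (\<lambda>x. ennreal (h k y' x)))"
  shows "samples_within D (real K * \<delta>) (real K * N \<delta>) (sequential_sampler vals a K (S \<delta>)) orc (p 1)
     \<and> 0 \<le> N \<delta>"
proof -
  define U where "U = seed (S \<delta>)"
  define P where "P = prog (S \<delta>)"
  define R where "R k u y' = run (P u) (\<lambda>y. backward_answer vals (a k) y' y (orc (k, y)))" for k u y'
  define R\<^sub>0 where "R\<^sub>0 u = run (P u) (\<lambda>y. orc (K, y))" for u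
  have acc: "samples_within D \<delta> (N \<delta>) (S \<delta>) o' (density lborel (\<lambda>x. ennreal (g x)))"
    if "slc 4 g" "density_oracle vals g o'" for g o' using S \<delta> that unfolding slc_sampler_def by blast
  have U: "prob_space U" using acc[OF top] by (simp add: samples_within_def U_def)
  interpret U: prob_space U by fact
  have N0: "0 \<le> N \<delta>"
  proof -
    obtain u where "u \<in> space U" using U.not_empty by auto
    then have "real (queries (P u) (\<lambda>y. orc (K, y))) \<le> N \<delta>"
      using acc[OF top] by (simp add: samples_within_def U_def P_def)
    then show ?thesis by (meson of_nat_0_le_iff order_trans)
  qed
  have R0: "R\<^sub>0 \<in> U \<rightarrow>\<^sub>M borel"
    using acc[OF top] by (simp add: samples_within_def U_def P_def R\<^sub>0_def[abs_def])
  have R: "(\<lambda>(u, y). R k u y) \<in> U \<Otimes>\<^sub>M borel \<rightarrow>\<^sub>M borel" if k: "1 \<le> k" "k < K" for k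
  proof -
    have o: "(\<lambda>y. orc (k, y)) \<in> borel \<rightarrow>\<^sub>M borel \<Otimes>\<^sub>M borel"
      using k orc[of k] by (simp add: borel_prod)
    have [measurable]: "(\<lambda>y. fst (orc (k, y))) \<in> borel_measurable borel"
      "(\<lambda>y. snd (orc (k, y))) \<in> borel_measurable borel"
      using measurable_compose[OF o measurable_fst] measurable_compose[OF o measurable_snd] by auto
    have "(\<lambda>(z, y). backward_answer vals (a k) z y (orc (k, y))) \<in> borel_measurable borel"
      unfolding backward_answer_def borel_prod[symmetric] by measurable
    then have "(\<lambda>(w, z). run (prog (S \<delta>) w) (\<lambda>y. (\<lambda>(z, y). backward_answer vals (a k) z y (orc (k, y))) (z, y)))
       \<in> seed (S \<delta>) \<Otimes>\<^sub>M borel \<rightarrow>\<^sub>M borel"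
      using S \<delta> unfolding slc_sampler_def by blast
    then show ?thesis by (simp add: R_def U_def P_def)
  qed
  have desc: "run (descend vals a (\<lambda>k. P (w k)) j (chain R R\<^sub>0 K (K - 1 - j) w)) orc = chain R R\<^sub>0 K (K - 1) w"
    if "j < K" for j w
    using that
  proof (induction j)
    case (Suc j)
    have e: "K - 1 - j = Suc (K - 1 - Suc j)" "K - Suc (K - 1 - Suc j) = Suc j" using Suc.prems by auto
    have "chain R R\<^sub>0 K (K - 1 - j) w = R (Suc j) (w (Suc j)) (chain R R\<^sub>0 K (K - 1 - Suc j) w)"
      unfolding e(1) by (simp only: chain.simps e(2))
    then show ?case using Suc by (simp add: run_bind_tree run_simulate R_def[symmetric])
  qed simp
  have run_eq: "run (prog (sequential_sampler vals a K (S \<delta>)) w) orc = chain R R\<^sub>0 K (K - 1) w" for w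
    using desc[of "K - 1" w] K
    by (simp add: sequential_sampler_def run_bind_tree run_simulate P_def[symmetric] R\<^sub>0_def)
  have qd: "real (queries (descend vals a (\<lambda>k. P (w k)) j y') orc) \<le> real j * N \<delta>"
    if "j < K" "w \<in> space (PiM {1..K} (\<lambda>_. U))" for j w y'
    using that(1)
  proof (induction j arbitrary: y')
    case (Suc j)
    have "w (Suc j) \<in> space U" using that(2) Suc.prems by (auto simp: space_PiM)
    then have "real (queries (P (w (Suc j))) (\<lambda>y. backward_answer vals (a (Suc j)) y' y (orc (Suc j, y)))) \<le> N \<delta>"
      using acc[OF cond[of "Suc j" y']] Suc.prems by (simp add: samples_within_def U_def P_def)
    moreover note Suc.IH
    ultimately show ?case using Suc.prems
      by (auto simp: queries_bind_tree queries_simulate algebra_simps intro!: add_mono)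
  qed simp
  have "samples_within D (real K * \<delta>) (real K * N \<delta>) (sequential_sampler vals a K (S \<delta>)) orc (p 1)"
    unfolding samples_within_def run_eq output_law_def
  proof (intro conjI ballI)
    have sd: "seed (sequential_sampler vals a K (S \<delta>)) = PiM {1..K} (\<lambda>_. U)"
      by (simp add: sequential_sampler_def U_def)
    show "prob_space (seed (sequential_sampler vals a K (S \<delta>)))"
      unfolding sd by (intro prob_space_PiM U)
    show "(\<lambda>w. chain R R\<^sub>0 K (K - 1) w) \<in> seed (sequential_sampler vals a K (S \<delta>)) \<rightarrow>\<^sub>M borel"
      unfolding sd using K by (intro measurable_chain R R0) auto
    have "D (distr (PiM {1..K} (\<lambda>_. U)) borel (chain R R\<^sub>0 K (K - 1))) (p (K - (K - 1))) \<le> ereal (real (Suc (K - 1)) * \<delta>)"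
    proof (rule chain_law_within[where R=R and p=p and U=U and
          \<kappa>="\<lambda>k y'. density lborel (\<lambda>x. ennreal (h k y' x))", OF D U R R0 p \<kappa> pk])
      show "D (distr U borel R\<^sub>0) (p K) \<le> ereal \<delta>"
        using acc[OF top] unfolding pK by (simp add: samples_within_def output_law_def U_def P_def R\<^sub>0_def[abs_def])
      show "D (distr U borel (\<lambda>u. R k u y)) (density lborel (\<lambda>x. ennreal (h k y x))) \<le> ereal \<delta>"
        if "1 \<le> k" "k < K" for k y
        using acc[OF cond[OF that, of y]] by (simp add: samples_within_def output_law_def U_def P_def R_def)
    qed (use K in auto)
    then show "D (distr (seed (sequential_sampler vals a K (S \<delta>))) borel (\<lambda>w. chain R R\<^sub>0 K (K - 1) w)) (p 1)
        \<le> ereal (real K * \<delta>)" unfolding sd using K by simp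
    fix w assume w: "w \<in> space (seed (sequential_sampler vals a K (S \<delta>)))"
    then have w': "w \<in> space (PiM {1..K} (\<lambda>_. U))" by (simp add: sd)
    then have "w K \<in> space U" using K by (auto simp: space_PiM)
    then have "real (queries (P (w K)) (\<lambda>y. orc (K, y))) \<le> N \<delta>"
      using acc[OF top] by (simp add: samples_within_def U_def P_def)
    then have "real (queries (prog (sequential_sampler vals a K (S \<delta>)) w) orc) \<le> N \<delta> + real (K - 1) * N \<delta>"
      using qd[OF _ w', of "K - 1"] K
      by (auto simp: sequential_sampler_def queries_bind_tree queries_simulate P_def[symmetric] intro!: add_mono)
    also have "\<dots> = real K * N \<delta>" using K by (simp add: algebra_simps of_nat_diff)
    finally show "real (queries (prog (sequential_sampler vals a K (S \<delta>)) w) orc) \<le> real K * N \<delta>" .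
  qed
  then show ?thesis using N0 by simp
qed

section \<open>Continuous densities and weakly continuous conditional laws are unique\<close>

lemma continuous_eq_if_AE_lborel:
  fixes f g :: "'v::euclidean_space \<Rightarrow> real"
  assumes f: "continuous_on UNIV f" and g: "continuous_on UNIV g" and ae: "AE x in lborel. f x = g x"
  shows "f = g"
proof (rule ccontr)
  assume "f \<noteq> g"
  then have ne: "{x. f x \<noteq> g x} \<noteq> {}" by auto
  have op: "open {x. f x \<noteq> g x}" using f g by (rule open_Collect_neq)
  then have "{x. f x \<noteq> g x} \<in> null_sets lborel"
    using ae AE_iff_null_sets[of "{x. f x \<noteq> g x}" lborel] by auto
  then have "negligible {x. f x \<noteq> g x}"
    by (simp add: negligible_iff_null_sets null_sets_completionI)
  then show False using open_not_negligible[OF op ne] by simp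
qed

lemma cont_density_eqI:
  fixes \<mu> :: "'v::euclidean_space measure"
  assumes f: "continuous_on UNIV f" "\<And>x. 0 \<le> f x" and \<mu>: "\<mu> = density lborel (\<lambda>x. ennreal (f x))"
  shows "cont_density \<mu> = f"
  unfolding cont_density_def
proof (rule the_equality)
  fix g assume g: "continuous_on UNIV g \<and> (\<forall>x. 0 \<le> g x) \<and> \<mu> = density lborel (\<lambda>x. ennreal (g x))"
  have [measurable]: "f \<in> borel_measurable borel" "g \<in> borel_measurable borel"
    using f g by (auto intro: borel_measurable_continuous_onI)
  have "AE x in lborel. ennreal (f x) = ennreal (g x)"
  proof (rule sigma_finite_measure.density_unique[OF sigma_finite_lborel])
    show "density lborel (\<lambda>x. ennreal (f x)) = density lborel (\<lambda>x. ennreal (g x))"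
      using \<mu> g by metis
  qed measurable
  then have "AE x in lborel. g x = f x"
    by eventually_elim (use f g in \<open>simp add: ennreal_inj\<close>)
  with f g show "g = f" by (intro continuous_eq_if_AE_lborel) auto
qed (use assms in auto)

text \<open>
  The indicator of a closed set is the decreasing limit of the functions
  \<open>max 0 (1 - n \<cdot> dist (x, A))\<close>, and closed sets form an intersection-stable generator.
\<close>

lemma measure_eq_if_bounded_continuous_integrals_eq:
  fixes \<mu> \<nu> :: "'v::euclidean_space measure"
  assumes \<mu>: "prob_space \<mu>" "sets \<mu> = sets borel" and \<nu>: "prob_space \<nu>" "sets \<nu> = sets borel"
    and eq: "\<And>f::'v \<Rightarrow> real. continuous_on UNIV f \<Longrightarrow> bounded (range f) \<Longrightarrow> (\<integral>x. f x \<partial>\<mu>) = (\<integral>x. f x \<partial>\<nu>)"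
  shows "\<mu> = \<nu>"
proof -
  have key: "emeasure \<mu> A = emeasure \<nu> A" if A: "closed A" "A \<noteq> {}" for A
  proof -
    define f where "f n x = max 0 (1 - real n * infdist x A)" for n x
    have c: "continuous_on UNIV (f n)" for n unfolding f_def by (intro continuous_intros)
    have b: "0 \<le> f n x" "f n x \<le> 1" for n x by (auto simp: f_def infdist_nonneg)
    have lim: "(\<lambda>n. f n x) \<longlonglongrightarrow> indicator A x" for x
    proof (cases "x \<in> A")
      case True
      then show ?thesis by (simp add: f_def)
    next
      case False
      then have pos: "0 < infdist x A"
        using A in_closed_iff_infdist_zero[of A x] infdist_nonneg[of x A] by fastforce
      have "eventually (\<lambda>n. f n x = 0) sequentially"
        using eventually_ge_at_top[of "nat \<lceil>1 / infdist x A\<rceil>"]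
      proof eventually_elim
        case (elim n)
        then have "1 / infdist x A \<le> real n" by linarith
        then show ?case using pos by (simp add: f_def field_simps)
      qed
      then show ?thesis using False by (intro tendsto_eventually) (auto elim: eventually_mono)
    qed
    have "(\<lambda>n. \<integral>x. f n x \<partial>\<rho>) \<longlonglongrightarrow> measure \<rho> A" if \<rho>: "prob_space \<rho>" "sets \<rho> = sets borel" for \<rho> :: "'v measure"
    proof -
      interpret r: prob_space \<rho> by fact
      have sp: "space \<rho> = UNIV" using \<rho>(2) by (metis sets_eq_imp_space_eq space_borel)
      have m: "f n \<in> borel_measurable \<rho>" "indicator A \<in> borel_measurable \<rho>" for n
        using borel_measurable_continuous_onI[OF c, of n] A \<rho>(2)
        by (auto simp: measurable_cong_sets[OF \<rho>(2) refl])
      have "(\<lambda>n. \<integral>x. f n x \<partial>\<rho>) \<longlonglongrightarrow> (\<integral>x. indicator A x \<partial>\<rho>)"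
        using m b lim by (intro integral_dominated_convergence[where w="\<lambda>_. 1"]) auto
      then show ?thesis by (simp add: sp)
    qed
    then have l: "(\<lambda>n. \<integral>x. f n x \<partial>\<mu>) \<longlonglongrightarrow> measure \<mu> A" "(\<lambda>n. \<integral>x. f n x \<partial>\<nu>) \<longlonglongrightarrow> measure \<nu> A"
      using \<mu> \<nu> by auto
    have "bounded (range (f n))" for n
      by (rule boundedI[of _ 1]) (use b in auto)
    then have "(\<lambda>n. \<integral>x. f n x \<partial>\<mu>) = (\<lambda>n. \<integral>x. f n x \<partial>\<nu>)" using eq c by auto
    with l have "measure \<mu> A = measure \<nu> A" using LIMSEQ_unique by metis
    then show ?thesis using \<mu> \<nu>
      by (simp add: prob_space_def finite_measure.emeasure_eq_measure)
  qed
  show ?thesis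
  proof (rule measure_eqI_generator_eq[where E="Collect closed" and \<Omega>=UNIV and A="\<lambda>_. UNIV"])
    show "Int_stable (Collect (closed :: 'v set \<Rightarrow> bool))" by (auto simp: Int_stable_def)
    show "sets \<mu> = sigma_sets UNIV (Collect closed)" "sets \<nu> = sigma_sets UNIV (Collect closed)"
      using \<mu> \<nu> by (simp_all add: borel_eq_closed)
    show "emeasure \<mu> X = emeasure \<nu> X" if "X \<in> Collect closed" for X
      using key[of X] that by (cases "X = {}") auto
    show "emeasure \<mu> UNIV \<noteq> \<infinity>" for i
      using \<mu> by (simp add: prob_space_def finite_measure.emeasure_eq_measure)
  qed auto
qed

text \<open>
  Two disintegrations of the same joint law integrate each fixed function equally outside a null
  set.  That null set may depend on the function, which is harmless below, where
  continuity in \<open>y\<close> removes it before the function varies.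
\<close>

lemma kernels_nn_integral_AE_eq:
  fixes \<kappa> \<kappa>' :: "'u::euclidean_space \<Rightarrow> 'v::euclidean_space measure"
  assumes \<nu>: "prob_space \<nu>" "sets \<nu> = sets borel"
    and \<kappa>: "\<kappa> \<in> borel \<rightarrow>\<^sub>M prob_algebra borel" and \<kappa>': "\<kappa>' \<in> borel \<rightarrow>\<^sub>M prob_algebra borel"
    and eq: "\<And>A B. A \<in> sets borel \<Longrightarrow> B \<in> sets borel \<Longrightarrow>
      (\<integral>\<^sup>+y\<in>B. emeasure (\<kappa> y) A \<partial>\<nu>) = (\<integral>\<^sup>+y\<in>B. emeasure (\<kappa>' y) A \<partial>\<nu>)"
    and f: "f \<in> borel_measurable borel"
  shows "AE y in \<nu>. (\<integral>\<^sup>+x. f x \<partial>\<kappa> y) = (\<integral>\<^sup>+x. f x \<partial>\<kappa>' y)"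
  using f
proof (induction rule: borel_measurable_induct)
  interpret prob_space \<nu> by fact
  note [measurable_cong] = \<nu>(2)
  have s: "sets (\<kappa> y) = sets borel" "sets (\<kappa>' y) = sets borel" for y
    using measurable_space[OF \<kappa>, of y] measurable_space[OF \<kappa>', of y] by (auto simp: space_prob_algebra)
  have mc: "g \<in> borel_measurable (\<kappa> y)" "g \<in> borel_measurable (\<kappa>' y)" if "g \<in> borel_measurable borel" for g :: "'v \<Rightarrow> ennreal" and y
    using that by (auto simp: measurable_cong_sets[OF s(1) refl] measurable_cong_sets[OF s(2) refl])
  {
    case (cong f g)
    then have "f = g" by (intro ext) auto
    with cong show ?case by simp
  next
    case (set A)
    have [measurable]: "(\<lambda>y. emeasure (\<kappa> y) A) \<in> borel_measurable borel"
      "(\<lambda>y. emeasure (\<kappa>' y) A) \<in> borel_measurable borel"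
      using measurable_emeasure_kernel[OF measurable_prob_algebraD[OF \<kappa>] set]
        measurable_emeasure_kernel[OF measurable_prob_algebraD[OF \<kappa>'] set] by auto
    have "density \<nu> (\<lambda>y. emeasure (\<kappa> y) A) = density \<nu> (\<lambda>y. emeasure (\<kappa>' y) A)"
      using eq[OF set] by (intro measure_eqI) (auto simp: emeasure_density \<nu>(2))
    then have "AE y in \<nu>. emeasure (\<kappa> y) A = emeasure (\<kappa>' y) A"
      by (intro density_unique) auto
    then show ?case using set by (simp add: s)
  next
    case (mult u c)
    then show ?case by (auto simp: nn_integral_cmult[OF mc(1)] nn_integral_cmult[OF mc(2)] elim: eventually_mono)
  next
    case (add u v)
    have "(\<integral>\<^sup>+x. v x + u x \<partial>\<kappa> y) = (\<integral>\<^sup>+x. v x \<partial>\<kappa> y) + (\<integral>\<^sup>+x. u x \<partial>\<kappa> y)"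
      "(\<integral>\<^sup>+x. v x + u x \<partial>\<kappa>' y) = (\<integral>\<^sup>+x. v x \<partial>\<kappa>' y) + (\<integral>\<^sup>+x. u x \<partial>\<kappa>' y)" for y
      using add by (auto intro!: nn_integral_add mc)
    then show ?case using add.IH by (auto elim: eventually_elim2)
  next
    case (seq U)
    have "AE y in \<nu>. \<forall>i. (\<integral>\<^sup>+x. U i x \<partial>\<kappa> y) = (\<integral>\<^sup>+x. U i x \<partial>\<kappa>' y)"
      using seq.IH by (simp add: AE_all_countable)
    moreover have "(\<integral>\<^sup>+x. (SUP i. U i) x \<partial>\<kappa> y) = (SUP i. \<integral>\<^sup>+x. U i x \<partial>\<kappa> y)"
      "(\<integral>\<^sup>+x. (SUP i. U i) x \<partial>\<kappa>' y) = (SUP i. \<integral>\<^sup>+x. U i x \<partial>\<kappa>' y)" for y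
      unfolding SUP_apply using seq by (auto intro!: nn_integral_monotone_convergence_SUP mc)
    ultimately show ?case by auto
  }
qed

text \<open>
  A positive density of \<open>Y\<close> makes null sets of its law Lebesgue null, so the continuous functions
  \<open>y \<mapsto> \<integral> f d\<kappa> y\<close> agree everywhere as soon as they agree almost surely.
\<close>

lemma is_cond_law_unique:
  fixes X :: "'m \<Rightarrow> 'v::euclidean_space" and Y :: "'m \<Rightarrow> 'u::euclidean_space"
  assumes M: "prob_space M" and Y: "Y \<in> borel_measurable M"
    and p: "p \<in> borel_measurable borel" "\<And>y. 0 < p y" and law: "distr M borel Y = density lborel (\<lambda>y. ennreal (p y))"
    and \<kappa>: "is_cond_law M X Y \<kappa>" and \<kappa>': "is_cond_law M X Y \<kappa>'"
  shows "\<kappa> = \<kappa>'"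
proof
  fix y
  let ?\<nu> = "distr M borel Y"
  have \<nu>: "prob_space ?\<nu>" "sets ?\<nu> = sets borel" using prob_space.prob_space_distr[OF M Y] by auto
  have k: "\<kappa> \<in> borel \<rightarrow>\<^sub>M prob_algebra borel" "\<kappa>' \<in> borel \<rightarrow>\<^sub>M prob_algebra borel"
    using \<kappa> \<kappa>' by (auto simp: is_cond_law_def)
  have K: "prob_space (\<kappa> y)" "prob_space (\<kappa>' y)" "sets (\<kappa> y) = sets borel" "sets (\<kappa>' y) = sets borel" for y
    using measurable_space[OF k(1), of y] measurable_space[OF k(2), of y] by (auto simp: space_prob_algebra)
  show "\<kappa> y = \<kappa>' y"
  proof (rule measure_eq_if_bounded_continuous_integrals_eq[OF K(1,3) K(2,4)])
    fix f :: "'v \<Rightarrow> real" assume f: "continuous_on UNIV f" "bounded (range f)"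
    then obtain C where C: "\<And>x. \<bar>f x\<bar> \<le> C" by (auto simp: bounded_iff)
    have [measurable]: "f \<in> borel_measurable borel" using f by (intro borel_measurable_continuous_onI)
    have int: "(\<integral>x. f x \<partial>\<rho>) = enn2real (\<integral>\<^sup>+x. ennreal (f x + C) \<partial>\<rho>) - C"
      if "prob_space \<rho>" "sets \<rho> = sets borel" for \<rho> :: "'v measure"
    proof -
      interpret prob_space \<rho> by fact
      note [measurable_cong] = that(2)
      have i: "integrable \<rho> f" using C by (intro integrable_const_bound[of _ C]) auto
      have pos: "0 \<le> f x + C" for x using C[of x] by linarith
      have i': "integrable \<rho> (\<lambda>x. f x + C)" using i by simp
      have "(\<integral>\<^sup>+x. ennreal (f x + C) \<partial>\<rho>) = ennreal (\<integral>x. f x + C \<partial>\<rho>)"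
        by (rule nn_integral_eq_integral[OF i']) (simp add: pos)
      then have "enn2real (\<integral>\<^sup>+x. ennreal (f x + C) \<partial>\<rho>) = (\<integral>x. f x + C \<partial>\<rho>)"
        using pos by (simp add: integral_nonneg)
      also have "\<dots> = (\<integral>x. f x \<partial>\<rho>) + C" using i by (simp add: prob_space)
      finally show ?thesis by simp
    qed
    have "AE y in ?\<nu>. (\<integral>\<^sup>+x. ennreal (f x + C) \<partial>\<kappa> y) = (\<integral>\<^sup>+x. ennreal (f x + C) \<partial>\<kappa>' y)"
      using \<kappa> \<kappa>' by (intro kernels_nn_integral_AE_eq[OF \<nu> k]) (auto simp: is_cond_law_def)
    then have "AE y in ?\<nu>. (\<integral>x. f x \<partial>\<kappa> y) = (\<integral>x. f x \<partial>\<kappa>' y)"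
      by eventually_elim (simp add: int[OF K(1,3)] int[OF K(2,4)])
    then have "AE y in lborel. (\<integral>x. f x \<partial>\<kappa> y) = (\<integral>x. f x \<partial>\<kappa>' y)"
      unfolding law using p by (subst (asm) AE_density) auto
    moreover have "continuous_on UNIV (\<lambda>y. \<integral>x. f x \<partial>\<kappa> y)" "continuous_on UNIV (\<lambda>y. \<integral>x. f x \<partial>\<kappa>' y)"
      using \<kappa> \<kappa>' f by (auto simp: is_cond_law_def)
    ultimately have "(\<lambda>y. \<integral>x. f x \<partial>\<kappa> y) = (\<lambda>y. \<integral>x. f x \<partial>\<kappa>' y)"
      by (intro continuous_eq_if_AE_lborel)
    then show "(\<integral>x. f x \<partial>\<kappa> y) = (\<integral>x. f x \<partial>\<kappa>' y)" by (rule fun_cong)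
  qed
qed

lemma cond_law_eqI:
  assumes "prob_space M" "Y \<in> borel_measurable M" "p \<in> borel_measurable borel" "\<And>y. 0 < p y"
    "distr M borel Y = density lborel (\<lambda>y. ennreal (p y))" "is_cond_law M X Y \<kappa>"
  shows "cond_law M X Y = \<kappa>"
  unfolding cond_law_def
proof (rule the_equality)
  show "is_cond_law M X Y \<kappa>" by fact
  show "\<kappa>' = \<kappa>" if "is_cond_law M X Y \<kappa>'" for \<kappa>'
    using is_cond_law_unique[OF assms(1-5) that assms(6)] .
qed

section \<open>Gaussian channels\<close>

text \<open>
  The density of \<open>s N\<close> for a standard Gaussian vector \<open>N\<close> and \<open>s > 0\<close>.
\<close>

definition gauss_kernel :: "real \<Rightarrow> 'v::euclidean_space \<Rightarrow> real" where
  "gauss_kernel s z = (2 * pi * s\<^sup>2) powr (- real DIM('v) / 2) * exp (- (norm z)\<^sup>2 / (2 * s\<^sup>2))"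

text \<open>
  The density of \<open>c X + s N\<close> when \<open>X\<close> has law \<open>\<mu>\<close>.
\<close>

definition noised_density :: "'v::euclidean_space measure \<Rightarrow> real \<Rightarrow> real \<Rightarrow> 'v \<Rightarrow> real" where
  "noised_density \<mu> c s y = (\<integral>x. gauss_kernel s (y - c *\<^sub>R x) \<partial>\<mu>)"

text \<open>
  Bayes' rule for \<open>X\<close> given \<open>c X + s N = y\<close>, defined for every \<open>y\<close> since the
  denominator is positive for \<open>s \<noteq> 0\<close>.
\<close>

definition posterior :: "'v::euclidean_space measure \<Rightarrow> real \<Rightarrow> real \<Rightarrow> 'v \<Rightarrow> 'v measure" where
  "posterior \<mu> c s y = density \<mu> (\<lambda>x. ennreal (gauss_kernel s (y - c *\<^sub>R x) / noised_density \<mu> c s y))"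

lemma gauss_kernel_continuous[continuous_intros]:
  "continuous_on S f \<Longrightarrow> continuous_on S (\<lambda>x. gauss_kernel s (f x))"
  unfolding gauss_kernel_def by (cases "s = 0") (auto intro!: continuous_intros)

lemma gauss_kernel_measurable[measurable]: "gauss_kernel s \<in> borel_measurable borel"
  by (intro borel_measurable_continuous_onI continuous_intros)

lemma gauss_kernel_pos: "s \<noteq> 0 \<Longrightarrow> 0 < gauss_kernel s z"
  unfolding gauss_kernel_def by simp

lemma gauss_kernel_nonneg: "0 \<le> gauss_kernel s z"
  unfolding gauss_kernel_def by simp

lemma gauss_kernel_le: "gauss_kernel s (z :: 'v::euclidean_space) \<le> gauss_kernel s (0 :: 'v)"
  unfolding gauss_kernel_def by (intro mult_left_mono) auto

lemma std_gaussian_eq: "std_gaussian = density lborel (\<lambda>x. ennreal (gauss_kernel 1 x))"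
  unfolding std_gaussian_def gauss_kernel_def by simp

lemma sets_std_gaussian[measurable_cong, simp]: "sets std_gaussian = sets borel"
  unfolding std_gaussian_def by simp

lemma gauss_kernel_scale:
  assumes "0 < s"
  shows "s ^ DIM('v) * gauss_kernel s (s *\<^sub>R z :: 'v::euclidean_space) = gauss_kernel 1 z"
proof -
  have "(2 * pi * s\<^sup>2) powr (- real DIM('v) / 2) = (2 * pi) powr (- real DIM('v) / 2) * (s\<^sup>2) powr (- real DIM('v) / 2)"
    using assms by (simp add: powr_mult)
  also have "(s\<^sup>2) powr (- real DIM('v) / 2) = s powr (2 * (- real DIM('v) / 2))"
    using assms by (simp add: powr_powr flip: powr_numeral)
  also have "\<dots> = inverse (s ^ DIM('v))"
    using assms by (simp add: powr_minus powr_realpow)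
  finally show ?thesis using assms unfolding gauss_kernel_def
    by (simp add: power_mult_distrib)
qed

lemma nn_integral_std_gaussian_affine:
  fixes m :: "'v::euclidean_space"
  assumes s: "0 < s" and [measurable]: "g \<in> borel_measurable borel"
  shows "(\<integral>\<^sup>+n. g (m + s *\<^sub>R n) \<partial>std_gaussian) = (\<integral>\<^sup>+y. ennreal (gauss_kernel s (y - m)) * g y \<partial>lborel)"
proof -
  have "(\<integral>\<^sup>+y. ennreal (gauss_kernel s (y - m)) * g y \<partial>lborel) =
      (\<integral>\<^sup>+n. ennreal (s ^ DIM('v)) * (ennreal (gauss_kernel s (s *\<^sub>R n)) * g (m + s *\<^sub>R n)) \<partial>lborel)"
    using s by (subst lborel_affine[of s m]) (auto simp: nn_integral_density nn_integral_distr)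
  also have "\<dots> = (\<integral>\<^sup>+n. ennreal (gauss_kernel 1 n) * g (m + s *\<^sub>R n) \<partial>lborel)"
    using s by (simp add: gauss_kernel_scale[symmetric] ennreal_mult gauss_kernel_nonneg mult.assoc)
  also have "\<dots> = (\<integral>\<^sup>+n. g (m + s *\<^sub>R n) \<partial>std_gaussian)"
    unfolding std_gaussian_eq by (subst nn_integral_density) auto
  finally show ?thesis by simp
qed

text \<open>
  The Ornstein--Uhlenbeck transition is reversible with respect to the standard Gaussian.  This
  identity determines the law of a mixture of two independent Gaussian vectors.
\<close>

lemma gauss_kernel_reverse:
  fixes x y :: "'v::euclidean_space"
  assumes "\<alpha>\<^sup>2 + \<beta>\<^sup>2 = 1" "0 < \<beta>"
  shows "gauss_kernel \<beta> (y - \<alpha> *\<^sub>R x) * gauss_kernel 1 x = gauss_kernel 1 y * gauss_kernel \<beta> (x - \<alpha> *\<^sub>R y)"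
proof -
  have e: "(norm (y - \<alpha> *\<^sub>R x))\<^sup>2 + \<beta>\<^sup>2 * (norm x)\<^sup>2 = \<beta>\<^sup>2 * (norm y)\<^sup>2 + (norm (x - \<alpha> *\<^sub>R y))\<^sup>2"
  proof -
    have b: "\<beta>\<^sup>2 = 1 - \<alpha>\<^sup>2" using assms by simp
    show ?thesis unfolding b power2_norm_eq_inner
      by (simp add: inner_diff inner_commute algebra_simps power2_eq_square)
  qed
  have "- (norm (y - \<alpha> *\<^sub>R x))\<^sup>2 / (2 * \<beta>\<^sup>2) + - (norm x)\<^sup>2 / 2 =
     - ((norm (y - \<alpha> *\<^sub>R x))\<^sup>2 + \<beta>\<^sup>2 * (norm x)\<^sup>2) / (2 * \<beta>\<^sup>2)"
    using assms by (simp add: field_simps)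
  also have "\<dots> = - (norm y)\<^sup>2 / 2 + - (norm (x - \<alpha> *\<^sub>R y))\<^sup>2 / (2 * \<beta>\<^sup>2)"
    unfolding e using assms by (simp add: field_simps)
  finally have "exp (- (norm (y - \<alpha> *\<^sub>R x))\<^sup>2 / (2 * \<beta>\<^sup>2)) * exp (- (norm x)\<^sup>2 / 2) =
     exp (- (norm y)\<^sup>2 / 2) * exp (- (norm (x - \<alpha> *\<^sub>R y))\<^sup>2 / (2 * \<beta>\<^sup>2))"
    by (metis exp_add)
  then show ?thesis unfolding gauss_kernel_def by simp
qed

locale borel_prob =
  fixes \<mu> :: "'v::euclidean_space measure"
  assumes prob: "prob_space \<mu>" and sets_mu[measurable_cong]: "sets \<mu> = sets borel"

sublocale borel_prob \<subseteq> prob_space \<mu> by (rule prob)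

context borel_prob
begin

text \<open>
  Dominated convergence, with the maximum of the kernel times \<open>C\<close> as the dominating constant; it gives
  both the continuity of the noised density and the weak continuity of the posterior.
\<close>

lemma continuous_gauss_integral:
  assumes f[measurable]: "f \<in> borel_measurable borel" and b: "\<And>x. \<bar>f x :: real\<bar> \<le> C"
  shows "continuous_on UNIV (\<lambda>y. \<integral>x. f x * gauss_kernel s (y - c *\<^sub>R x) \<partial>\<mu>)"
proof -
  have "continuous (at y within UNIV) (\<lambda>y. \<integral>x. f x * gauss_kernel s (y - c *\<^sub>R x) \<partial>\<mu>)" for y
  proof (rule continuous_within_sequentiallyI)
    fix u :: "nat \<Rightarrow> 'v" assume u: "u \<longlonglongrightarrow> y"
    show "(\<lambda>n. \<integral>x. f x * gauss_kernel s (u n - c *\<^sub>R x) \<partial>\<mu>) \<longlonglongrightarrow> (\<integral>x. f x * gauss_kernel s (y - c *\<^sub>R x) \<partial>\<mu>)"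
    proof (rule integral_dominated_convergence[where w="\<lambda>_. C * gauss_kernel s (0::'v)"])
      have "(\<lambda>n. gauss_kernel s (u n - c *\<^sub>R x)) \<longlonglongrightarrow> gauss_kernel s (y - c *\<^sub>R x)" for x
      proof -
        have "isCont (gauss_kernel s) (y - c *\<^sub>R x)"
          using gauss_kernel_continuous[of UNIV "\<lambda>z::'v. z" s]
          by (simp add: continuous_on_eq_continuous_at continuous_on_id)
        moreover have "(\<lambda>n. u n - c *\<^sub>R x) \<longlonglongrightarrow> y - c *\<^sub>R x" by (intro tendsto_intros u)
        ultimately show ?thesis by (rule isCont_tendsto_compose)
      qed
      then show "AE x in \<mu>. (\<lambda>n. f x * gauss_kernel s (u n - c *\<^sub>R x)) \<longlonglongrightarrow> f x * gauss_kernel s (y - c *\<^sub>R x)"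
        by (auto intro!: tendsto_mult)
      show "AE x in \<mu>. norm (f x * gauss_kernel s (u n - c *\<^sub>R x)) \<le> C * gauss_kernel s (0::'v)" for n
        using b order_trans[OF abs_ge_zero b]
        by (auto simp: abs_mult gauss_kernel_nonneg gauss_kernel_le intro!: mult_mono)
    qed auto
  qed
  then show ?thesis by (simp add: continuous_on_eq_continuous_within)
qed

lemma integrable_gauss_kernel: "integrable \<mu> (\<lambda>x. gauss_kernel s (y - c *\<^sub>R x))"
  by (intro integrable_const_bound[of _ "gauss_kernel s (0::'v)"])
    (auto simp: gauss_kernel_nonneg gauss_kernel_le)

lemma noised_density_continuous: "continuous_on UNIV (noised_density \<mu> c s)"
  using continuous_gauss_integral[of "\<lambda>_. 1" 1 s c] by (simp add: noised_density_def[abs_def])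

lemma noised_density_measurable[measurable]: "noised_density \<mu> c s \<in> borel_measurable borel"
  by (intro borel_measurable_continuous_onI noised_density_continuous)

lemma noised_density_pos:
  assumes "s \<noteq> 0" shows "0 < noised_density \<mu> c s y"
proof -
  have nn: "0 \<le> noised_density \<mu> c s y" unfolding noised_density_def
    by (intro Bochner_Integration.integral_nonneg gauss_kernel_nonneg)
  have "noised_density \<mu> c s y \<noteq> 0"
  proof
    assume "noised_density \<mu> c s y = 0"
    then have "AE x in \<mu>. gauss_kernel s (y - c *\<^sub>R x) = 0"
      unfolding noised_density_def
      by (subst (asm) integral_nonneg_eq_0_iff_AE) (auto simp: gauss_kernel_nonneg integrable_gauss_kernel)
    then have "AE x in \<mu>. False"
    proof eventually_elim
      case (elim x)
      then show ?case using gauss_kernel_pos[OF assms, of "y - c *\<^sub>R x"] by simp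
    qed
    then show False by simp
  qed
  with nn show ?thesis by simp
qed

lemma nn_integral_gauss_kernel:
  "(\<integral>\<^sup>+x. ennreal (gauss_kernel s (y - c *\<^sub>R x)) \<partial>\<mu>) = ennreal (noised_density \<mu> c s y)"
  unfolding noised_density_def
  by (intro nn_integral_eq_integral integrable_gauss_kernel) (simp add: gauss_kernel_nonneg)

lemma prob_posterior:
  assumes "s \<noteq> 0" shows "prob_space (posterior \<mu> c s y)"
proof
  have p: "0 < noised_density \<mu> c s y" by (rule noised_density_pos[OF assms])
  have "emeasure (posterior \<mu> c s y) (space (posterior \<mu> c s y)) =
     (\<integral>\<^sup>+x. ennreal (gauss_kernel s (y - c *\<^sub>R x) / noised_density \<mu> c s y) \<partial>\<mu>)"
    unfolding posterior_def by (subst emeasure_density) (auto intro!: nn_integral_cong)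
  also have "\<dots> = ennreal (\<integral>x. gauss_kernel s (y - c *\<^sub>R x) / noised_density \<mu> c s y \<partial>\<mu>)"
    using p by (intro nn_integral_eq_integral) (auto simp: gauss_kernel_nonneg integrable_gauss_kernel)
  also have "\<dots> = 1" using p by (simp add: noised_density_def[symmetric])
  finally show "emeasure (posterior \<mu> c s y) (space (posterior \<mu> c s y)) = 1" .
qed

lemma sets_posterior[simp]: "sets (posterior \<mu> c s y) = sets borel"
  unfolding posterior_def by (simp add: sets_mu)

lemma posterior_kernel:
  assumes "s \<noteq> 0" shows "posterior \<mu> c s \<in> borel \<rightarrow>\<^sub>M prob_algebra borel"
proof (rule measurable_prob_algebraI)
  show "posterior \<mu> c s \<in> borel \<rightarrow>\<^sub>M subprob_algebra borel"
  proof (rule measurable_subprob_algebra)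
    fix A :: "'v set" assume [measurable]: "A \<in> sets borel"
    have "emeasure (posterior \<mu> c s y) A =
        (\<integral>\<^sup>+x. ennreal (gauss_kernel s (y - c *\<^sub>R x) / noised_density \<mu> c s y) * indicator A x \<partial>\<mu>)" for y
      unfolding posterior_def by (subst emeasure_density) (auto simp: sets_mu)
    then show "(\<lambda>y. emeasure (posterior \<mu> c s y) A) \<in> borel_measurable borel" by simp
  qed (auto intro: prob_space_imp_subprob_space prob_posterior[OF assms])
qed (rule prob_posterior[OF assms])

lemma integral_posterior:
  fixes f :: "'v \<Rightarrow> 'w::{banach, second_countable_topology}"
  assumes "s \<noteq> 0" and [measurable]: "f \<in> borel_measurable borel"
  shows "(\<integral>x. f x \<partial>posterior \<mu> c s y) = (\<integral>x. gauss_kernel s (y - c *\<^sub>R x) *\<^sub>R f x \<partial>\<mu>) /\<^sub>R noised_density \<mu> c s y"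
proof -
  have p: "0 < noised_density \<mu> c s y" by (rule noised_density_pos[OF assms(1)])
  have "(\<integral>x. f x \<partial>posterior \<mu> c s y) = (\<integral>x. (gauss_kernel s (y - c *\<^sub>R x) / noised_density \<mu> c s y) *\<^sub>R f x \<partial>\<mu>)"
    unfolding posterior_def using p by (subst integral_density) (auto simp: gauss_kernel_nonneg)
  also have "\<dots> = (\<integral>x. inverse (noised_density \<mu> c s y) *\<^sub>R (gauss_kernel s (y - c *\<^sub>R x) *\<^sub>R f x) \<partial>\<mu>)"
    by (simp add: field_simps)
  finally show ?thesis unfolding integral_scaleR_right .
qed

lemma posterior_weakly_continuous:
  assumes "s \<noteq> 0" and f: "continuous_on UNIV f" "bounded (range (f :: 'v \<Rightarrow> real))"
  shows "continuous_on UNIV (\<lambda>y. \<integral>x. f x \<partial>posterior \<mu> c s y)"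
proof -
  obtain C where C: "\<And>x. \<bar>f x\<bar> \<le> C" using f by (auto simp: bounded_iff)
  have m[measurable]: "f \<in> borel_measurable borel" using f by (intro borel_measurable_continuous_onI)
  have "continuous_on UNIV (\<lambda>y. inverse (noised_density \<mu> c s y) * (\<integral>x. f x * gauss_kernel s (y - c *\<^sub>R x) \<partial>\<mu>))"
    using noised_density_pos[OF assms(1)]
    by (intro continuous_intros noised_density_continuous continuous_gauss_integral[OF m C])
      (simp add: less_imp_neq[THEN not_sym])
  then show ?thesis by (simp add: integral_posterior[OF assms(1) m] mult.commute)
qed

end

text \<open>
  Both kinds of conditional laws in the problem are posteriors of such a channel: \<open>X\<close> given
  \<open>Y k\<close>, and \<open>Y k\<close> given \<open>Y (k + 1)\<close>.
\<close>

locale gaussian_channel = prob_space M for M :: "'m measure" +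
  fixes X N Y :: "'m \<Rightarrow> 'v::euclidean_space" and c s :: real
  assumes X[measurable]: "X \<in> borel_measurable M" and N[measurable]: "N \<in> borel_measurable M"
    and prob_gauss: "prob_space (std_gaussian :: 'v measure)"
    and indep: "distr M (borel \<Otimes>\<^sub>M borel) (\<lambda>\<omega>. (X \<omega>, N \<omega>)) = distr M borel X \<Otimes>\<^sub>M std_gaussian"
    and Y: "\<And>\<omega>. \<omega> \<in> space M \<Longrightarrow> Y \<omega> = c *\<^sub>R X \<omega> + s *\<^sub>R N \<omega>"
    and s: "0 < s"

sublocale gaussian_channel \<subseteq> law: borel_prob "distr M borel X"
  by (intro borel_prob.intro prob_space_distr X) simp

context gaussian_channel
begin

lemma Y_measurable[measurable]: "Y \<in> borel_measurable M"
  by (subst measurable_cong[OF Y]) auto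

lemma nn_integral_joint:
  assumes [measurable]: "h \<in> borel_measurable (borel \<Otimes>\<^sub>M borel)"
  shows "(\<integral>\<^sup>+\<omega>. h (X \<omega>, Y \<omega>) \<partial>M) =
    (\<integral>\<^sup>+y. \<integral>\<^sup>+x. ennreal (gauss_kernel s (y - c *\<^sub>R x)) * h (x, y) \<partial>distr M borel X \<partial>lborel)"
proof -
  interpret G: prob_space "std_gaussian :: 'v measure" by (rule prob_gauss)
  interpret P: pair_sigma_finite lborel "distr M borel X" ..
  have "(\<integral>\<^sup>+\<omega>. h (X \<omega>, Y \<omega>) \<partial>M) = (\<integral>\<^sup>+\<omega>. h (X \<omega>, c *\<^sub>R X \<omega> + s *\<^sub>R N \<omega>) \<partial>M)"
    by (intro nn_integral_cong) (simp add: Y)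
  also have "\<dots> = (\<integral>\<^sup>+z. h (fst z, c *\<^sub>R fst z + s *\<^sub>R snd z) \<partial>distr M (borel \<Otimes>\<^sub>M borel) (\<lambda>\<omega>. (X \<omega>, N \<omega>)))"
    by (subst nn_integral_distr) auto
  also have "\<dots> = (\<integral>\<^sup>+x. \<integral>\<^sup>+n. h (x, c *\<^sub>R x + s *\<^sub>R n) \<partial>std_gaussian \<partial>distr M borel X)"
    unfolding indep by (subst G.nn_integral_fst[symmetric]) auto
  also have "\<dots> = (\<integral>\<^sup>+x. \<integral>\<^sup>+y. ennreal (gauss_kernel s (y - c *\<^sub>R x)) * h (x, y) \<partial>lborel \<partial>distr M borel X)"
    by (intro nn_integral_cong nn_integral_std_gaussian_affine s) auto
  also have "\<dots> = (\<integral>\<^sup>+y. \<integral>\<^sup>+x. ennreal (gauss_kernel s (y - c *\<^sub>R x)) * h (x, y) \<partial>distr M borel X \<partial>lborel)"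
    by (rule P.Fubini') measurable
  finally show ?thesis .
qed

lemma distr_Y: "distr M borel Y = density lborel (\<lambda>y. ennreal (noised_density (distr M borel X) c s y))"
proof (rule measure_eqI)
  fix A assume "A \<in> sets (distr M borel Y)"
  then have A[measurable]: "A \<in> sets borel" by simp
  have "emeasure (distr M borel Y) A = (\<integral>\<^sup>+\<omega>. indicator A (snd (X \<omega>, Y \<omega>)) \<partial>M)"
    using nn_integral_distr[OF Y_measurable, of "indicator A"] by simp
  also have "\<dots> = (\<integral>\<^sup>+y. \<integral>\<^sup>+x. ennreal (gauss_kernel s (y - c *\<^sub>R x)) * indicator A y \<partial>distr M borel X \<partial>lborel)"
    by (subst nn_integral_joint) auto
  also have "\<dots> = (\<integral>\<^sup>+y. ennreal (noised_density (distr M borel X) c s y) * indicator A y \<partial>lborel)"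
    by (intro nn_integral_cong) (simp add: nn_integral_multc law.nn_integral_gauss_kernel)
  finally show "emeasure (distr M borel Y) A =
      emeasure (density lborel (\<lambda>y. ennreal (noised_density (distr M borel X) c s y))) A"
    by (simp add: emeasure_density)
qed simp

lemma is_cond_law_posterior: "is_cond_law M X Y (posterior (distr M borel X) c s)"
  unfolding is_cond_law_def
proof (intro conjI ballI allI impI)
  have s0: "s \<noteq> 0" using s by simp
  show "posterior (distr M borel X) c s \<in> borel \<rightarrow>\<^sub>M prob_algebra borel"
    by (rule law.posterior_kernel[OF s0])
  show "continuous_on UNIV (\<lambda>y. \<integral>x. f x \<partial>posterior (distr M borel X) c s y)"
    if "continuous_on UNIV f \<and> bounded (range f)" for f :: "'v \<Rightarrow> real"
    using that by (intro law.posterior_weakly_continuous s0) auto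
  fix A B :: "'v set" assume [measurable]: "A \<in> sets borel" "B \<in> sets borel"
  have pm: "(\<lambda>y. emeasure (posterior (distr M borel X) c s y) A) \<in> borel_measurable borel"
    by (rule measurable_emeasure_kernel[OF measurable_prob_algebraD[OF law.posterior_kernel[OF s0]]]) simp
  have "emeasure M {\<omega>\<in>space M. X \<omega> \<in> A \<and> Y \<omega> \<in> B} = (\<integral>\<^sup>+\<omega>. indicator {\<omega>\<in>space M. X \<omega> \<in> A \<and> Y \<omega> \<in> B} \<omega> \<partial>M)"
    by (subst nn_integral_indicator) auto
  also have "\<dots> = (\<integral>\<^sup>+\<omega>. indicator (A \<times> B) (X \<omega>, Y \<omega>) \<partial>M)"
    by (intro nn_integral_cong) (auto split: split_indicator)
  also have "\<dots> = (\<integral>\<^sup>+y. \<integral>\<^sup>+x. ennreal (gauss_kernel s (y - c *\<^sub>R x)) * indicator (A \<times> B) (x, y) \<partial>distr M borel X \<partial>lborel)"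
    by (rule nn_integral_joint) measurable
  also have "\<dots> = (\<integral>\<^sup>+y. ennreal (noised_density (distr M borel X) c s y) *
      (emeasure (posterior (distr M borel X) c s y) A * indicator B y) \<partial>lborel)"
  proof (intro nn_integral_cong)
    fix y
    let ?p = "noised_density (distr M borel X) c s y"
    have p: "0 < ?p" by (rule law.noised_density_pos[OF s0])
    have e: "ennreal (gauss_kernel s (y - c *\<^sub>R x)) = ennreal ?p * ennreal (gauss_kernel s (y - c *\<^sub>R x) / ?p)" for x
      using p by (subst ennreal_mult[symmetric]) (auto simp: gauss_kernel_nonneg)
    have "(\<integral>\<^sup>+x. ennreal (gauss_kernel s (y - c *\<^sub>R x)) * indicator (A \<times> B) (x, y) \<partial>distr M borel X) =
      (\<integral>\<^sup>+x. (ennreal ?p * indicator B y) * (ennreal (gauss_kernel s (y - c *\<^sub>R x) / ?p) * indicator A x) \<partial>distr M borel X)"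
      by (intro nn_integral_cong) (auto simp: e split: split_indicator)
    also have "\<dots> = (ennreal ?p * indicator B y) * emeasure (posterior (distr M borel X) c s y) A"
      unfolding posterior_def by (subst nn_integral_cmult) (auto simp: emeasure_density)
    finally show "(\<integral>\<^sup>+x. ennreal (gauss_kernel s (y - c *\<^sub>R x)) * indicator (A \<times> B) (x, y) \<partial>distr M borel X) =
      ennreal ?p * (emeasure (posterior (distr M borel X) c s y) A * indicator B y)"
      by (simp add: mult_ac)
  qed
  also have "\<dots> = (\<integral>\<^sup>+y\<in>B. emeasure (posterior (distr M borel X) c s y) A \<partial>distr M borel Y)"
    unfolding distr_Y using pm by (subst nn_integral_density) auto
  finally show "emeasure M {\<omega>\<in>space M. X \<omega> \<in> A \<and> Y \<omega> \<in> B} =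
      (\<integral>\<^sup>+y\<in>B. emeasure (posterior (distr M borel X) c s y) A \<partial>distr M borel Y)" .
qed

lemma cond_law_eq_posterior: "cond_law M X Y = posterior (distr M borel X) c s"
  using s by (intro cond_law_eqI[OF prob_space_axioms Y_measurable _ _ distr_Y is_cond_law_posterior]
     law.noised_density_pos) auto

lemma rv_density_eq: "rv_density M Y = noised_density (distr M borel X) c s"
  unfolding rv_density_def
  using s law.noised_density_pos[of s] law.noised_density_continuous
  by (intro cont_density_eqI distr_Y) (auto intro: less_imp_le)

text \<open>
  This links consecutive levels of the chain: the marginal at level \<open>k\<close> arises from the marginal
  at level \<open>k + 1\<close> by the exact backward kernel, with which the sampler's kernel is compared.
\<close>

lemma distr_X_eq_bind: "distr M borel X = distr M borel Y \<bind> posterior (distr M borel X) c s"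
proof (rule measure_eqI)
  have s0: "s \<noteq> 0" using s by simp
  have q: "distr M borel Y \<in> space (prob_algebra borel)"
    by (simp add: space_prob_algebra prob_space_distr)
  note b = q law.posterior_kernel[OF s0, of c]
  show "sets (distr M borel X) = sets (distr M borel Y \<bind> posterior (distr M borel X) c s)"
    using sets_bind'[OF b] by simp
  fix A assume "A \<in> sets (distr M borel X)"
  then have A: "A \<in> sets borel" by simp
  have "emeasure (distr M borel X) A = emeasure M {\<omega>\<in>space M. X \<omega> \<in> A \<and> Y \<omega> \<in> UNIV}"
    using A by (subst emeasure_distr) (auto simp: vimage_def Int_def conj_commute)
  also have "\<dots> = (\<integral>\<^sup>+y. emeasure (posterior (distr M borel X) c s y) A \<partial>distr M borel Y)"
    using is_cond_law_posterior A unfolding is_cond_law_def by force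
  also have "\<dots> = emeasure (distr M borel Y \<bind> posterior (distr M borel X) c s) A"
    using emeasure_bind_prob_algebra[OF b A] by simp
  finally show "emeasure (distr M borel X) A = emeasure (distr M borel Y \<bind> posterior (distr M borel X) c s) A" .
qed

end

text \<open>
  By reversibility the density of \<open>\<alpha> N + \<beta> W\<close> at \<open>y\<close> is the standard Gaussian density there times
  the total mass of a Gaussian centred at \<open>\<alpha> y\<close>.
\<close>

lemma std_gaussian_rotation:
  fixes N W :: "'m \<Rightarrow> 'v::euclidean_space"
  assumes ch: "gaussian_channel M N W Y \<alpha> \<beta>" and law_N: "distr M borel N = std_gaussian" and ab: "\<alpha>\<^sup>2 + \<beta>\<^sup>2 = 1"
  shows "distr M borel Y = std_gaussian"
proof -
  interpret gaussian_channel M N W Y \<alpha> \<beta> by (rule ch)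
  have "ennreal (noised_density (distr M borel N) \<alpha> \<beta> y) = ennreal (gauss_kernel 1 y)" for y
  proof -
    have "ennreal (noised_density (distr M borel N) \<alpha> \<beta> y) = (\<integral>\<^sup>+x. ennreal (gauss_kernel \<beta> (y - \<alpha> *\<^sub>R x)) \<partial>std_gaussian)"
      using law.nn_integral_gauss_kernel[of \<beta> y \<alpha>] unfolding law_N by simp
    also have "\<dots> = (\<integral>\<^sup>+x. ennreal (gauss_kernel \<beta> (y - \<alpha> *\<^sub>R x) * gauss_kernel 1 x) \<partial>lborel)"
      unfolding std_gaussian_eq by (subst nn_integral_density) (auto simp: ennreal_mult gauss_kernel_nonneg mult.commute)
    also have "\<dots> = ennreal (gauss_kernel 1 y) * (\<integral>\<^sup>+x. ennreal (gauss_kernel \<beta> (x - \<alpha> *\<^sub>R y)) * 1 \<partial>lborel)"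
      unfolding gauss_kernel_reverse[OF ab s]
      by (subst nn_integral_cmult[symmetric]) (auto simp: ennreal_mult gauss_kernel_nonneg)
    also have "(\<integral>\<^sup>+x. ennreal (gauss_kernel \<beta> (x - \<alpha> *\<^sub>R y)) * 1 \<partial>lborel) = (\<integral>\<^sup>+n. 1 \<partial>(std_gaussian :: 'v measure))"
      by (rule nn_integral_std_gaussian_affine[OF s, symmetric]) simp
    also have "\<dots> = 1" using prob_gauss by (simp add: prob_space.emeasure_space_1)
    finally show ?thesis by simp
  qed
  then show ?thesis unfolding distr_Y std_gaussian_eq by simp
qed

section \<open>Exponential integrals are differentiable\<close>

lemma abs_exp_minus_linear_le: "\<bar>exp t - 1 - t\<bar> \<le> t\<^sup>2 / 2 * exp \<bar>t :: real\<bar>"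
proof -
  obtain r where r: "\<bar>r\<bar> \<le> \<bar>t\<bar>" "exp t = (\<Sum>m<2. t ^ m / fact m) + exp r / fact 2 * t ^ 2"
    using Maclaurin_exp_le[of t 2] by blast
  then have "exp t - 1 - t = t\<^sup>2 / 2 * exp r" by (simp add: numeral_2_eq_2)
  then have "\<bar>exp t - 1 - t\<bar> = t\<^sup>2 / 2 * exp r" by (simp only: abs_of_nonneg) simp
  also have "\<dots> \<le> t\<^sup>2 / 2 * exp \<bar>t\<bar>" using r by (intro mult_left_mono) auto
  finally show ?thesis .
qed

text \<open>
  Integrability against \<open>exp (t \<parallel>x\<parallel>)\<close> for all \<open>t\<close> absorbs every polynomial factor, so a single
  assumption supports differentiation any number of times.  Vector-valued \<open>g\<close> allows the same
  lemma to yield the gradient and the Hessian.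
\<close>

locale all_exp_moments =
  fixes \<mu> :: "'v::euclidean_space measure" and g :: "'v \<Rightarrow> 'w::{banach, second_countable_topology}"
  assumes sets_mu[measurable_cong]: "sets \<mu> = sets borel"
    and g[measurable]: "g \<in> borel_measurable borel"
    and moment: "\<And>t. integrable \<mu> (\<lambda>x. exp (t * norm x) * norm (g x))"
begin

lemma integrable_exp_tilt: "integrable \<mu> (\<lambda>x. exp (u \<bullet> x) *\<^sub>R g x)"
proof (rule Bochner_Integration.integrable_bound[OF moment[of "norm u"]])
  show "AE x in \<mu>. norm (exp (u \<bullet> x) *\<^sub>R g x) \<le> norm (exp (norm u * norm x) * norm (g x))"
    using norm_cauchy_schwarz[of u] by (auto intro!: mult_right_mono)
qed measurable

lemma abs_inner_exp_le: "\<bar>h \<bullet> x\<bar> * exp (u \<bullet> x) \<le> norm h * exp ((norm u + 1) * norm (x :: 'v))"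
proof -
  have "norm x \<le> exp (norm x)" using exp_ge_add_one_self[of "norm x"] by linarith
  then have "\<bar>h \<bullet> x\<bar> \<le> norm h * exp (norm x)"
    using Cauchy_Schwarz_ineq2[of h x] by (meson mult_left_mono norm_ge_zero order_trans)
  moreover have "exp (u \<bullet> x) \<le> exp (norm u * norm x)" using norm_cauchy_schwarz[of u x] by simp
  ultimately have "\<bar>h \<bullet> x\<bar> * exp (u \<bullet> x) \<le> (norm h * exp (norm x)) * exp (norm u * norm x)"
    by (intro mult_mono) auto
  also have "(norm h * exp (norm x)) * exp (norm u * norm x) = norm h * exp ((norm u + 1) * norm x)"
    by (simp add: distrib_right exp_add)
  finally show ?thesis .
qed

lemma norm_inner_exp_tilt_le:
  "norm (((h \<bullet> x) * exp (u \<bullet> x)) *\<^sub>R g x) \<le> norm h * (exp ((norm u + 1) * norm x) * norm (g x))"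
  using mult_right_mono[OF abs_inner_exp_le[of h x u] norm_ge_zero[of "g x"]] by (simp add: abs_mult mult.assoc)

lemma integrable_inner_exp_tilt: "integrable \<mu> (\<lambda>x. ((h \<bullet> x) * exp (u \<bullet> x)) *\<^sub>R g x)"
proof (rule Bochner_Integration.integrable_bound[OF integrable_mult_right[OF moment[of "norm u + 1"], of "norm h"]])
  show "AE x in \<mu>. norm (((h \<bullet> x) * exp (u \<bullet> x)) *\<^sub>R g x) \<le>
      norm (norm h * (exp ((norm u + 1) * norm x) * norm (g x)))"
    using norm_inner_exp_tilt_le by (intro AE_I2) (simp del: norm_scaleR)
qed measurable

text \<open>
  The second-order remainder of the exponential gives, for \<open>\<parallel>h\<parallel> \<le> 1\<close>, an error of at most
  \<open>\<parallel>h\<parallel>\<^sup>2 exp ((\<parallel>u\<parallel> + 2) \<parallel>x\<parallel>)\<close> pointwise, which is integrable against \<open>g\<close> by assumption.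
\<close>

lemma exp_tilt_has_derivative:
  "((\<lambda>u. \<integral>x. exp (u \<bullet> x) *\<^sub>R g x \<partial>\<mu>) has_derivative
    (\<lambda>h. \<integral>x. ((h \<bullet> x) * exp (u \<bullet> x)) *\<^sub>R g x \<partial>\<mu>)) (at u)"
proof (rule has_derivativeI_sandwich[of 1])
  define C where "C = (\<integral>x. exp ((norm u + 2) * norm x) * norm (g x) \<partial>\<mu>)"
  define C1 where "C1 = (\<integral>x. exp ((norm u + 1) * norm x) * norm (g x) \<partial>\<mu>)"
  let ?F = "\<lambda>u. \<integral>x. exp (u \<bullet> x) *\<^sub>R g x \<partial>\<mu>" and ?D = "\<lambda>h. \<integral>x. ((h \<bullet> x) * exp (u \<bullet> x)) *\<^sub>R g x \<partial>\<mu>"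
  show "bounded_linear ?D"
  proof (rule bounded_linear_intro[where K=C1])
    show "?D (h + k) = ?D h + ?D k" for h k
      by (subst Bochner_Integration.integral_add[symmetric])
        (auto simp: integrable_inner_exp_tilt inner_add_left algebra_simps)
    show "?D (r *\<^sub>R h) = r *\<^sub>R ?D h" for r h
      by (subst integral_scaleR_right[symmetric]) (simp add: mult.assoc)
    show "norm (?D h) \<le> norm h * C1" for h
    proof -
      have "norm (?D h) \<le> (\<integral>x. norm h * (exp ((norm u + 1) * norm x) * norm (g x)) \<partial>\<mu>)"
        by (intro order_trans[OF integral_norm_bound] integral_mono norm_inner_exp_tilt_le
            integrable_norm integrable_inner_exp_tilt integrable_mult_right moment)
      then show ?thesis by (simp add: C1_def)
    qed
  qed
  show "norm (?F v - ?F u - ?D (v - u)) / norm (v - u) \<le> C * norm (v - u)"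
    if "v \<noteq> u" "dist v u < 1" for v
  proof -
    define h where "h = v - u"
    have h: "norm h \<le> 1" "h \<noteq> 0" "v = u + h" using that by (auto simp: h_def dist_norm)
    have pt: "\<bar>exp (v \<bullet> x) - exp (u \<bullet> x) - (h \<bullet> x) * exp (u \<bullet> x)\<bar> \<le> (norm h)\<^sup>2 * exp ((norm u + 2) * norm x)" for x
    proof -
      have hx: "\<bar>h \<bullet> x\<bar> \<le> norm h * norm x" by (rule Cauchy_Schwarz_ineq2)
      have "1 + norm x + (norm x)\<^sup>2 / 2 \<le> exp (norm x)" by (rule exp_lower_Taylor_quadratic) simp
      then have x2: "(norm x)\<^sup>2 / 2 \<le> exp (norm x)" using norm_ge_zero[of x] by linarith
      have "(h \<bullet> x)\<^sup>2 \<le> (norm h * norm x)\<^sup>2" using hx by (simp add: abs_le_square_iff[symmetric])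
      then have "(h \<bullet> x)\<^sup>2 / 2 \<le> (norm h)\<^sup>2 * ((norm x)\<^sup>2 / 2)" by (simp add: power_mult_distrib)
      also have "\<dots> \<le> (norm h)\<^sup>2 * exp (norm x)" by (intro mult_left_mono x2) simp
      finally have 1: "(h \<bullet> x)\<^sup>2 / 2 \<le> (norm h)\<^sup>2 * exp (norm x)" .
      have "\<bar>h \<bullet> x\<bar> \<le> norm x" using hx h mult_right_mono[OF h(1), of "norm x"] by simp
      then have 2: "exp \<bar>h \<bullet> x\<bar> \<le> exp (norm x)" by simp
      have 3: "exp (u \<bullet> x) \<le> exp (norm u * norm x)" using norm_cauchy_schwarz[of u x] by simp
      have "exp (v \<bullet> x) - exp (u \<bullet> x) - (h \<bullet> x) * exp (u \<bullet> x) = exp (u \<bullet> x) * (exp (h \<bullet> x) - 1 - h \<bullet> x)"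
        unfolding h by (simp add: inner_add_left exp_add algebra_simps)
      then have "\<bar>exp (v \<bullet> x) - exp (u \<bullet> x) - (h \<bullet> x) * exp (u \<bullet> x)\<bar> = exp (u \<bullet> x) * \<bar>exp (h \<bullet> x) - 1 - h \<bullet> x\<bar>"
        by (simp add: abs_mult)
      also have "\<dots> \<le> exp (norm u * norm x) * ((norm h)\<^sup>2 * exp (norm x) * exp (norm x))"
        using order_trans[OF abs_exp_minus_linear_le mult_mono[OF 1 2]] 3 by (intro mult_mono) auto
      also have "\<dots> = (norm h)\<^sup>2 * exp ((norm u + 2) * norm x)"
      proof -
        have "(norm u + 2) * norm x = norm u * norm x + norm x + norm x" by (simp add: algebra_simps)
        then show ?thesis by (simp only: exp_add mult_ac)
      qed
      finally show ?thesis .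
    qed
    have "?F v - ?F u - ?D h = (\<integral>x. (exp (v \<bullet> x) - exp (u \<bullet> x) - (h \<bullet> x) * exp (u \<bullet> x)) *\<^sub>R g x \<partial>\<mu>)"
      by (simp add: scaleR_diff_left integrable_exp_tilt integrable_inner_exp_tilt)
    also have "norm \<dots> \<le> (\<integral>x. (norm h)\<^sup>2 * (exp ((norm u + 2) * norm x) * norm (g x)) \<partial>\<mu>)"
    proof (intro order_trans[OF integral_norm_bound] integral_mono integrable_norm)
      show "integrable \<mu> (\<lambda>x. (exp (v \<bullet> x) - exp (u \<bullet> x) - (h \<bullet> x) * exp (u \<bullet> x)) *\<^sub>R g x)"
        by (simp add: scaleR_diff_left integrable_exp_tilt integrable_inner_exp_tilt)
      show "integrable \<mu> (\<lambda>x. (norm h)\<^sup>2 * (exp ((norm u + 2) * norm x) * norm (g x)))"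
        by (intro integrable_mult_right moment)
      show "norm ((exp (v \<bullet> x) - exp (u \<bullet> x) - (h \<bullet> x) * exp (u \<bullet> x)) *\<^sub>R g x) \<le>
          (norm h)\<^sup>2 * (exp ((norm u + 2) * norm x) * norm (g x))" for x
        using mult_right_mono[OF pt[of x] norm_ge_zero[of "g x"]] by (simp add: mult.assoc)
    qed
    finally have "norm (?F v - ?F u - ?D h) \<le> (norm h)\<^sup>2 * C" by (simp add: C_def)
    then show ?thesis using h unfolding h_def[symmetric]
      by (simp add: divide_le_eq power2_eq_square mult_ac)
  qed
  have "((\<lambda>v. C * norm (v - u)) \<longlongrightarrow> C * norm (u - u)) (at u)" by (intro tendsto_intros)
  then show "((\<lambda>v. C * norm (v - u)) \<longlongrightarrow> 0) (at u)" by simp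
qed simp

end

section \<open>The Hessian of a noised log-density is a posterior covariance\<close>

lemma gauss_weight_exp_moment:
  fixes x :: "'v::euclidean_space"
  assumes "0 < b" shows "exp (t * norm x) * exp (- b * (norm x)\<^sup>2) \<le> exp (t\<^sup>2 / (4 * b))"
proof -
  have "0 \<le> (2 * b * norm x - t)\<^sup>2" by simp
  then have "4 * b * (t * norm x - b * (norm x)\<^sup>2) \<le> t\<^sup>2" by (simp add: power2_eq_square algebra_simps)
  then have "t * norm x + - b * (norm x)\<^sup>2 \<le> t\<^sup>2 / (4 * b)" using assms by (simp add: field_simps)
  then show ?thesis by (simp flip: exp_add)
qed

text \<open>
  Expanding the square in the Gaussian kernel splits it into a factor depending on \<open>y\<close>, the
  exponential of a linear form in \<open>x\<close>, and this weight.
\<close>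

definition gauss_weight :: "real \<Rightarrow> real \<Rightarrow> 'v::euclidean_space \<Rightarrow> real" where
  "gauss_weight c s x = exp (- (c\<^sup>2 / (2 * s\<^sup>2)) * (norm x)\<^sup>2)"

definition tilt_const :: "real \<Rightarrow> 'v::euclidean_space \<Rightarrow> real" where
  "tilt_const s y = (2 * pi * s\<^sup>2) powr (- real DIM('v) / 2) * exp (- (y \<bullet> y) / (2 * s\<^sup>2))"

lemma gauss_kernel_eq_tilt:
  fixes x y :: "'v::euclidean_space"
  assumes "s \<noteq> 0"
  shows "gauss_kernel s (y - c *\<^sub>R x) = tilt_const s y * (exp (((c / s\<^sup>2) *\<^sub>R y) \<bullet> x) * gauss_weight c s x)"
proof -
  have "- (norm (y - c *\<^sub>R x))\<^sup>2 / (2 * s\<^sup>2) =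
     - (y \<bullet> y) / (2 * s\<^sup>2) + (((c / s\<^sup>2) *\<^sub>R y) \<bullet> x + - (c\<^sup>2 / (2 * s\<^sup>2)) * (norm x)\<^sup>2)"
    using assms unfolding power2_norm_eq_inner
    by (simp add: inner_diff inner_commute field_simps power2_eq_square)
  then show ?thesis unfolding gauss_kernel_def tilt_const_def gauss_weight_def exp_add[symmetric] mult.assoc
    by simp
qed

lemma gauss_weight_measurable[measurable]: "gauss_weight c s \<in> borel_measurable borel"
  unfolding gauss_weight_def by measurable

lemma gauss_weight_pos: "0 < gauss_weight c s x"
  unfolding gauss_weight_def by simp

text \<open>
  Since \<open>c \<noteq> 0\<close>, the weight decays like a Gaussian and creates all exponential moments, whatever the
  law \<open>\<mu>\<close> is.
\<close>

locale noised = borel_prob \<mu> for \<mu> :: "'v::euclidean_space measure" +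
  fixes c s :: real
  assumes c: "c \<noteq> 0" and s: "0 < s"

sublocale noised \<subseteq> mass: all_exp_moments \<mu> "gauss_weight c s"
proof
  have b: "0 < c\<^sup>2 / (2 * s\<^sup>2)" using c s by simp
  show "integrable \<mu> (\<lambda>x. exp (t * norm x) * norm (gauss_weight c s x))" for t
    using gauss_weight_exp_moment[OF b, of t]
    by (intro integrable_const_bound[of _ "exp (t\<^sup>2 / (4 * (c\<^sup>2 / (2 * s\<^sup>2))))"]) (auto simp: gauss_weight_def)
qed (auto simp: sets_mu)

sublocale noised \<subseteq> mean: all_exp_moments \<mu> "\<lambda>x. gauss_weight c s x *\<^sub>R x"
proof
  show "integrable \<mu> (\<lambda>x. exp (t * norm x) * norm (gauss_weight c s x *\<^sub>R x))" for t
  proof (rule Bochner_Integration.integrable_bound[OF mass.moment[of "t + 1"]])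
    have "exp (t * norm x) * (gauss_weight c s x * norm x) \<le> exp ((t + 1) * norm x) * gauss_weight c s x" for x :: 'v
    proof -
      have "norm x \<le> exp (norm x)" using exp_ge_add_one_self[of "norm x"] by linarith
      then have "(exp (t * norm x) * gauss_weight c s x) * norm x \<le> (exp (t * norm x) * gauss_weight c s x) * exp (norm x)"
        by (intro mult_left_mono) (auto simp: less_imp_le gauss_weight_pos)
      also have "\<dots> = exp ((t + 1) * norm x) * gauss_weight c s x"
        by (simp add: distrib_right exp_add)
      finally show ?thesis by (simp only: mult.assoc)
    qed
    then show "AE x in \<mu>. norm (exp (t * norm x) * norm (gauss_weight c s x *\<^sub>R x)) \<le>
        norm (exp ((t + 1) * norm x) * norm (gauss_weight c s x))"
      by (auto simp: abs_mult abs_of_pos[OF gauss_weight_pos])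
  qed measurable
qed (auto simp: sets_mu)

context noised
begin

abbreviation "post \<equiv> posterior \<mu> c s"
abbreviation "tilt y \<equiv> (c / s\<^sup>2) *\<^sub>R (y :: 'v)"

definition partition :: "'v \<Rightarrow> real" where
  "partition u = (\<integral>x. exp (u \<bullet> x) *\<^sub>R gauss_weight c s x \<partial>\<mu>)"

definition first_moment :: "'v \<Rightarrow> 'v" where
  "first_moment u = (\<integral>x. exp (u \<bullet> x) *\<^sub>R (gauss_weight c s x *\<^sub>R x) \<partial>\<mu>)"

lemma s0: "s \<noteq> 0" using s by simp

lemma tilt_const_pos: "0 < tilt_const s (y :: 'v)"
  unfolding tilt_const_def using s by simp

lemma noised_density_eq_partition: "noised_density \<mu> c s y = tilt_const s y * partition (tilt y)"
  unfolding noised_density_def partition_def gauss_kernel_eq_tilt[OF s0] by simp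

lemma partition_pos: "0 < partition (tilt y)"
  using noised_density_pos[OF s0, of c y] tilt_const_pos[of y]
  unfolding noised_density_eq_partition by (simp add: zero_less_mult_iff)

lemma integral_posterior_eq_tilt:
  fixes f :: "'v \<Rightarrow> 'w::{banach, second_countable_topology}"
  assumes [measurable]: "f \<in> borel_measurable borel"
  shows "(\<integral>x. f x \<partial>post y) = (\<integral>x. exp (tilt y \<bullet> x) *\<^sub>R (gauss_weight c s x *\<^sub>R f x) \<partial>\<mu>) /\<^sub>R partition (tilt y)"
proof -
  have "(\<integral>x. gauss_kernel s (y - c *\<^sub>R x) *\<^sub>R f x \<partial>\<mu>) =
      tilt_const s y *\<^sub>R (\<integral>x. exp (tilt y \<bullet> x) *\<^sub>R (gauss_weight c s x *\<^sub>R f x) \<partial>\<mu>)"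
    unfolding gauss_kernel_eq_tilt[OF s0] by (subst integral_scaleR_right[symmetric]) (simp add: mult.assoc)
  then show ?thesis using tilt_const_pos[of y]
    by (simp add: integral_posterior[OF s0 assms] noised_density_eq_partition)
qed

lemma integrable_posterior_if_tilt:
  fixes f :: "'v \<Rightarrow> 'w::{banach, second_countable_topology}"
  assumes [measurable]: "f \<in> borel_measurable borel"
    and i: "integrable \<mu> (\<lambda>x. exp (tilt y \<bullet> x) *\<^sub>R (gauss_weight c s x *\<^sub>R f x))"
  shows "integrable (post y) f"
proof -
  have "integrable \<mu> (\<lambda>x. (tilt_const s y / noised_density \<mu> c s y) *\<^sub>R
      (exp (tilt y \<bullet> x) *\<^sub>R (gauss_weight c s x *\<^sub>R f x)))"
    using i by (rule integrable_scaleR_right)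
  then have "integrable \<mu> (\<lambda>x. (gauss_kernel s (y - c *\<^sub>R x) / noised_density \<mu> c s y) *\<^sub>R f x)"
    unfolding gauss_kernel_eq_tilt[OF s0] by (simp add: mult_ac)
  then show ?thesis unfolding posterior_def using noised_density_pos[OF s0, of c y]
    by (subst integrable_density) (auto simp: gauss_kernel_nonneg)
qed

lemma integrable_posterior_id: "integrable (post y) (\<lambda>x. x)"
  by (intro integrable_posterior_if_tilt mean.integrable_exp_tilt) simp

lemma integrable_posterior_quadratic: "integrable (post y) (\<lambda>x. (h \<bullet> x) *\<^sub>R x)"
  using mean.integrable_inner_exp_tilt[of h "tilt y"]
  by (intro integrable_posterior_if_tilt) (auto simp: mult_ac)

definition post_mean :: "'v \<Rightarrow> 'v" where "post_mean y = (\<integral>x. x \<partial>post y)"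

lemma post_mean_eq: "post_mean y = first_moment (tilt y) /\<^sub>R partition (tilt y)"
  unfolding post_mean_def first_moment_def by (rule integral_posterior_eq_tilt) simp

lemma cov_integrable: "integrable (post y) (\<lambda>x. ((x - post_mean y) \<bullet> h) *\<^sub>R (x - post_mean y))"
proof -
  interpret P: prob_space "post y" by (rule prob_posterior[OF s0])
  have "(\<lambda>x. ((x - post_mean y) \<bullet> h) *\<^sub>R (x - post_mean y)) =
    (\<lambda>x. (h \<bullet> x) *\<^sub>R x - (x \<bullet> h) *\<^sub>R post_mean y - (post_mean y \<bullet> h) *\<^sub>R x + (post_mean y \<bullet> h) *\<^sub>R post_mean y)"
    by (auto simp: fun_eq_iff inner_diff algebra_simps inner_commute)
  then show ?thesis using integrable_posterior_id integrable_posterior_quadratic by simp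
qed

text \<open>
  The derivative of \<open>first_moment\<close> is a second moment; this is the form in
  which the covariance appears when the posterior mean, a quotient, is differentiated.
\<close>

lemma cov_op_posterior:
  "cov_op (post y) h = (\<integral>x. ((h \<bullet> x) * exp (tilt y \<bullet> x)) *\<^sub>R (gauss_weight c s x *\<^sub>R x) \<partial>\<mu>) /\<^sub>R partition (tilt y)
     - (post_mean y \<bullet> h) *\<^sub>R post_mean y"
proof -
  interpret P: prob_space "post y" by (rule prob_posterior[OF s0])
  have e: "(\<lambda>x. ((x - post_mean y) \<bullet> h) *\<^sub>R (x - post_mean y)) =
    (\<lambda>x. (h \<bullet> x) *\<^sub>R x - (x \<bullet> h) *\<^sub>R post_mean y - (post_mean y \<bullet> h) *\<^sub>R x + (post_mean y \<bullet> h) *\<^sub>R post_mean y)"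
    by (auto simp: fun_eq_iff inner_diff algebra_simps inner_commute)
  have "cov_op (post y) h = (\<integral>x. ((x - post_mean y) \<bullet> h) *\<^sub>R (x - post_mean y) \<partial>post y)"
    unfolding cov_op_def post_mean_def Let_def ..
  also have "\<dots> = (\<integral>x. (h \<bullet> x) *\<^sub>R x \<partial>post y) - (post_mean y \<bullet> h) *\<^sub>R post_mean y"
    unfolding e using integrable_posterior_id integrable_posterior_quadratic
    by (simp add: P.prob_space post_mean_def[symmetric])
  also have "(\<integral>x. (h \<bullet> x) *\<^sub>R x \<partial>post y) =
      (\<integral>x. ((h \<bullet> x) * exp (tilt y \<bullet> x)) *\<^sub>R (gauss_weight c s x *\<^sub>R x) \<partial>\<mu>) /\<^sub>R partition (tilt y)"
    by (subst integral_posterior_eq_tilt) (auto simp: mult_ac)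
  finally show ?thesis .
qed

lemma bounded_linear_cov_op: "bounded_linear (cov_op (post y))"
proof (rule linear_conv_bounded_linear[THEN iffD1])
  have e: "cov_op (post y) = (\<lambda>h. \<integral>x. ((x - post_mean y) \<bullet> h) *\<^sub>R (x - post_mean y) \<partial>post y)"
    unfolding cov_op_def post_mean_def Let_def ..
  show "linear (cov_op (post y))" unfolding e
  proof (rule linearI)
    show "(\<integral>x. ((x - post_mean y) \<bullet> (h + k)) *\<^sub>R (x - post_mean y) \<partial>post y) =
       (\<integral>x. ((x - post_mean y) \<bullet> h) *\<^sub>R (x - post_mean y) \<partial>post y) + (\<integral>x. ((x - post_mean y) \<bullet> k) *\<^sub>R (x - post_mean y) \<partial>post y)" for h k
      by (simp add: inner_add_right scaleR_add_left cov_integrable)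
    show "(\<integral>x. ((x - post_mean y) \<bullet> (r *\<^sub>R h)) *\<^sub>R (x - post_mean y) \<partial>post y) =
       r *\<^sub>R (\<integral>x. ((x - post_mean y) \<bullet> h) *\<^sub>R (x - post_mean y) \<partial>post y)" for r h
      by (subst integral_scaleR_right[symmetric]) simp
  qed
qed

lemma cov_op_nonneg: "0 \<le> h \<bullet> cov_op (post y) h"
proof -
  have "h \<bullet> cov_op (post y) h = (\<integral>x. h \<bullet> (((x - post_mean y) \<bullet> h) *\<^sub>R (x - post_mean y)) \<partial>post y)"
    unfolding cov_op_def post_mean_def[symmetric] Let_def
    by (rule integral_inner_right[symmetric]) (rule cov_integrable)
  also have "\<dots> = (\<integral>x. ((x - post_mean y) \<bullet> h)\<^sup>2 \<partial>post y)"
    by (simp add: power2_eq_square inner_commute)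
  also have "0 \<le> \<dots>" by simp
  finally show ?thesis .
qed

lemma cov_op_le: "h \<bullet> cov_op (post y) h \<le> onorm (cov_op (post y)) * (h \<bullet> h)"
proof -
  have "h \<bullet> cov_op (post y) h \<le> norm h * norm (cov_op (post y) h)" by (rule norm_cauchy_schwarz)
  also have "\<dots> \<le> norm h * (onorm (cov_op (post y)) * norm h)"
    by (intro mult_left_mono onorm bounded_linear_cov_op) simp
  finally show ?thesis by (simp add: power2_norm_eq_inner[symmetric] power2_eq_square mult_ac)
qed

lemma partition_has_derivative: "(partition has_derivative (\<lambda>h. h \<bullet> first_moment u)) (at u)"
proof -
  have "(\<integral>x. ((h \<bullet> x) * exp (u \<bullet> x)) *\<^sub>R gauss_weight c s x \<partial>\<mu>) = h \<bullet> first_moment u" for h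
    unfolding first_moment_def
    by (subst integral_inner_right[symmetric]) (auto simp: mult_ac intro: mean.integrable_exp_tilt[simplified])
  then show ?thesis using mass.exp_tilt_has_derivative[of u] by (simp add: partition_def[abs_def])
qed

text \<open>
  Tweedie's formula: the score of the noised density at \<open>y\<close> is a linear combination of \<open>y\<close> and
  the posterior mean.
\<close>

lemma gderiv_ln_noised_density:
  "GDERIV (\<lambda>z. ln (noised_density \<mu> c s z)) y :> - (1 / s\<^sup>2) *\<^sub>R y + (c / s\<^sup>2) *\<^sub>R post_mean y"
proof -
  define A where "A = (2 * pi * s\<^sup>2) powr (- real DIM('v) / 2)"
  have A: "0 < A" using s by (simp add: A_def)
  have e: "(\<lambda>z. ln (noised_density \<mu> c s z)) = (\<lambda>z. ln A + - (z \<bullet> z) / (2 * s\<^sup>2) + ln (partition (tilt z)))"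
  proof
    show "ln (noised_density \<mu> c s z) = ln A + - (z \<bullet> z) / (2 * s\<^sup>2) + ln (partition (tilt z))" for z
      using partition_pos[of z] A unfolding noised_density_eq_partition tilt_const_def A_def[symmetric]
      by (simp add: ln_mult)
  qed
  have dZ: "((\<lambda>z. partition (tilt z)) has_derivative (\<lambda>h. tilt h \<bullet> first_moment (tilt y))) (at y)"
    by (rule has_derivative_compose[OF _ partition_has_derivative]) (auto intro!: derivative_eq_intros)
  have first_moment_eq: "first_moment (tilt y) = partition (tilt y) *\<^sub>R post_mean y" using partition_pos[of y] by (simp add: post_mean_eq)
  have "((\<lambda>z. ln A + - (z \<bullet> z) / (2 * s\<^sup>2) + ln (partition (tilt z))) has_derivative
      (\<lambda>h. - (h \<bullet> y) / s\<^sup>2 + (tilt h \<bullet> first_moment (tilt y)) / partition (tilt y))) (at y)"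
    using partition_pos[of y] s
    by (auto intro!: derivative_eq_intros dZ simp: fun_eq_iff inner_commute field_simps)
  also have "(\<lambda>h. - (h \<bullet> y) / s\<^sup>2 + (tilt h \<bullet> first_moment (tilt y)) / partition (tilt y)) =
      (\<lambda>h. h \<bullet> (- (1 / s\<^sup>2) *\<^sub>R y + (c / s\<^sup>2) *\<^sub>R post_mean y))"
    unfolding first_moment_eq using partition_pos[of y] by (simp add: fun_eq_iff inner_diff_right)
  finally show ?thesis unfolding e gderiv_def .
qed

text \<open>
  The quotient rule subtracts the outer square of the mean from the second moment, so the
  posterior mean, as a function of the tilt, has the posterior covariance as its derivative; the
  factor \<open>c / s\<^sup>2\<close> is the derivative of the tilt.
\<close>

lemma post_mean_has_derivative: "(post_mean has_derivative (\<lambda>h. (c / s\<^sup>2) *\<^sub>R cov_op (post y) h)) (at y)"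
proof -
  have t: "(tilt has_derivative tilt) (at y)" by (auto intro!: derivative_eq_intros)
  have dZ: "((\<lambda>z. partition (tilt z)) has_derivative (\<lambda>h. tilt h \<bullet> first_moment (tilt y))) (at y)"
    by (rule has_derivative_compose[OF t partition_has_derivative])
  have dV: "((\<lambda>z. first_moment (tilt z)) has_derivative (\<lambda>h. \<integral>x. ((tilt h \<bullet> x) * exp (tilt y \<bullet> x)) *\<^sub>R (gauss_weight c s x *\<^sub>R x) \<partial>\<mu>)) (at y)"
    unfolding first_moment_def by (rule has_derivative_compose[OF t mean.exp_tilt_has_derivative])
  have e: "post_mean = (\<lambda>z. inverse (partition (tilt z)) *\<^sub>R first_moment (tilt z))" by (simp add: fun_eq_iff post_mean_eq)
  have Q: "(\<integral>x. ((tilt h \<bullet> x) * exp (tilt y \<bullet> x)) *\<^sub>R (gauss_weight c s x *\<^sub>R x) \<partial>\<mu>) =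
      (c / s\<^sup>2) *\<^sub>R (partition (tilt y) *\<^sub>R (cov_op (post y) h + (post_mean y \<bullet> h) *\<^sub>R post_mean y))" for h
  proof -
    have "(\<integral>x. ((tilt h \<bullet> x) * exp (tilt y \<bullet> x)) *\<^sub>R (gauss_weight c s x *\<^sub>R x) \<partial>\<mu>) =
      (c / s\<^sup>2) *\<^sub>R (\<integral>x. ((h \<bullet> x) * exp (tilt y \<bullet> x)) *\<^sub>R (gauss_weight c s x *\<^sub>R x) \<partial>\<mu>)"
      by (subst integral_scaleR_right[symmetric]) (simp add: mult.assoc)
    then show ?thesis using partition_pos[of y] by (simp add: cov_op_posterior)
  qed
  have partition_ne: "partition (tilt y) \<noteq> 0" using partition_pos[of y] by simp
  have first_moment_eq: "first_moment (tilt y) = partition (tilt y) *\<^sub>R post_mean y" using partition_pos[of y] by (simp add: post_mean_eq)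
  have "(post_mean has_derivative (\<lambda>h. inverse (partition (tilt y)) *\<^sub>R
        (\<integral>x. ((tilt h \<bullet> x) * exp (tilt y \<bullet> x)) *\<^sub>R (gauss_weight c s x *\<^sub>R x) \<partial>\<mu>)
      + (- (inverse (partition (tilt y)) * (tilt h \<bullet> first_moment (tilt y)) * inverse (partition (tilt y)))) *\<^sub>R first_moment (tilt y))) (at y)"
    unfolding e by (rule has_derivative_scaleR[OF Deriv.has_derivative_inverse[OF partition_ne dZ] dV])
  also have "(\<lambda>h. inverse (partition (tilt y)) *\<^sub>R
        (\<integral>x. ((tilt h \<bullet> x) * exp (tilt y \<bullet> x)) *\<^sub>R (gauss_weight c s x *\<^sub>R x) \<partial>\<mu>)
      + (- (inverse (partition (tilt y)) * (tilt h \<bullet> first_moment (tilt y)) * inverse (partition (tilt y)))) *\<^sub>R first_moment (tilt y)) =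
      (\<lambda>h. (c / s\<^sup>2) *\<^sub>R cov_op (post y) h)"
    unfolding Q first_moment_eq using partition_pos[of y] by (simp add: fun_eq_iff scaleR_add_right inner_commute field_simps)
  finally show ?thesis .
qed

lemma score_has_derivative:
  "((\<lambda>y. - (1 / s\<^sup>2) *\<^sub>R y + (c / s\<^sup>2) *\<^sub>R post_mean y) has_derivative
    (\<lambda>h. - (1 / s\<^sup>2) *\<^sub>R h + (c / s\<^sup>2) *\<^sub>R ((c / s\<^sup>2) *\<^sub>R cov_op (post y) h))) (at y)"
  by (intro has_derivative_add has_derivative_scaleR_right has_derivative_ident post_mean_has_derivative)

end

section \<open>Strong log-concavity of noised densities and backward conditionals\<close>

lemma gderiv_unique:
  assumes "GDERIV f x :> g" "GDERIV f x :> g'" shows "g = g'"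
proof -
  have "(\<lambda>h. h \<bullet> g) = (\<lambda>h. h \<bullet> g')" using assms unfolding gderiv_def by (rule has_derivative_unique)
  then have "(g - g') \<bullet> g = (g - g') \<bullet> g'" by (rule fun_cong)
  then have "(g - g') \<bullet> (g - g') = 0" by (simp add: inner_diff_right)
  then show ?thesis by simp
qed

lemma score_eqI: "GDERIV (\<lambda>z. ln (p z)) x :> g \<Longrightarrow> score p x = g"
  unfolding score_def by (rule the_equality) (auto intro: gderiv_unique)

text \<open>
  \<^const>\<open>score\<close> is a definite description, so existence of the gradient has to be
  extracted from differentiability; the gradient is assembled from the partial derivatives.
\<close>

lemma gderiv_score:
  fixes p :: "'v::euclidean_space \<Rightarrow> real"
  assumes "(\<lambda>z. ln (p z)) differentiable (at x)"
  shows "GDERIV (\<lambda>z. ln (p z)) x :> score p x"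
proof -
  obtain D where D: "((\<lambda>z. ln (p z)) has_derivative D) (at x)" using assms by (auto simp: differentiable_def)
  interpret bounded_linear D using D by (rule has_derivative_bounded_linear)
  define g where "g = (\<Sum>i\<in>Basis. D i *\<^sub>R i)"
  have "D h = h \<bullet> g" for h
  proof -
    have "D h = D (\<Sum>i\<in>Basis. (h \<bullet> i) *\<^sub>R i)" by (simp add: euclidean_representation)
    also have "\<dots> = (\<Sum>i\<in>Basis. (h \<bullet> i) * D i)" by (simp add: sum scaleR)
    finally show ?thesis by (simp add: g_def inner_sum_right mult.commute)
  qed
  then have "D = (\<lambda>h. h \<bullet> g)" by (rule ext)
  with D have "GDERIV (\<lambda>z. ln (p z)) x :> g" by (simp add: gderiv_def)
  with score_eqI[OF this] show ?thesis by simp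
qed

lemma slc_betweenI:
  assumes "p \<in> borel_measurable borel" "\<And>x. 0 < p x" "(\<integral>\<^sup>+x. ennreal (p x) \<partial>lborel) = 1"
    and g: "\<And>x. GDERIV (\<lambda>z. ln (p z)) x :> g x" and H: "\<And>x. (g has_derivative H x) (at x)"
    and "\<And>x h. m * (h \<bullet> h) \<le> - (h \<bullet> H x h)" "\<And>x h. - (h \<bullet> H x h) \<le> M * (h \<bullet> h)"
  shows "slc_between m M p"
proof -
  have "score p = g" using score_eqI[OF g] by (rule ext)
  moreover have "(\<lambda>z. ln (p z)) differentiable (at x)" for x
    using g[of x] unfolding gderiv_def differentiable_def by blast
  ultimately show ?thesis unfolding slc_between_def using assms by blast
qed

lemma score_continuous:
  assumes "slc_between m M p" shows "continuous_on UNIV (score p)"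
  unfolding continuous_on_eq_continuous_at[OF open_UNIV]
  using assms has_derivative_continuous unfolding slc_between_def by blast

lemma density_oracle_measurable:
  fixes p :: "'v::euclidean_space \<Rightarrow> real"
  assumes p: "slc_between m M p" and orc: "density_oracle vals p orc"
  shows "orc \<in> borel \<rightarrow>\<^sub>M borel"
proof -
  obtain c where c: "\<And>x. orc x = (score p x, if vals then ln (p x) + c else 0)"
    using orc unfolding density_oracle_def by blast
  have [measurable]: "score p \<in> borel_measurable borel" "p \<in> borel_measurable borel"
    using score_continuous[OF p] p by (auto simp: slc_between_def intro: borel_measurable_continuous_onI)
  have "(\<lambda>x. (score p x, if vals then ln (p x) + c else 0)) \<in> borel \<rightarrow>\<^sub>M borel \<Otimes>\<^sub>M borel"
    by measurable
  then show ?thesis unfolding borel_prod using c by (simp add: fun_eq_iff[symmetric] cong: measurable_cong)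
qed

text \<open>
  The conditional density of the previous state, with \<open>q\<close> as normalizing constant.
\<close>

definition backward_density :: "('v::euclidean_space \<Rightarrow> real) \<Rightarrow> real \<Rightarrow> real \<Rightarrow> real \<Rightarrow> 'v \<Rightarrow> 'v \<Rightarrow> real" where
  "backward_density p a r q y' y = p y * (gauss_kernel r (y' - a *\<^sub>R y) / q)"

context
  fixes p :: "'v::euclidean_space \<Rightarrow> real" and a r q :: real and y' :: 'v and m M :: real
  assumes p: "slc_between m M p" and r: "0 < r" and q: "0 < q"
begin

lemma backward_density_pos: "0 < backward_density p a r q y' y"
  using p r q gauss_kernel_pos[of r "y' - a *\<^sub>R y"] by (simp add: backward_density_def slc_between_def)

lemma ln_backward_density:
  "ln (backward_density p a r q y' y) = ln (p y) - (norm (y' - a *\<^sub>R y))\<^sup>2 / (2 * r\<^sup>2)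
     + (ln ((2 * pi * r\<^sup>2) powr (- real DIM('v) / 2)) - ln q)"
proof -
  define A where "A = (2 * pi * r\<^sup>2) powr (- real DIM('v) / 2)"
  have "0 < A" "0 < p y" using p r by (auto simp: A_def slc_between_def)
  then show ?thesis using q unfolding backward_density_def gauss_kernel_def A_def[symmetric]
    by (simp add: ln_mult ln_div)
qed

lemma gderiv_ln_backward_density:
  "GDERIV (\<lambda>y. ln (backward_density p a r q y' y)) y :> score p y - (a / r\<^sup>2) *\<^sub>R (a *\<^sub>R y - y')"
proof -
  have d: "((\<lambda>z. ln (p z)) has_derivative (\<lambda>h. h \<bullet> score p y)) (at y)"
    using gderiv_score[of p y] p unfolding slc_between_def gderiv_def by blast
  define L k where "L z = ln (p z)" and "k = ln ((2 * pi * r\<^sup>2) powr (- real DIM('v) / 2)) - ln q" for z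
  have dL: "(L has_derivative (\<lambda>h. h \<bullet> score p y)) (at y)" using d by (simp add: L_def[abs_def])
  have "((\<lambda>z. L z - ((y' - a *\<^sub>R z) \<bullet> (y' - a *\<^sub>R z)) / (2 * r\<^sup>2) + k) has_derivative
      (\<lambda>h. h \<bullet> score p y - (- 2 * a * (h \<bullet> (y' - a *\<^sub>R y))) / (2 * r\<^sup>2))) (at y)"
    using r by (auto intro!: derivative_eq_intros dL simp: fun_eq_iff inner_diff inner_commute field_simps)
  also have "(\<lambda>h. h \<bullet> score p y - (- 2 * a * (h \<bullet> (y' - a *\<^sub>R y))) / (2 * r\<^sup>2)) =
      (\<lambda>h. h \<bullet> (score p y - (a / r\<^sup>2) *\<^sub>R (a *\<^sub>R y - y')))"
    using r by (intro ext) (simp add: inner_diff_right, simp add: field_simps)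
  finally show ?thesis unfolding ln_backward_density gderiv_def power2_norm_eq_inner L_def k_def .
qed

lemma score_backward_density:
  "score (backward_density p a r q y') y = score p y - (a / r\<^sup>2) *\<^sub>R (a *\<^sub>R y - y')"
  by (rule score_eqI[OF gderiv_ln_backward_density])

text \<open>
  A Gaussian likelihood is log-concave with constant Hessian, so it shifts both bounds by the same
  amount.  The lower bound \<open>m\<close> may be negative: the shift is what restores strong log-concavity.
\<close>

lemma slc_between_backward_density:
  assumes "(\<integral>\<^sup>+x. ennreal (backward_density p a r q y' x) \<partial>lborel) = 1"
  shows "slc_between (m + a\<^sup>2 / r\<^sup>2) (M + a\<^sup>2 / r\<^sup>2) (backward_density p a r q y')"
proof -
  obtain H where H: "\<And>x. (score p has_derivative H x) (at x)"
    "\<And>x h. m * (h \<bullet> h) \<le> - (h \<bullet> H x h)" "\<And>x h. - (h \<bullet> H x h) \<le> M * (h \<bullet> h)"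
    using p unfolding slc_between_def by metis
  have [measurable]: "p \<in> borel_measurable borel" using p by (simp add: slc_between_def)
  show ?thesis
  proof (rule slc_betweenI[where g="\<lambda>y. score p y - (a / r\<^sup>2) *\<^sub>R (a *\<^sub>R y - y')"
        and H="\<lambda>x h. H x h - (a / r\<^sup>2) *\<^sub>R (a *\<^sub>R h)"])
    show "((\<lambda>y. score p y - (a / r\<^sup>2) *\<^sub>R (a *\<^sub>R y - y')) has_derivative (\<lambda>h. H x h - (a / r\<^sup>2) *\<^sub>R (a *\<^sub>R h))) (at x)" for x
      by (auto intro!: derivative_eq_intros H(1))
    have e: "- (h \<bullet> (H x h - (a / r\<^sup>2) *\<^sub>R (a *\<^sub>R h))) = - (h \<bullet> H x h) + a\<^sup>2 / r\<^sup>2 * (h \<bullet> h)" for x h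
      by (simp add: inner_diff_right power2_eq_square)
    show "(m + a\<^sup>2 / r\<^sup>2) * (h \<bullet> h) \<le> - (h \<bullet> (H x h - (a / r\<^sup>2) *\<^sub>R (a *\<^sub>R h)))"
      "- (h \<bullet> (H x h - (a / r\<^sup>2) *\<^sub>R (a *\<^sub>R h))) \<le> (M + a\<^sup>2 / r\<^sup>2) * (h \<bullet> h)" for x h
      unfolding e distrib_right using H(2,3)[of h x] by linarith+
  qed (use assms backward_density_pos gderiv_ln_backward_density in \<open>auto simp: backward_density_def[abs_def]\<close>)
qed

text \<open>
  The logarithm of the normalizing constant is absorbed into the additive constant
  that an oracle may choose freely.
\<close>

lemma density_oracle_backward:
  assumes "density_oracle vals p orc" and r2: "r\<^sup>2 = 1 - a\<^sup>2"
  shows "density_oracle vals (backward_density p a r q y') (\<lambda>y. backward_answer vals a y' y (orc y))"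
proof -
  obtain c where c: "\<And>x. orc x = (score p x, if vals then ln (p x) + c else 0)"
    using assms unfolding density_oracle_def by blast
  show ?thesis unfolding density_oracle_def
    by (intro exI[of _ "c - (ln ((2 * pi * r\<^sup>2) powr (- real DIM('v) / 2)) - ln q)"] allI)
      (simp add: backward_answer_def c score_backward_density ln_backward_density r2)
qed

end

text \<open>
  The covariance is positive semidefinite and bounded by its operator norm, which gives the upper and
  the lower bound respectively.
\<close>

lemma (in noised) slc_between_noised_density:
  assumes b: "\<And>y. onorm (cov_op (post y)) \<le> b"
    and 1: "(\<integral>\<^sup>+y. ennreal (noised_density \<mu> c s y) \<partial>lborel) = 1"
  shows "slc_between (1 / s\<^sup>2 - (c / s\<^sup>2)\<^sup>2 * b) (1 / s\<^sup>2) (noised_density \<mu> c s)"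
proof (rule slc_betweenI[OF noised_density_measurable noised_density_pos[OF s0] 1
      gderiv_ln_noised_density score_has_derivative])
  fix y h :: 'v
  have e: "- (h \<bullet> (- (1 / s\<^sup>2) *\<^sub>R h + (c / s\<^sup>2) *\<^sub>R ((c / s\<^sup>2) *\<^sub>R cov_op (post y) h))) =
      1 / s\<^sup>2 * (h \<bullet> h) - (c / s\<^sup>2)\<^sup>2 * (h \<bullet> cov_op (post y) h)"
    by (simp add: inner_diff_right inner_add_right power2_eq_square)
  have "h \<bullet> cov_op (post y) h \<le> b * (h \<bullet> h)"
    by (rule order_trans[OF cov_op_le]) (intro mult_right_mono b inner_ge_zero)
  then have "(c / s\<^sup>2)\<^sup>2 * (h \<bullet> cov_op (post y) h) \<le> (c / s\<^sup>2)\<^sup>2 * (b * (h \<bullet> h))" by (intro mult_left_mono) auto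
  then show "(1 / s\<^sup>2 - (c / s\<^sup>2)\<^sup>2 * b) * (h \<bullet> h) \<le>
      - (h \<bullet> (- (1 / s\<^sup>2) *\<^sub>R h + (c / s\<^sup>2) *\<^sub>R ((c / s\<^sup>2) *\<^sub>R cov_op (post y) h)))"
    unfolding e by (simp add: left_diff_distrib mult.assoc)
  show "- (h \<bullet> (- (1 / s\<^sup>2) *\<^sub>R h + (c / s\<^sup>2) *\<^sub>R ((c / s\<^sup>2) *\<^sub>R cov_op (post y) h))) \<le> 1 / s\<^sup>2 * (h \<bullet> h)"
    unfolding e using cov_op_nonneg[of h y] by simp
qed

lemma (in gaussian_channel) nn_integral_noised_density:
  "(\<integral>\<^sup>+y. ennreal (noised_density (distr M borel X) c s y) \<partial>lborel) = 1"
proof -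
  interpret D: prob_space "distr M borel Y" by (rule prob_space_distr) simp
  have "emeasure (density lborel (\<lambda>y. ennreal (noised_density (distr M borel X) c s y))) UNIV = 1"
    using D.emeasure_space_1 unfolding distr_Y by simp
  then show ?thesis by (simp add: emeasure_density)
qed

lemma (in gaussian_channel) posterior_eq_backward_density:
  assumes p: "slc_between m M' p" and lawX: "distr M borel X = density lborel (\<lambda>x. ennreal (p x))"
  shows "posterior (distr M borel X) c s y =
    density lborel (\<lambda>x. ennreal (backward_density p c s (noised_density (distr M borel X) c s y) y x))"
proof -
  have [measurable]: "p \<in> borel_measurable borel" and p0: "\<And>x. 0 \<le> p x"
    using p by (auto simp: slc_between_def less_imp_le)
  have q: "0 < noised_density (distr M borel X) c s y" using s by (intro law.noised_density_pos) simp
  show ?thesis unfolding posterior_def backward_density_def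
    using p0 q by (subst (1) lawX)
      (simp add: density_density_eq ennreal_mult gauss_kernel_nonneg del: times_divide_eq_right)
qed

lemma (in gaussian_channel) nn_integral_backward_density:
  assumes p: "slc_between m M' p" and lawX: "distr M borel X = density lborel (\<lambda>x. ennreal (p x))"
  shows "(\<integral>\<^sup>+x. ennreal (backward_density p c s (noised_density (distr M borel X) c s y) y x) \<partial>lborel) = 1"
proof -
  have [measurable]: "p \<in> borel_measurable borel" using p by (auto simp: slc_between_def)
  interpret D: prob_space "posterior (distr M borel X) c s y" using s by (intro law.prob_posterior) simp
  show ?thesis using D.emeasure_space_1 unfolding posterior_eq_backward_density[OF assms]
    by (simp add: emeasure_density backward_density_def)
qed

lemma (in gaussian_channel) cond_density_eq_backward_density:
  assumes p: "slc_between m M' p" and lawX: "distr M borel X = density lborel (\<lambda>x. ennreal (p x))"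
  shows "cond_density M X Y y = backward_density p c s (noised_density (distr M borel X) c s y) y"
proof -
  have q: "0 < noised_density (distr M borel X) c s y" using s by (intro law.noised_density_pos) simp
  have cp: "continuous_on UNIV p"
  proof -
    have "isCont p x" for x
    proof -
      have "isCont (\<lambda>z. exp (ln (p z))) x"
        using p unfolding slc_between_def
        by (intro isCont_exp' differentiable_imp_continuous_within) blast
      then show ?thesis using p by (simp add: slc_between_def)
    qed
    then show ?thesis by (simp add: continuous_on_eq_continuous_at)
  qed
  show ?thesis unfolding cond_density_def cond_law_eq_posterior
  proof (rule cont_density_eqI[OF _ _ posterior_eq_backward_density[OF assms]])
    show "continuous_on UNIV (backward_density p c s (noised_density (distr M borel X) c s y) y)"
      unfolding backward_density_def[abs_def] using q cp by (intro continuous_intros) auto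
  qed (use backward_density_pos[OF p s q] in \<open>auto intro: less_imp_le\<close>)
qed

section \<open>The Ornstein-Uhlenbeck chain as a family of Gaussian channels\<close>

text \<open>
  The noise accumulated by the chain, as a function of the sequence of inputs, so that its
  measurability with respect to a finite block of inputs can be expressed.
\<close>

primrec noise :: "(nat \<Rightarrow> real) \<Rightarrow> (nat \<Rightarrow> real) \<Rightarrow> (nat \<Rightarrow> 'v::real_vector) \<Rightarrow> nat \<Rightarrow> 'v" where
  "noise \<alpha> \<beta> w 0 = w 0"
| "noise \<alpha> \<beta> w (Suc j) = \<alpha> j *\<^sub>R noise \<alpha> \<beta> w j + \<beta> j *\<^sub>R w (Suc j)"

lemma noise_cong: "(\<And>i. i \<le> j \<Longrightarrow> w i = w' i) \<Longrightarrow> noise \<alpha> \<beta> w j = noise \<alpha> \<beta> w' j"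
  by (induction j) auto

lemma noise_measurable:
  assumes "Suc ` {..j} \<subseteq> A"
  shows "(\<lambda>z. noise \<alpha> \<beta> (\<lambda>i. z (Suc i)) j) \<in> PiM A (\<lambda>_. borel) \<rightarrow>\<^sub>M (borel :: 'v::euclidean_space measure)"
  using assms
proof (induction j)
  case 0
  then show ?case by (auto intro!: measurable_component_singleton)
next
  case (Suc j)
  have "Suc ` {..j} \<subseteq> A" using Suc.prems by (auto simp: image_subset_iff)
  note [measurable] = Suc.IH[OF this]
  have [measurable]: "(\<lambda>z. z (Suc (Suc j))) \<in> PiM A (\<lambda>_. borel) \<rightarrow>\<^sub>M (borel :: 'v measure)"
    using Suc.prems by (intro measurable_component_singleton) auto
  show ?case by simp
qed

text \<open>
  In the chain, the signal, the accumulated noise and the next input are functions of pairwise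
  disjoint blocks of one independent family.
\<close>

lemma (in prob_space) distr_Pair_of_blocks:
  assumes ind: "indep_vars (\<lambda>_. borel) Z UNIV" and AB: "A \<inter> B = {}"
    and F: "F \<in> PiM A (\<lambda>_. borel) \<rightarrow>\<^sub>M (borel :: 'v::euclidean_space measure)"
    and G: "G \<in> PiM B (\<lambda>_. borel) \<rightarrow>\<^sub>M (borel :: 'v measure)"
  shows "distr M (borel \<Otimes>\<^sub>M borel) (\<lambda>\<omega>. (F (restrict (\<lambda>i. Z i \<omega>) A), G (restrict (\<lambda>i. Z i \<omega>) B))) =
    distr M borel (\<lambda>\<omega>. F (restrict (\<lambda>i. Z i \<omega>) A)) \<Otimes>\<^sub>M distr M borel (\<lambda>\<omega>. G (restrict (\<lambda>i. Z i \<omega>) B))"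
proof -
  have "indep_var borel (F \<circ> (\<lambda>\<omega>. restrict (\<lambda>i. Z i \<omega>) A)) borel (G \<circ> (\<lambda>\<omega>. restrict (\<lambda>i. Z i \<omega>) B))"
    by (rule indep_var_compose[OF indep_var_restrict[OF ind AB] F G]) auto
  then show ?thesis unfolding indep_var_distribution_eq comp_def by auto
qed

locale ou_chain = prob_space M for M :: "'m measure" +
  fixes X :: "'m \<Rightarrow> 'v::euclidean_space" and W Y :: "nat \<Rightarrow> 'm \<Rightarrow> 'v" and a :: "nat \<Rightarrow> real" and K :: nat
  assumes X[measurable]: "X \<in> borel_measurable M"
    and W[measurable]: "\<And>k. W k \<in> borel_measurable M"
    and law_W: "\<And>k. distr M borel (W k) = std_gaussian"
    and indep: "indep_vars (\<lambda>_. borel) (case_nat X W) UNIV"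
    and Y1: "\<And>\<omega>. \<omega> \<in> space M \<Longrightarrow> Y 1 \<omega> = (1 / sqrt 2) *\<^sub>R X \<omega> + (1 / sqrt 2) *\<^sub>R W 0 \<omega>"
    and YSuc: "\<And>k \<omega>. 1 \<le> k \<Longrightarrow> k < K \<Longrightarrow> \<omega> \<in> space M \<Longrightarrow>
       Y (Suc k) \<omega> = a k *\<^sub>R Y k \<omega> + sqrt (1 - (a k)\<^sup>2) *\<^sub>R W k \<omega>"
    and a0: "a 0 = 1 / sqrt 2"
begin

definition scale :: "nat \<Rightarrow> real" where "scale k = (\<Prod>l<k. a l)"

definition sd :: "nat \<Rightarrow> real" where "sd k = sqrt (1 - (scale k)\<^sup>2)"

text \<open>
  Nondegeneracy of the stepsizes below \<open>k\<close>.  It cannot be assumed from the outset, because a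
  stepsize is given by a covariance bound whose sign is only known once the channel at
  its level has been identified.
\<close>

definition admissible :: "nat \<Rightarrow> bool" where
  "admissible k \<longleftrightarrow> (\<forall>l. 1 \<le> l \<and> l < k \<longrightarrow> a l \<noteq> 0 \<and> (a l)\<^sup>2 < 1)"

text \<open>
  \<open>keep\<close> and \<open>fresh\<close> are the weights of the old and of the new noise, normalized to unit variance.
  Indices are shifted by one because \<open>Y\<close> starts at level \<open>1\<close>.
\<close>

definition keep :: "nat \<Rightarrow> real" where "keep j = a (Suc j) * sd (Suc j) / sd (Suc (Suc j))"

definition fresh :: "nat \<Rightarrow> real" where "fresh j = sqrt (1 - (a (Suc j))\<^sup>2) / sd (Suc (Suc j))"

definition total_noise :: "nat \<Rightarrow> 'm \<Rightarrow> 'v" where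
  "total_noise k \<omega> = noise keep fresh (\<lambda>i. W i \<omega>) (k - 1)"

lemma scale_Suc: "scale (Suc k) = a k * scale k"
  by (simp add: scale_def)

lemma scale_sq: "(scale k)\<^sup>2 = (\<Prod>l<k. (a l)\<^sup>2)"
  by (simp add: scale_def prod_power_distrib)

lemma scale_bounds:
  assumes "1 \<le> k" "admissible k" shows "scale k \<noteq> 0" "(scale k)\<^sup>2 \<le> 1 / 2"
proof -
  have "scale k \<noteq> 0 \<and> (scale k)\<^sup>2 \<le> 1 / 2" using assms
  proof (induction k rule: nat_induct_at_least)
    case base
    show ?case by (simp add: scale_def a0 power_divide)
  next
    case (Suc k)
    then have IH: "scale k \<noteq> 0 \<and> (scale k)\<^sup>2 \<le> 1 / 2" and a: "a k \<noteq> 0" "(a k)\<^sup>2 < 1"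
      by (auto simp: admissible_def)
    have "(a k)\<^sup>2 * (scale k)\<^sup>2 \<le> 1 * (1 / 2)" using IH a by (intro mult_mono) auto
    then show ?case using IH a by (simp add: scale_Suc power_mult_distrib)
  qed
  then show "scale k \<noteq> 0" "(scale k)\<^sup>2 \<le> 1 / 2" by auto
qed

lemma sd_bounds:
  assumes "1 \<le> k" "admissible k" shows "0 < sd k" "(sd k)\<^sup>2 = 1 - (scale k)\<^sup>2"
  using scale_bounds[OF assms] unfolding sd_def by auto

lemma prob_std_gaussian: "prob_space (std_gaussian :: 'v measure)"
  using prob_space_distr[OF W[of 0]] by (simp add: law_W)

lemma Y_eq:
  assumes "1 \<le> k" "k \<le> K" "admissible k" "\<omega> \<in> space M"
  shows "Y k \<omega> = scale k *\<^sub>R X \<omega> + sd k *\<^sub>R total_noise k \<omega>"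
  using assms
proof (induction k rule: nat_induct_at_least)
  case base
  have "1 - 1 / 2 = (1 / 2 :: real)" by simp
  then show ?case using base Y1[of \<omega>]
    by (simp add: scale_def a0 sd_def total_noise_def power_divide real_sqrt_divide)
next
  case (Suc k)
  then obtain j where k: "k = Suc j" by (cases k) auto
  have sd: "0 < sd (Suc k)" using Suc.prems Suc.hyps by (intro sd_bounds) auto
  have "Y (Suc k) \<omega> = a k *\<^sub>R (scale k *\<^sub>R X \<omega> + sd k *\<^sub>R total_noise k \<omega>) + sqrt (1 - (a k)\<^sup>2) *\<^sub>R W k \<omega>"
    using Suc YSuc[of k \<omega>] by (simp add: admissible_def)
  also have "\<dots> = scale (Suc k) *\<^sub>R X \<omega> + sd (Suc k) *\<^sub>R total_noise (Suc k) \<omega>"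
    using sd by (simp add: total_noise_def keep_def fresh_def k scale_Suc scaleR_add_right)
  finally show ?case .
qed

lemma total_noise_measurable[measurable]: "total_noise k \<in> borel_measurable M"
proof -
  have "(\<lambda>\<omega>. noise \<alpha> \<beta> (\<lambda>i. W i \<omega>) j) \<in> borel_measurable M" for \<alpha> \<beta> j by (induction j) auto
  then show ?thesis unfolding total_noise_def[abs_def] .
qed

lemma Y_measurable: "1 \<le> k \<Longrightarrow> k \<le> K \<Longrightarrow> admissible k \<Longrightarrow> Y k \<in> borel_measurable M"
  by (subst measurable_cong[OF Y_eq]) auto

abbreviation "inputs \<omega> i \<equiv> case_nat X W i \<omega>"

lemma total_noise_eq_restrict:
  assumes "1 \<le> k" "Suc ` {..<k} \<subseteq> A"
  shows "total_noise k \<omega> = noise keep fresh (\<lambda>i. restrict (inputs \<omega>) A (Suc i)) (k - 1)"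
  unfolding total_noise_def using assms by (intro noise_cong) (auto simp: image_subset_iff)

lemma distr_X_total_noise:
  assumes "1 \<le> k"
  shows "distr M (borel \<Otimes>\<^sub>M borel) (\<lambda>\<omega>. (X \<omega>, total_noise k \<omega>)) = distr M borel X \<Otimes>\<^sub>M distr M borel (total_noise k)"
proof -
  let ?G = "\<lambda>z. noise keep fresh (\<lambda>i. z (Suc i)) (k - 1)"
  have "?G \<in> PiM (Suc ` {..<k}) (\<lambda>_. borel) \<rightarrow>\<^sub>M (borel :: 'v measure)"
    using assms by (intro noise_measurable) auto
  moreover have "(\<lambda>z. z 0) \<in> PiM {0} (\<lambda>_. borel) \<rightarrow>\<^sub>M (borel :: 'v measure)"
    by (intro measurable_component_singleton) auto
  moreover have "{0} \<inter> Suc ` {..<k} = {}" by auto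
  ultimately show ?thesis
    using distr_Pair_of_blocks[OF indep, of "{0}" "Suc ` {..<k}" "\<lambda>z. z 0" ?G]
    unfolding total_noise_eq_restrict[OF assms order_refl] by simp
qed

lemma distr_total_noise_W:
  assumes "1 \<le> k"
  shows "distr M (borel \<Otimes>\<^sub>M borel) (\<lambda>\<omega>. (total_noise k \<omega>, W k \<omega>)) = distr M borel (total_noise k) \<Otimes>\<^sub>M std_gaussian"
proof -
  let ?G = "\<lambda>z. noise keep fresh (\<lambda>i. z (Suc i)) (k - 1)"
  have "?G \<in> PiM (Suc ` {..<k}) (\<lambda>_. borel) \<rightarrow>\<^sub>M (borel :: 'v measure)"
    using assms by (intro noise_measurable) auto
  moreover have "(\<lambda>z. z (Suc k)) \<in> PiM {Suc k} (\<lambda>_. borel) \<rightarrow>\<^sub>M (borel :: 'v measure)"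
    by (intro measurable_component_singleton) auto
  moreover have "Suc ` {..<k} \<inter> {Suc k} = {}" by auto
  ultimately show ?thesis
    using distr_Pair_of_blocks[OF indep, of "Suc ` {..<k}" "{Suc k}" ?G "\<lambda>z. z (Suc k)"]
    unfolding total_noise_eq_restrict[OF assms order_refl] by (simp add: law_W)
qed

lemma distr_Y_W:
  assumes k: "1 \<le> k" "k \<le> K" "admissible k"
  shows "distr M (borel \<Otimes>\<^sub>M borel) (\<lambda>\<omega>. (Y k \<omega>, W k \<omega>)) = distr M borel (Y k) \<Otimes>\<^sub>M std_gaussian"
proof -
  let ?n = "\<lambda>z. noise keep fresh (\<lambda>i. z (Suc i)) (k - 1)"
  let ?F = "\<lambda>z. scale k *\<^sub>R z 0 + sd k *\<^sub>R ?n z"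
  have [measurable]: "?n \<in> PiM {..k} (\<lambda>_. borel) \<rightarrow>\<^sub>M (borel :: 'v measure)"
    using k by (intro noise_measurable) auto
  have [measurable]: "(\<lambda>z. z 0) \<in> PiM {..k} (\<lambda>_. borel) \<rightarrow>\<^sub>M (borel :: 'v measure)"
    by (intro measurable_component_singleton) auto
  have F: "?F \<in> PiM {..k} (\<lambda>_. borel) \<rightarrow>\<^sub>M (borel :: 'v measure)" by measurable
  have G: "(\<lambda>z. z (Suc k)) \<in> PiM {Suc k} (\<lambda>_. borel) \<rightarrow>\<^sub>M (borel :: 'v measure)"
    by (intro measurable_component_singleton) auto
  have sub: "Suc ` {..<k} \<subseteq> {..k}" by auto
  have Yk: "Y k \<omega> = ?F (restrict (inputs \<omega>) {..k})" if "\<omega> \<in> space M" for \<omega>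
    using Y_eq[OF k that] total_noise_eq_restrict[OF k(1) sub, of \<omega>] by simp
  have "distr M (borel \<Otimes>\<^sub>M borel) (\<lambda>\<omega>. (Y k \<omega>, W k \<omega>)) =
      distr M (borel \<Otimes>\<^sub>M borel) (\<lambda>\<omega>. (?F (restrict (inputs \<omega>) {..k}), restrict (inputs \<omega>) {Suc k} (Suc k)))"
    by (intro distr_cong) (auto simp: Yk)
  also have "\<dots> = distr M borel (\<lambda>\<omega>. ?F (restrict (inputs \<omega>) {..k})) \<Otimes>\<^sub>M
      distr M borel (\<lambda>\<omega>. restrict (inputs \<omega>) {Suc k} (Suc k))"
    by (rule distr_Pair_of_blocks[OF indep _ F G]) auto
  also have "distr M borel (\<lambda>\<omega>. ?F (restrict (inputs \<omega>) {..k})) = distr M borel (Y k)"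
    by (intro distr_cong) (auto simp: Yk)
  finally show ?thesis by (simp add: law_W)
qed

text \<open>
  Each step mixes the accumulated noise with fresh noise by coefficients whose squares sum to one.
\<close>

lemma law_total_noise: "1 \<le> k \<Longrightarrow> admissible k \<Longrightarrow> distr M borel (total_noise k) = std_gaussian"
proof (induction k rule: nat_induct_at_least)
  case base
  show ?case by (simp add: total_noise_def[abs_def] law_W)
next
  case (Suc k)
  then obtain j where k: "k = Suc j" by (cases k) auto
  have ad: "admissible k" and ak: "(a k)\<^sup>2 < 1" using Suc by (auto simp: admissible_def)
  have sd: "0 < sd (Suc k)" "(sd (Suc k))\<^sup>2 = 1 - (scale (Suc k))\<^sup>2" using Suc by (auto intro: sd_bounds)
  have sk: "(sd k)\<^sup>2 = 1 - (scale k)\<^sup>2" using Suc ad by (intro sd_bounds) auto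
  have "gaussian_channel M (total_noise k) (W k) (total_noise (Suc k)) (a k * sd k / sd (Suc k)) (sqrt (1 - (a k)\<^sup>2) / sd (Suc k))"
  proof (rule gaussian_channel.intro[OF prob_space_axioms gaussian_channel_axioms.intro])
    show "0 < sqrt (1 - (a k)\<^sup>2) / sd (Suc k)" using ak sd by simp
    show "distr M (borel \<Otimes>\<^sub>M borel) (\<lambda>\<omega>. (total_noise k \<omega>, W k \<omega>)) = distr M borel (total_noise k) \<Otimes>\<^sub>M std_gaussian"
      using Suc by (intro distr_total_noise_W) auto
    show "total_noise (Suc k) \<omega> = (a k * sd k / sd (Suc k)) *\<^sub>R total_noise k \<omega> + (sqrt (1 - (a k)\<^sup>2) / sd (Suc k)) *\<^sub>R W k \<omega>" for \<omega>
      by (simp add: total_noise_def keep_def fresh_def k)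
  qed (fact total_noise_measurable W prob_std_gaussian)+
  then show ?case
  proof (rule std_gaussian_rotation)
    show "distr M borel (total_noise k) = std_gaussian" using Suc ad by auto
    have "(a k * sd k / sd (Suc k))\<^sup>2 + (sqrt (1 - (a k)\<^sup>2) / sd (Suc k))\<^sup>2 =
        ((a k)\<^sup>2 * (sd k)\<^sup>2 + (1 - (a k)\<^sup>2)) / (sd (Suc k))\<^sup>2"
      using ak by (simp add: power_divide power_mult_distrib add_divide_distrib)
    also have "(a k)\<^sup>2 * (sd k)\<^sup>2 + (1 - (a k)\<^sup>2) = (sd (Suc k))\<^sup>2"
      unfolding sd sk by (simp add: scale_Suc power_mult_distrib algebra_simps)
    finally show "(a k * sd k / sd (Suc k))\<^sup>2 + (sqrt (1 - (a k)\<^sup>2) / sd (Suc k))\<^sup>2 = 1" using sd(1) by simp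
  qed
qed

lemma noising_channel:
  assumes k: "1 \<le> k" "k \<le> K" "admissible k"
  shows "gaussian_channel M X (total_noise k) (Y k) (scale k) (sd k)"
proof (rule gaussian_channel.intro[OF prob_space_axioms gaussian_channel_axioms.intro])
  show "distr M (borel \<Otimes>\<^sub>M borel) (\<lambda>\<omega>. (X \<omega>, total_noise k \<omega>)) = distr M borel X \<Otimes>\<^sub>M std_gaussian"
    using distr_X_total_noise[OF k(1)] law_total_noise[OF k(1,3)] by simp
qed (fact X total_noise_measurable prob_std_gaussian Y_eq[OF k] sd_bounds(1)[OF k(1,3)])+

lemma step_channel:
  assumes k: "1 \<le> k" "k < K" "admissible (Suc k)"
  shows "gaussian_channel M (Y k) (W k) (Y (Suc k)) (a k) (sqrt (1 - (a k)\<^sup>2))"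
proof (rule gaussian_channel.intro[OF prob_space_axioms gaussian_channel_axioms.intro])
  have ad: "admissible k" using k by (auto simp: admissible_def)
  show "distr M (borel \<Otimes>\<^sub>M borel) (\<lambda>\<omega>. (Y k \<omega>, W k \<omega>)) = distr M borel (Y k) \<Otimes>\<^sub>M std_gaussian"
    using k ad by (intro distr_Y_W) auto
  show "Y k \<in> borel_measurable M" using k ad by (intro Y_measurable) auto
  show "0 < sqrt (1 - (a k)\<^sup>2)" using k by (auto simp: admissible_def)
qed (fact W prob_std_gaussian YSuc[OF k(1,2)])+

end

section \<open>Condition numbers and the main theorem\<close>

text \<open>
  Here \<open>v = c\<^sup>2\<close> and \<open>1 - v = s\<^sup>2 \<ge> 1 / 2\<close>, so \<open>b v \<le> 1 / 8\<close> makes the covariance term at most a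
  quarter of \<open>1 / s\<^sup>2\<close>.
\<close>

lemma noised_condition_number:
  fixes v b :: real
  assumes "0 < v" "v \<le> 1 / 2" "0 \<le> b" "b * v \<le> 1 / 8"
  shows "0 < 1 / (1 - v) - v / (1 - v)\<^sup>2 * b"
    and "(1 / (1 - v)) / (1 / (1 - v) - v / (1 - v)\<^sup>2 * b) \<le> 4"
proof -
  define t where "t = 1 / (1 - v)"
  have t: "0 < t" "t \<le> 2" using assms by (auto simp: t_def field_simps)
  have e: "v / (1 - v)\<^sup>2 * b = t * (t * (b * v))" by (simp add: t_def power2_eq_square)
  have "t * (b * v) \<le> 2 * (1 / 8)" using t assms by (intro mult_mono) auto
  then have "t * (t * (b * v)) \<le> t * (1 / 4)" using t by (intro mult_left_mono) auto
  then show "0 < 1 / (1 - v) - v / (1 - v)\<^sup>2 * b"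
    "(1 / (1 - v)) / (1 / (1 - v) - v / (1 - v)\<^sup>2 * b) \<le> 4"
    unfolding e t_def[symmetric] using t by (auto simp: divide_le_eq)
qed

text \<open>
  With \<open>\<lambda> = 4 b v\<close>, the covariance term is at most \<open>\<lambda>\<close> because \<open>s\<^sup>2 \<ge> 1 / 2\<close>; the likelihood
  contributes \<open>A = 2 \<lambda> + 2\<close>, which dominates it.
\<close>

lemma backward_condition_number:
  fixes v b A :: real
  assumes v: "0 < v" "v \<le> 1 / 2" and b: "0 \<le> b" and A: "A = 2 * (4 * b * v) + 2"
  defines "m \<equiv> 1 / (1 - v) - v / (1 - v)\<^sup>2 * b + A" and "M \<equiv> 1 / (1 - v) + A"
  shows "0 < m" "m \<le> M" "M / m \<le> 4"
proof -
  define t where "t = 1 / (1 - v)"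
  have t: "1 \<le> t" "t \<le> 2" using v by (auto simp: t_def field_simps)
  have e: "v / (1 - v)\<^sup>2 * b = t * t * (b * v)" by (simp add: t_def power2_eq_square)
  have bv: "0 \<le> b * v" using v b by simp
  have "t * t * (b * v) \<le> 2 * 2 * (b * v)" using t bv by (intro mult_right_mono mult_mono) auto
  then have le: "t * t * (b * v) \<le> 4 * (b * v)" by simp
  have "0 \<le> t * t * (b * v)" using t bv by simp
  then show "0 < m" "m \<le> M" "M / m \<le> 4"
    unfolding m_def M_def e t_def[symmetric] A using t bv le by (auto simp: divide_le_eq)
qed

theorem theorem2:
  fixes M :: "'m measure"
    and X :: "'m \<Rightarrow> 'v::euclidean_space"
    and W Y :: "nat \<Rightarrow> 'm \<Rightarrow> 'v"
    and a B lam :: "nat \<Rightarrow> real"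
    and K :: nat
  assumes "prob_space M"
    and "X \<in> borel_measurable M"
    and "\<And>k. W k \<in> borel_measurable M"
    and "\<And>k. distr M borel (W k) = std_gaussian"
    and "prob_space.indep_vars M (\<lambda>_. borel) (case_nat X W) UNIV"
    and "\<And>\<omega>. \<omega> \<in> space M \<Longrightarrow> Y 1 \<omega> = (1 / sqrt 2) *\<^sub>R X \<omega> + (1 / sqrt 2) *\<^sub>R W 0 \<omega>"
    and "\<And>k \<omega>. 1 \<le> k \<Longrightarrow> k < K \<Longrightarrow> \<omega> \<in> space M \<Longrightarrow>
           Y (Suc k) \<omega> = a k *\<^sub>R Y k \<omega> + sqrt (1 - (a k)\<^sup>2) *\<^sub>R W k \<omega>"
    and "\<And>k. 1 \<le> k \<Longrightarrow> k \<le> K \<Longrightarrow> bdd_above (range (cond_cov_norm M X (Y k)))"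
    and "\<And>k. 1 \<le> k \<Longrightarrow> k \<le> K \<Longrightarrow> B k = (SUP y. cond_cov_norm M X (Y k) y)"
    and "a 0 = 1 / sqrt 2"
    and "\<And>k. 1 \<le> k \<Longrightarrow> k < K \<Longrightarrow> lam k = 4 * B k * (\<Prod>l<k. (a l)\<^sup>2)"
    and "\<And>k. 1 \<le> k \<Longrightarrow> k < K \<Longrightarrow> (a k)\<^sup>2 = (2 * lam k + 2) / (2 * lam k + 3)"
    and "1 \<le> K"
    and "B K = 0 \<or> (\<Prod>l<K. (a l)\<^sup>2) \<le> 1 / (8 * B K)"
  shows
    "slc 4 (rv_density M (Y K)) \<and>
     (\<forall>k. 1 \<le> k \<and> k < K \<longrightarrow> slc_family 4 (cond_density M (Y k) (Y (Suc k)))) \<and>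
     (\<forall>D \<in> {D_TV, D_KL}. \<forall>\<epsilon>>0. \<forall>vals N (S :: real \<Rightarrow> ('w, 'v, 'v \<times> real, 'v) procedure) orc.
        slc_sampler D vals N S \<and>
        (\<forall>k. 1 \<le> k \<and> k \<le> K \<longrightarrow> density_oracle vals (rv_density M (Y k)) (\<lambda>y. orc (k, y))) \<longrightarrow>
        samples_within D \<epsilon> (\<Sum>k=0..K. N (\<epsilon> / (real K + 1)))
          (sequential_sampler vals a K (S (\<epsilon> / (real K + 1)))) orc (distr M borel (Y 1)))"
proof -
  note bdd = assms(8) and Bk = assms(9) and lamk = assms(11) and ak = assms(12)
    and K = assms(13) and stop = assms(14)
  interpret ou_chain M X W Y a K
    by (rule ou_chain.intro[OF assms(1) ou_chain_axioms.intro[OF assms(2-7,10)]])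
  let ?\<mu> = "distr M borel X"
  have cov: "cond_cov_norm M X (Y k) y = onorm (cov_op (posterior ?\<mu> (scale k) (sd k) y))"
    and cov_nonneg: "0 \<le> cond_cov_norm M X (Y k) y" and noised: "noised ?\<mu> (scale k) (sd k)"
    if k: "1 \<le> k" "k \<le> K" "admissible k" for k y
  proof -
    interpret ch: gaussian_channel M X "total_noise k" "Y k" "scale k" "sd k" by (rule noising_channel[OF k])
    interpret n: noised ?\<mu> "scale k" "sd k"
      using scale_bounds[OF k(1,3)] sd_bounds[OF k(1,3)] by unfold_locales auto
    show "noised ?\<mu> (scale k) (sd k)" by unfold_locales
    show "cond_cov_norm M X (Y k) y = onorm (cov_op (posterior ?\<mu> (scale k) (sd k) y))"
      by (simp add: cond_cov_norm_def ch.cond_law_eq_posterior)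
    then show "0 \<le> cond_cov_norm M X (Y k) y" by (simp add: onorm_pos_le n.bounded_linear_cov_op)
  qed
  have B_ge: "cond_cov_norm M X (Y k) y \<le> B k" if "1 \<le> k" "k \<le> K" for k y
    unfolding Bk[OF that] by (intro cSUP_upper bdd that) auto
  have B0: "0 \<le> B k" if "1 \<le> k" "k \<le> K" "admissible k" for k
    using cov_nonneg[OF that, of 0] B_ge[OF that(1,2), of 0] by linarith
  have lam0: "0 \<le> lam k" if "1 \<le> k" "k < K" "admissible k" for k
    using that B0[of k] lamk[of k] by (simp add: prod_nonneg)
  \<comment> \<open>Levels are unlocked one at a time: an admissible level has a Gaussian channel, hence \<open>B k \<ge> 0\<close>,
    hence a stepsize with \<open>0 < (a k)\<^sup>2 < 1\<close>.\<close>
  have adm: "admissible k" if "k \<le> K" for k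
    using that
  proof (induction k)
    case (Suc k)
    have "a k \<noteq> 0 \<and> (a k)\<^sup>2 < 1" if "1 \<le> k"
    proof -
      have "0 \<le> lam k" using Suc that by (intro lam0) auto
      then have "0 < (a k)\<^sup>2 \<and> (a k)\<^sup>2 < 1" using ak[of k] Suc.prems that by simp
      then show ?thesis by auto
    qed
    then show ?case using Suc by (auto simp: admissible_def less_Suc_eq)
  qed (simp add: admissible_def)
  define p where "p k = noised_density ?\<mu> (scale k) (sd k)" for k
  define m\<^sub>0 where "m\<^sub>0 k = 1 / (sd k)\<^sup>2 - (scale k / (sd k)\<^sup>2)\<^sup>2 * B k" for k
  define M\<^sub>0 where "M\<^sub>0 k = 1 / (sd k)\<^sup>2" for k
  have p_slc: "slc_between (m\<^sub>0 k) (M\<^sub>0 k) (p k)" and law_Y: "distr M borel (Y k) = density lborel (\<lambda>y. ennreal (p k y))"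
    and p_rv: "rv_density M (Y k) = p k" if k: "1 \<le> k" "k \<le> K" for k
  proof -
    note k' = k adm[OF k(2)]
    interpret ch: gaussian_channel M X "total_noise k" "Y k" "scale k" "sd k" by (rule noising_channel[OF k'])
    interpret n: noised ?\<mu> "scale k" "sd k" by (rule noised[OF k'])
    show "slc_between (m\<^sub>0 k) (M\<^sub>0 k) (p k)" unfolding m\<^sub>0_def M\<^sub>0_def p_def
      using B_ge[OF k] unfolding cov[OF k']
      by (rule n.slc_between_noised_density[OF _ ch.nn_integral_noised_density])
    show "distr M borel (Y k) = density lborel (\<lambda>y. ennreal (p k y))" unfolding p_def by (rule ch.distr_Y)
    show "rv_density M (Y k) = p k" unfolding p_def by (rule ch.rv_density_eq)
  qed
  have m\<^sub>0_eq: "m\<^sub>0 k = 1 / (1 - (scale k)\<^sup>2) - (scale k)\<^sup>2 / (1 - (scale k)\<^sup>2)\<^sup>2 * B k"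
    "M\<^sub>0 k = 1 / (1 - (scale k)\<^sup>2)" if "1 \<le> k" "k \<le> K" for k
    using sd_bounds[OF that(1) adm[OF that(2)]] by (auto simp: m\<^sub>0_def M\<^sub>0_def power_divide)
  have v: "0 < (scale k)\<^sup>2" "(scale k)\<^sup>2 \<le> 1 / 2" "0 \<le> B k" if "1 \<le> k" "k \<le> K" for k
    using scale_bounds[OF that(1) adm[OF that(2)]] B0[OF that adm[OF that(2)]] by auto
  have top: "slc 4 (p K)"
  proof -
    have "B K * (scale K)\<^sup>2 \<le> 1 / 8"
      using stop v(3)[of K] K by (cases "B K = 0") (auto simp: scale_sq[symmetric] field_simps)
    note c = noised_condition_number[OF v[OF K order_refl] this]
    have "m\<^sub>0 K \<le> M\<^sub>0 K" using v(3)[of K] K by (simp add: m\<^sub>0_def M\<^sub>0_def)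
    then show ?thesis unfolding slc_def
      using p_slc[OF K order_refl] c[folded m\<^sub>0_eq[OF K order_refl]] by blast
  qed
  define r where "r k = sqrt (1 - (a k)\<^sup>2)" for k
  define q where "q k y = noised_density (distr M borel (Y k)) (a k) (r k) y" for k y
  define h where "h k y = backward_density (p k) (a k) (r k) (q k y) y" for k y
  have r: "0 < r k" "(r k)\<^sup>2 = 1 - (a k)\<^sup>2" if "1 \<le> k" "k < K" for k
    using adm[of "Suc k"] that by (auto simp: r_def admissible_def)
  have channel: "gaussian_channel M (Y k) (W k) (Y (Suc k)) (a k) (r k)" if "1 \<le> k" "k < K" for k
    unfolding r_def using that adm[of "Suc k"] by (intro step_channel) auto
  have q: "0 < q k y" and h_slc: "slc_between (m\<^sub>0 k + (a k)\<^sup>2 / (r k)\<^sup>2) (M\<^sub>0 k + (a k)\<^sup>2 / (r k)\<^sup>2) (h k y)"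
    and h_cond: "cond_density M (Y k) (Y (Suc k)) y = h k y"
    and h_post: "posterior (distr M borel (Y k)) (a k) (r k) y = density lborel (\<lambda>x. ennreal (h k y x))"
    and kernel: "posterior (distr M borel (Y k)) (a k) (r k) \<in> borel \<rightarrow>\<^sub>M prob_algebra borel"
    and law_bind: "distr M borel (Y k) = distr M borel (Y (Suc k)) \<bind> posterior (distr M borel (Y k)) (a k) (r k)"
    if k: "1 \<le> k" "k < K" for k y
  proof -
    interpret ch: gaussian_channel M "Y k" "W k" "Y (Suc k)" "a k" "r k" by (rule channel[OF k])
    have k': "k \<le> K" using k by simp
    note pk = p_slc[OF k(1) k'] law_Y[OF k(1) k']
    have r0: "r k \<noteq> 0" using r(1)[OF k] by simp
    show q: "0 < q k y" unfolding q_def by (rule ch.law.noised_density_pos[OF r0])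
    show "slc_between (m\<^sub>0 k + (a k)\<^sup>2 / (r k)\<^sup>2) (M\<^sub>0 k + (a k)\<^sup>2 / (r k)\<^sup>2) (h k y)" unfolding h_def
      using ch.nn_integral_backward_density[OF pk, of y]
      by (intro slc_between_backward_density pk r(1)[OF k] q) (simp add: q_def)
    show "cond_density M (Y k) (Y (Suc k)) y = h k y" unfolding h_def q_def
      by (rule ch.cond_density_eq_backward_density[OF pk])
    show "posterior (distr M borel (Y k)) (a k) (r k) y = density lborel (\<lambda>x. ennreal (h k y x))"
      unfolding h_def q_def by (rule ch.posterior_eq_backward_density[OF pk])
    show "posterior (distr M borel (Y k)) (a k) (r k) \<in> borel \<rightarrow>\<^sub>M prob_algebra borel"
      by (rule ch.law.posterior_kernel[OF r0])
    show "distr M borel (Y k) = distr M borel (Y (Suc k)) \<bind> posterior (distr M borel (Y k)) (a k) (r k)"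
      by (rule ch.distr_X_eq_bind)
  qed
  \<comment> \<open>the choice of the stepsize gives \<open>(a k)\<^sup>2 / (1 - (a k)\<^sup>2) = 2 (lam k) + 2\<close>\<close>
  have bounds: "0 < m\<^sub>0 k + (a k)\<^sup>2 / (r k)\<^sup>2 \<and> m\<^sub>0 k + (a k)\<^sup>2 / (r k)\<^sup>2 \<le> M\<^sub>0 k + (a k)\<^sup>2 / (r k)\<^sup>2 \<and>
      (M\<^sub>0 k + (a k)\<^sup>2 / (r k)\<^sup>2) / (m\<^sub>0 k + (a k)\<^sup>2 / (r k)\<^sup>2) \<le> 4" if k: "1 \<le> k" "k < K" for k
  proof -
    have k': "k \<le> K" using k by simp
    have l: "0 \<le> lam k" using k adm by (intro lam0) auto
    have "(a k)\<^sup>2 / (r k)\<^sup>2 = 2 * lam k + 2"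
      unfolding r(2)[OF k] ak[OF k] using l by (simp add: field_simps)
    also have "\<dots> = 2 * (4 * B k * (scale k)\<^sup>2) + 2" by (simp add: lamk[OF k] scale_sq)
    finally have "(a k)\<^sup>2 / (r k)\<^sup>2 = 2 * (4 * B k * (scale k)\<^sup>2) + 2" .
    from backward_condition_number[OF v[OF k(1) k'] this] show ?thesis
      unfolding m\<^sub>0_eq[OF k(1) k'] by blast
  qed
  have fam: "slc_family 4 (h k)" if k: "1 \<le> k" "k < K" for k
    unfolding slc_family_def using bounds[OF k] h_slc[OF k] by blast
  have "samples_within D \<epsilon> (\<Sum>k=0..K. N (\<epsilon> / (real K + 1)))
          (sequential_sampler vals a K (S (\<epsilon> / (real K + 1)))) orc (distr M borel (Y 1))"
    if D: "D \<in> {D_TV, D_KL}" and \<epsilon>: "0 < \<epsilon>" and S: "slc_sampler D vals N S"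
      and orc: "\<And>k. 1 \<le> k \<Longrightarrow> k \<le> K \<Longrightarrow> density_oracle vals (rv_density M (Y k)) (\<lambda>y. orc (k, y))"
    for D \<epsilon> vals N orc and S :: "real \<Rightarrow> ('w, 'v, 'v \<times> real, 'v) procedure"
  proof -
    define \<delta> where "\<delta> = \<epsilon> / (real K + 1)"
    have \<delta>: "0 < \<delta>" "real K * \<delta> \<le> \<epsilon>" using \<epsilon> by (auto simp: \<delta>_def field_simps)
    have orc': "density_oracle vals (p k) (\<lambda>y. orc (k, y))" if "1 \<le> k" "k \<le> K" for k
      using orc[OF that] by (simp add: p_rv[OF that])
    have post: "posterior (distr M borel (Y k)) (a k) (r k) = (\<lambda>y. density lborel (\<lambda>x. ennreal (h k y x)))"
      if "1 \<le> k" "k < K" for k by (rule ext) (rule h_post[OF that])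
    have "samples_within D (real K * \<delta>) (real K * N \<delta>) (sequential_sampler vals a K (S \<delta>)) orc (distr M borel (Y 1))
        \<and> 0 \<le> N \<delta>"
    proof (rule samples_within_sequential_sampler[where f="p K" and h=h and p="\<lambda>k. distr M borel (Y k)"])
      show "bind_stable D" using D by (rule bind_stable_TV_KL)
      show "(\<lambda>y. orc (k, y)) \<in> borel \<rightarrow>\<^sub>M borel" if "1 \<le> k" "k \<le> K" for k
        using p_slc[OF that] orc'[OF that] by (rule density_oracle_measurable)
      show "density_oracle vals (p K) (\<lambda>y. orc (K, y))" using orc' K by simp
      show "slc 4 (h k y)" if "1 \<le> k" "k < K" for k y
        unfolding slc_def using bounds[OF that] h_slc[OF that] by blast
      show "density_oracle vals (h k y') (\<lambda>y. backward_answer vals (a k) y' y (orc (k, y)))"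
        if k: "1 \<le> k" "k < K" for k y'
        unfolding h_def using k orc'[of k]
        by (intro density_oracle_backward[OF p_slc r(1)[OF k] q[OF k] _ r(2)[OF k]]) auto
      show "distr M borel (Y k) \<in> space (prob_algebra borel)" if "1 \<le> k" "k \<le> K" for k
        using Y_measurable[OF that adm[OF that(2)]] by (auto simp: space_prob_algebra intro: prob_space_distr)
      show "distr M borel (Y K) = density lborel (\<lambda>x. ennreal (p K x))" using law_Y K by simp
      show "(\<lambda>y'. density lborel (\<lambda>x. ennreal (h k y' x))) \<in> borel \<rightarrow>\<^sub>M prob_algebra borel"
        if "1 \<le> k" "k < K" for k using kernel[OF that] unfolding post[OF that] .
      show "distr M borel (Y k) = distr M borel (Y (Suc k)) \<bind> (\<lambda>y'. density lborel (\<lambda>x. ennreal (h k y' x)))"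
        if "1 \<le> k" "k < K" for k using law_bind[OF that] unfolding post[OF that] .
    qed (use S \<delta> K top in auto)
    then have acc: "D (output_law (sequential_sampler vals a K (S \<delta>)) orc) (distr M borel (Y 1)) \<le> ereal (real K * \<delta>)"
      and cost: "real K * N \<delta> \<le> (\<Sum>k=0..K. N \<delta>)"
      and rest: "samples_within D (real K * \<delta>) (real K * N \<delta>) (sequential_sampler vals a K (S \<delta>)) orc (distr M borel (Y 1))"
      by (auto simp: samples_within_def algebra_simps)
    have "D (output_law (sequential_sampler vals a K (S \<delta>)) orc) (distr M borel (Y 1)) \<le> ereal \<epsilon>"
      using acc \<delta>(2) by (meson ereal_less_eq(3) order_trans)
    then show ?thesis using rest cost unfolding samples_within_def \<delta>_def[symmetric]
      by (meson order_trans)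
  qed
  moreover have "slc_family 4 (cond_density M (Y k) (Y (Suc k)))" if k: "1 \<le> k" "k < K" for k
  proof -
    have "cond_density M (Y k) (Y (Suc k)) = h k" by (rule ext) (rule h_cond[OF k])
    then show ?thesis using fam[OF k] by simp
  qed
  moreover have "slc 4 (rv_density M (Y K))" using top by (simp add: p_rv[OF K order_refl])
  ultimately show ?thesis by blast
qed

end
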